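(* Let $g>0$, let $m_{\mathcal I}\in\mathbb{R}^3$ be a constant vector with $m_{\mathcal I}\times e_3\neq 0$, and let $k_1^v,k_2^v,k_1^r,k_2^r$ be positive constants. Consider the system $$\dot v = v\times\omega + a_{\mathcal B} + gR^Te_3,\qquad \dot R = R\,\omega_\times$$ with state $(v,R)\in\mathbb{R}^3\times \mathrm{SO}(3)$ and measurements $(v,\omega,a_{\mathcal B},m_{\mathcal B})$, where $m_{\mathcal B}=R^Tm_{\mathcal I}$, and the observer (Observer 2) with state $(\hat v,\hat R)\in\mathbb{R}^3\times\mathrm{SO}(3)$, $$\dot{\hat v}=\hat v\times\omega+a_{\mathcal B}+g\hat R^Te_3+\sigma_v,\qquad \dot{\hat R}=\hat R(\omega+\sigma_R)_\times,$$ $$\sigma_v = k_1^v\tilde v-k_2^v\,\hat\gamma\times(\hat\gamma\times\tilde v)-k_1^r\,\tilde v\times(\tilde v\times\hat\gamma),\qquad \sigma_R = k_1^r\,\tilde v\times\hat\gamma+k_2^r\big((m_{\mathcal B}\times\hat m_{\mathcal B})^T\hat\gamma\big)\hat\gamma,$$ where $\tilde v=v-\hat v$, $\hat\gamma=\hat R^Te_3$, $\hat m_{\mathcal B}=\hat R^Tm_{\mathcal I}$. Define the errors $\bar v=R(v-\hat v)$ and $\bar R=R\hat R^T$. Then: 1. The dynamics of the errors $(\bar v,\bar R)$ have only four isolated equilibria, one of which is $(\bar v,\bar R)=(0,I)$. 2. The equilibrium $(\bar v,\bar R)=(0,I)$ is locally exponentially stable and almost globally asymptotically stable, and the other three equilibria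 of $(\bar v,\bar R)$ are unstable. Thus, for almost all initial conditions $(\hat v(0),\hat R(0))$, the trajectory $(\hat v(t),\hat R(t))$ converges to the system trajectory $(v(t),R(t))$. 3. The dynamics of $(\hat v,\hat R^Te_3)$ are independent of $m_{\mathcal B}$.
   Context: $\{e_1,e_2,e_3\}$ is the canonical basis of $\mathbb{R}^3$; for $u\in\mathbb{R}^3$, $u_\times$ is the skew-symmetric matrix with $u_\times w=u\times w$ for all $w\in\mathbb{R}^3$; $I$ is the $3\times3$ identity matrix. $R$ is the attitude of a rigid vehicle (rotation from the body-fixed frame to the inertial frame), $v$ its linear velocity, $\omega$ its angular velocity and $a_{\mathcal B}$ its specific acceleration, all three expressed in the body frame (time-varying signals); $g$ is the gravitational acceleration constant and $m_{\mathcal I}$ the Earth's magnetic field in the inertial frame. The dynamics of the errors $(\bar v,\bar R)$ are the autonomous system on $\mathbb{R}^3\times\mathrm{SO}(3)$ $$\dot{\bar v}=g(I-\bar R)e_3-\bar\sigma_v,\qquad \dot{\bar R}=-(\bar\sigma_R)_\times\bar R,$$ $$\bar\sigma_v=k_1^v\bar v-k_2^v(\bar Re_3)\times((\bar Re_3)\times\bar v)-k_1^r\,\bar v\times(\bar v\times\bar Re_3),$$ $$\bar\sigma_R=k_1^r\,\bar v\times\bar Re_3+k_2^r\big((m_{\mathcal I}\times\bar Rm_{\mathcal I})^T\bar Re_3\big)\bar Re_3 .$$ An equilibrium is almost globally asymptotically stable if it is (Lyapunov) stable and attracts all trajectories except those starting in a set of measure zero. "The trajectory $(\hat v,\hat R)$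 converges to $(v,R)$" means $(\bar v(t),\bar R(t))\to(0,I)$ as $t\to\infty$. "Independent of $m_{\mathcal B}$" means that the time derivatives of $\hat v$ and $\hat R^Te_3$ can be expressed as functions of $\hat v,\hat R^Te_3,v,\omega,a_{\mathcal B}$ (and the constants) in which $m_{\mathcal B}$ does not appear. *)

theory Defs
  imports "HOL-Analysis.Analysis"
begin

unbundle cross3_syntax

type_synonym state = "(real^3) \<times> (real^3^3)"

definition state_space :: "state set" where
  "state_space = {(v, R). rotation_matrix R}"

definition e3 :: "real^3" where
  "e3 = axis 3 1"

definition skew :: "real^3 \<Rightarrow> real^3^3" where
  "skew u = matrix (\<lambda>w. u \<times> w)"

lemma skew_mult_vector: "skew u *v w = u \<times> w"
proof -
  have "linear (\<lambda>w. u \<times> w)"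
    by (intro linearI) (simp_all add: cross_add_right cross_mult_right)
  then show ?thesis
    by (simp add: skew_def matrix_works)
qed



subsection \<open>Solutions and stability notions on a subset of a normed space\<close>

definition solution_on ::
    "'a::real_normed_vector set \<Rightarrow> (real \<Rightarrow> 'a \<Rightarrow> 'a) \<Rightarrow> real set \<Rightarrow> (real \<Rightarrow> 'a) \<Rightarrow> bool" where
  "solution_on M f J x \<longleftrightarrow>
     (\<forall>t\<in>J. x t \<in> M \<and> (x has_vector_derivative f t (x t)) (at t within J))"

definition equilibria :: "'a::real_normed_vector set \<Rightarrow> ('a \<Rightarrow> 'a) \<Rightarrow> 'a set" where
  "equilibria M f = {x \<in> M. f x = 0}"

text \<open>Stability is tested on solutions over every compact horizon \<open>[0, T]\<close>, so that a solution
  that cannot be extended to \<open>[0, \<infinity>)\<close> is not exempt.\<close>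

definition stable_equilibrium ::
    "'a::real_normed_vector set \<Rightarrow> ('a \<Rightarrow> 'a) \<Rightarrow> 'a \<Rightarrow> bool" where
  "stable_equilibrium M f p \<longleftrightarrow> p \<in> equilibria M f \<and>
     (\<forall>\<epsilon>>0. \<exists>\<delta>>0. \<forall>T>0. \<forall>x. solution_on M (\<lambda>_. f) {0..T} x \<and> dist (x 0) p < \<delta> \<longrightarrow>
        (\<forall>t\<in>{0..T}. dist (x t) p < \<epsilon>))"

definition unstable_equilibrium ::
    "'a::real_normed_vector set \<Rightarrow> ('a \<Rightarrow> 'a) \<Rightarrow> 'a \<Rightarrow> bool" where
  "unstable_equilibrium M f p \<longleftrightarrow> p \<in> equilibria M f \<and> \<not> stable_equilibrium M f p"

definition locally_exponentially_stable ::
    "'a::real_normed_vector set \<Rightarrow> ('a \<Rightarrow> 'a) \<Rightarrow> 'a \<Rightarrow> bool" where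
  "locally_exponentially_stable M f p \<longleftrightarrow> p \<in> equilibria M f \<and>
     (\<exists>\<delta>>0. \<exists>C>0. \<exists>r>0. \<forall>T>0. \<forall>x. solution_on M (\<lambda>_. f) {0..T} x \<and> dist (x 0) p < \<delta> \<longrightarrow>
        (\<forall>t\<in>{0..T}. dist (x t) p \<le> C * exp (- r * t) * dist (x 0) p))"

definition attracted ::
    "'a::real_normed_vector set \<Rightarrow> ('a \<Rightarrow> 'a) \<Rightarrow> 'a \<Rightarrow> 'a \<Rightarrow> bool" where
  "attracted M f p x0 \<longleftrightarrow>
     (\<exists>x. solution_on M (\<lambda>_. f) {0..} x \<and> x 0 = x0) \<and>
     (\<forall>x. solution_on M (\<lambda>_. f) {0..} x \<and> x 0 = x0 \<longrightarrow> (x \<longlongrightarrow> p) at_top)"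


subsection \<open>Measure zero in the six-dimensional manifold \<open>state_space\<close>\<close>

text \<open>\<open>\<phi>\<close> is the inverse of a \<open>C\<^sup>1\<close> chart of the embedded submanifold \<open>state_space\<close>. A subset of a
  manifold has measure zero if its image under every chart is a Lebesgue null set.\<close>

definition local_parametrization ::
    "((real^3) \<times> (real^3)) set \<Rightarrow> ((real^3) \<times> (real^3) \<Rightarrow> state) \<Rightarrow> bool" where
  "local_parametrization U \<phi> \<longleftrightarrow>
     open U \<and> \<phi> ` U \<subseteq> state_space \<and> openin (top_of_set state_space) (\<phi> ` U) \<and>
     (\<exists>\<psi>. homeomorphism U (\<phi> ` U) \<phi> \<psi>) \<and>
     (\<exists>D :: (real^3) \<times> (real^3) \<Rightarrow> ((real^3) \<times> (real^3)) \<Rightarrow>\<^sub>L state.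
        continuous_on U D \<and>
        (\<forall>u\<in>U. (\<phi> has_derivative blinfun_apply (D u)) (at u) \<and> inj (blinfun_apply (D u))))"

definition measure_zero :: "state set \<Rightarrow> bool" where
  "measure_zero N \<longleftrightarrow> (\<forall>U \<phi>. local_parametrization U \<phi> \<longrightarrow> negligible {u \<in> U. \<phi> u \<in> N})"

definition almost_globally_asymptotically_stable :: "(state \<Rightarrow> state) \<Rightarrow> state \<Rightarrow> bool" where
  "almost_globally_asymptotically_stable f p \<longleftrightarrow> stable_equilibrium state_space f p \<and>
     measure_zero {x0 \<in> state_space. \<not> attracted state_space f p x0}"


subsection \<open>The vehicle, the observer and the errors\<close>

definition system_field ::
    "real \<Rightarrow> (real \<Rightarrow> real^3) \<Rightarrow> (real \<Rightarrow> real^3) \<Rightarrow> real \<Rightarrow> state \<Rightarrow> state" where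
  "system_field g \<omega> a t = (\<lambda>(v, R).
     (v \<times> \<omega> t + a t + g *\<^sub>R (transpose R *v e3), R ** skew (\<omega> t)))"

text \<open>The same expressions give \<open>\<sigma>\<^sub>v\<close>, \<open>\<sigma>\<^sub>R\<close> (body frame) and their inertial-frame counterparts
  in the error dynamics.\<close>

definition sigma_v :: "real \<Rightarrow> real \<Rightarrow> real \<Rightarrow> real^3 \<Rightarrow> real^3 \<Rightarrow> real^3" where
  "sigma_v k1v k2v k1r w \<gamma> =
     k1v *\<^sub>R w - k2v *\<^sub>R (\<gamma> \<times> (\<gamma> \<times> w)) - k1r *\<^sub>R (w \<times> (w \<times> \<gamma>))"

definition sigma_R :: "real \<Rightarrow> real \<Rightarrow> real^3 \<Rightarrow> real^3 \<Rightarrow> real^3 \<Rightarrow> real^3 \<Rightarrow> real^3" where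
  "sigma_R k1r k2r w \<gamma> m mhat =
     k1r *\<^sub>R (w \<times> \<gamma>) + (k2r * ((m \<times> mhat) \<bullet> \<gamma>)) *\<^sub>R \<gamma>"

text \<open>The inputs \<open>v\<close>, \<open>\<omega>\<close>, \<open>a\<close>, \<open>mB\<close> are the measured signals; \<open>mI\<close> is the known inertial
  magnetic field.\<close>

definition observer_field ::
    "real \<Rightarrow> real \<Rightarrow> real \<Rightarrow> real \<Rightarrow> real \<Rightarrow> real^3 \<Rightarrow>
     (real \<Rightarrow> real^3) \<Rightarrow> (real \<Rightarrow> real^3) \<Rightarrow> (real \<Rightarrow> real^3) \<Rightarrow> (real \<Rightarrow> real^3) \<Rightarrow>
     real \<Rightarrow> state \<Rightarrow> state" where
  "observer_field g k1v k2v k1r k2r mI v \<omega> a mB t = (\<lambda>(vh, Rh).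
     let \<gamma> = transpose Rh *v e3;
         w = v t - vh
     in (vh \<times> \<omega> t + a t + g *\<^sub>R \<gamma> + sigma_v k1v k2v k1r w \<gamma>,
         Rh ** skew (\<omega> t + sigma_R k1r k2r w \<gamma> (mB t) (transpose Rh *v mI))))"

definition error_state :: "state \<Rightarrow> state \<Rightarrow> state" where
  "error_state = (\<lambda>(v, R) (vh, Rh). (R *v (v - vh), R ** transpose Rh))"

definition error_field ::
    "real \<Rightarrow> real \<Rightarrow> real \<Rightarrow> real \<Rightarrow> real \<Rightarrow> real^3 \<Rightarrow> state \<Rightarrow> state" where
  "error_field g k1v k2v k1r k2r mI = (\<lambda>(w, Q).
     (g *\<^sub>R ((mat 1 - Q) *v e3) - sigma_v k1v k2v k1r w (Q *v e3),
      - (skew (sigma_R k1r k2r w (Q *v e3) mI (Q *v mI)) ** Q)))"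

end

theory Submission
  imports Defs
begin

text \<open>Put \<open>\<eta> = Q e3\<close> and split the velocity error into \<open>hor\<close>, orthogonal to \<open>\<eta>\<close>, and
  \<open>vert \<eta>\<close>. Then \<open>(hor, \<eta>)\<close> is an autonomous damped spherical pendulum, \<open>vert\<close> is a stable linear
  filter driven by \<open>\<eta>\<close>, and the remaining heading angle obeys a perturbed scalar equation, seen through
  its sine \<open>sn\<close> and cosine \<open>cn\<close>. Barbalat's argument gives \<open>\<eta> \<longrightarrow> e3\<close> or \<open>\<eta> \<longrightarrow> - e3\<close>, and in the
  first case \<open>cn \<longrightarrow> M\<close> (convergence to the identity) or \<open>cn \<longrightarrow> - M\<close>. Two trajectories that stay
  near an unstable equilibrium satisfy a cone condition, since a difference dominated by its unstable
  part would grow exponentially; hence such states lie on a Lipschitz graph of positive codimension.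
  The backward flow is locally Lipschitz, so the exceptional set is a countable union of null sets.\<close>

subsection \<open>Differential inequalities and global solutions\<close>

text \<open>The decoupling rests on one gain: \<open>k1r\<close> weights both the last term of
  \<open>sigma_v\<close> and the tilt part of \<open>sigma_R\<close>, so every product of
  \<open>vert\<close> and \<open>hor\<close> cancels in the derivatives, and \<open>m\<close> acts
  on the heading alone. The energy of the pendulum yields no exponential rate, since it is
  dissipated only through \<open>hor\<close>; near the upper pole a quadratic form with a small
  cross term replaces it. No invariant manifold is constructed: every estimate near an equilibrium
  concerns the difference of two trajectories. With the second one constant it gives exponential
  stability of the identity, with both free it gives the graph. Two obstacles shape the rest.
  Measure zero is demanded in every chart, so smallness is carried by maps into the six-dimensional
  model space with Lipschitz inverse, which can be pulled back along the flow and through charts.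
  And the graph condition holds only for trajectories that stay near the equilibrium from some time
  \<open>n\<close> on, with constants that depend on a bound \<open>\<rho>\<close> of the initial
  state, because \<open>f\<close> is quadratic in the velocity; hence the countable union over
  \<open>n\<close> and \<open>\<rho>\<close>.\<close>

lemma nonneg_derivative_imp_le:
  fixes f f' :: "real \<Rightarrow> real"
  assumes "a \<le> b" "{a..b} \<subseteq> J"
    and f: "\<And>t. t \<in> {a..b} \<Longrightarrow> (f has_real_derivative f' t) (at t within J)"
    and nn: "\<And>t. t \<in> {a..b} \<Longrightarrow> f' t \<ge> 0"
  shows "f a \<le> f b"
proof (rule DERIV_nonneg_imp_increasing_open[OF \<open>a \<le> b\<close>])
  have f2: "(f has_real_derivative f' t) (at t within {a..b})" if "t \<in> {a..b}" for t
    using f[OF that] \<open>{a..b} \<subseteq> J\<close> by (rule DERIV_subset)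
  show "continuous_on {a..b} f"
    unfolding continuous_on_eq_continuous_within using f2 DERIV_continuous by blast
  show "\<exists>y. DERIV f t :> y \<and> y \<ge> 0" if "a < t" "t < b" for t
    using f2[of t] nn[of t] that at_within_Icc_at[OF that] by auto
qed

text \<open>Gronwall's inequality: the integrating factor \<open>exp (- c * (t - a))\<close> makes
  the product nondecreasing. Derivatives are taken within a set \<open>J\<close> around the
  interval, so that one statement serves compact horizons and the half-line.\<close>

lemma derivative_ge_imp_exp_ge:
  fixes f f' :: "real \<Rightarrow> real"
  assumes "a \<le> b" "{a..b} \<subseteq> J"
    and f: "\<And>t. t \<in> {a..b} \<Longrightarrow> (f has_real_derivative f' t) (at t within J)"
    and ge: "\<And>t. t \<in> {a..b} \<Longrightarrow> f' t \<ge> c * f t"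
  shows "f a * exp (c * (b - a)) \<le> f b"
proof -
  define h where "h t = f t * exp (- c * (t - a))" for t
  have "h a \<le> h b"
  proof (rule nonneg_derivative_imp_le[OF assms(1,2)])
    fix t assume t: "t \<in> {a..b}"
    show "(h has_real_derivative (f' t - c * f t) * exp (- c * (t - a))) (at t within J)"
      unfolding h_def
      by (auto intro!: derivative_eq_intros f t simp: algebra_simps)
    show "0 \<le> (f' t - c * f t) * exp (- c * (t - a))"
      using ge[OF t] by simp
  qed
  then have "f a \<le> f b * exp (- c * (b - a))" by (simp add: h_def)
  then have "f a * exp (c * (b - a)) \<le> f b * exp (- c * (b - a)) * exp (c * (b - a))"
    by (rule mult_right_mono) simp
  then show ?thesis by (simp add: mult.assoc flip: exp_add)
qed

lemma derivative_le_imp_exp_le: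
  fixes f f' :: "real \<Rightarrow> real"
  assumes "a \<le> b" "{a..b} \<subseteq> J"
    and f: "\<And>t. t \<in> {a..b} \<Longrightarrow> (f has_real_derivative f' t) (at t within J)"
    and le: "\<And>t. t \<in> {a..b} \<Longrightarrow> f' t \<le> c * f t"
  shows "f b \<le> f a * exp (c * (b - a))"
proof -
  have "(- f a) * exp (c * (b - a)) \<le> - f b"
    by (rule derivative_ge_imp_exp_ge[OF assms(1,2), where f' = "\<lambda>t. - f' t"])
       (auto intro!: derivative_eq_intros f le)
  then show ?thesis by simp
qed

text \<open>Bootstrap principle: at the earliest time \<open>s0\<close> at which \<open>h\<close>
  equals \<open>r\<close> the weak bound has held so far, so \<open>step\<close> makes it strict
  there, a contradiction. It turns estimates that are valid only inside a ball into a proof that the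
  ball is never left.\<close>

lemma continuous_barrier:
  fixes h :: "real \<Rightarrow> real"
  assumes con: "continuous_on {0..T} h" and 0: "h 0 < r"
    and step: "\<And>t. t \<in> {0..T} \<Longrightarrow> (\<And>s. s \<in> {0..t} \<Longrightarrow> h s \<le> r) \<Longrightarrow> h t < r"
    and t: "t \<in> {0..T}"
  shows "h t < r"
proof (rule ccontr)
  assume "\<not> h t < r"
  define S where "S = {s \<in> {0..t}. h s = r}"
  have con': "continuous_on {0..t} h"
    using con t by (auto intro: continuous_on_subset)
  have ivt: "\<exists>s. 0 \<le> s \<and> s \<le> u \<and> h s = r" if "u \<in> {0..t}" "h u \<ge> r" for u
  proof (rule IVT')
    show "continuous_on {0..u} h" using that by (intro continuous_on_subset[OF con']) auto
  qed (use that 0 in auto)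
  have "S \<noteq> {}"
    using ivt[of t] \<open>\<not> h t < r\<close> t unfolding S_def by auto
  moreover have "closed S"
    using continuous_closed_preimage[OF con' closed_atLeastAtMost closed_singleton[of r]]
    by (simp add: S_def vimage_def Int_def)
  moreover have "bounded S"
    by (rule bounded_subset[OF bounded_closed_interval[of 0 t]]) (auto simp: S_def)
  ultimately have "compact S" "S \<noteq> {}" by (simp_all add: compact_eq_bounded_closed)
  then obtain s0 where s0: "s0 \<in> S" "\<And>s. s \<in> S \<Longrightarrow> s0 \<le> s"
    using compact_attains_inf[of S] by meson
  have "h s \<le> r" if "s \<in> {0..s0}" for s
  proof (rule ccontr)
    assume "\<not> h s \<le> r"
    moreover have "s \<in> {0..t}" using that s0(1) by (simp add: S_def)
    ultimately obtain u where "0 \<le> u" "u \<le> s" "h u = r"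
      using ivt[of s] by fastforce
    moreover from this have "u \<in> S" using that s0(1) by (auto simp: S_def)
    ultimately have "u = s" using s0(2)[of u] that by simp
    then show False using \<open>h u = r\<close> \<open>\<not> h s \<le> r\<close> by simp
  qed
  then have "h s0 < r" using step[of s0] s0(1) t by (auto simp: S_def)
  then show False using s0(1) by (auto simp: S_def)
qed

lemma indefinite_integral_deriv:
  fixes h :: "real \<Rightarrow> 'a::banach"
  assumes "continuous_on UNIV h" "t \<ge> 0"
  shows "((\<lambda>u. integral {0..u} h) has_vector_derivative h t) (at t within {0..})"
proof -
  have "((\<lambda>u. integral {0..u} h) has_vector_derivative h t) (at t within {0..t+1})"
    using assms by (intro integral_has_vector_derivative) (auto intro: continuous_on_subset)
  moreover have "at t within {0..t+1} = at t within {0..}"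
    by (rule at_within_nhd[of _ "{..<t+1}"]) auto
  ultimately show ?thesis by simp
qed

text \<open>The factor \<open>1 / c\<close> gained by integrating an exponential weight is what
  makes the Picard operator contract.\<close>

lemma exp_weighted_integral_bound:
  fixes h :: "real \<Rightarrow> 'a::banach"
  assumes con: "continuous_on UNIV h" and t: "t \<ge> 0" and "c > 0" "B \<ge> 0"
    and bnd: "\<And>s. s \<ge> 0 \<Longrightarrow> norm (h s) \<le> B * exp (c * s)"
  shows "norm (integral {0..t} h) \<le> B / c * exp (c * t)"
proof -
  have E: "((\<lambda>s. B * exp (c * s)) has_integral (B / c * exp (c * t) - B / c * exp (c * 0))) {0..t}"
    using t \<open>c > 0\<close>
    by (intro fundamental_theorem_of_calculus)
       (auto intro!: derivative_eq_intros simp flip: has_real_derivative_iff_has_vector_derivative)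
  have "norm (integral {0..t} h) \<le> integral {0..t} (\<lambda>s. B * exp (c * s))"
    using con bnd E
    by (intro integral_norm_bound_integral)
       (auto intro!: integrable_continuous_real continuous_intros intro: continuous_on_subset)
  also have "\<dots> = B / c * exp (c * t) - B / c"
    using integral_unique[OF E] by simp
  also have "\<dots> \<le> B / c * exp (c * t)" using assms by simp
  finally show ?thesis .
qed

text \<open>The weight \<open>exp (- 2 L t)\<close> turns the Picard operator into a contraction on the whole
  half-line at once, so that no continuation of local solutions is needed.\<close>

lemma global_solution_Lipschitz_field:
  fixes F :: "'a::banach \<Rightarrow> 'a"
  assumes L: "L > 0" "\<And>x y. norm (F x - F y) \<le> L * norm (x - y)"
  obtains x where "x 0 = x0"
    "\<And>t. t \<ge> 0 \<Longrightarrow> (x has_vector_derivative F (x t)) (at t within {0..})"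
proof -
  have "L-lipschitz_on UNIV F"
    using L by (intro lipschitz_onI) (auto simp: dist_norm)
  then have conF: "continuous_on UNIV F" by (rule lipschitz_on_continuous_on)
  \<comment> \<open>\<open>z\<close> stands for the solution damped by
    \<open>exp (- (2 * L * s))\<close>, so that bounded continuous functions describe solutions of
    exponential growth.\<close>
  define h where "h z s = F (exp (2 * L * s) *\<^sub>R apply_bcontfun z s)" for z :: "real \<Rightarrow>\<^sub>C 'a" and s
  have conh: "continuous_on UNIV (h z)" for z
    unfolding h_def by (intro continuous_on_compose2[OF conF] continuous_intros) auto
  \<comment> \<open>Elements of the function space live on all of the reals; \<open>max 0 t\<close>
    freezes the operator at \<open>x0\<close> for negative times.\<close>
  define T where "T z t = exp (- (2 * L * max 0 t)) *\<^sub>R (x0 + integral {0..max 0 t} (h z))"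
    for z and t :: real
  have bh: "norm (h z s) \<le> (norm (F 0) + L * norm z) * exp (2 * L * s)" if "s \<ge> 0" for z s
  proof -
    have "norm (h z s) \<le> norm (F 0) + L * norm (exp (2 * L * s) *\<^sub>R apply_bcontfun z s)"
      using L(2)[of "exp (2 * L * s) *\<^sub>R apply_bcontfun z s" 0]
        norm_triangle_ineq2[of "h z s" "F 0"] unfolding h_def by simp
    also have "\<dots> \<le> norm (F 0) * exp (2 * L * s) + L * (norm z * exp (2 * L * s))"
      using that L(1) norm_bounded[of z s] mult_left_mono[of 1 "exp (2 * L * s)" "norm (F 0)"]
      by (intro add_mono mult_left_mono) (auto simp: mult.commute)
    finally show ?thesis by (simp add: algebra_simps)
  qed
  have "T z \<in> bcontfun" for z
  proof (rule bcontfun_normI)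
    have "continuous_on {0..} (\<lambda>u. integral {0..u} (h z))"
      unfolding continuous_on_eq_continuous_within
      using indefinite_integral_deriv[OF conh] has_vector_derivative_continuous by fastforce
    then show "continuous_on UNIV (T z)"
      unfolding T_def by (intro continuous_intros continuous_on_compose2[of "{0..}" _ UNIV "max 0"]) auto
    fix t :: real
    let ?B = "norm (F 0) + L * norm z"
    let ?t = "max 0 t"
    have "norm (T z t) \<le> exp (- (2 * L * ?t)) * (norm x0 + norm (integral {0..?t} (h z)))"
      unfolding T_def using norm_triangle_ineq by (simp del: exp_minus)
    also have "\<dots> \<le> exp (- (2 * L * ?t)) * (norm x0 * exp (2 * L * ?t) + ?B / (2 * L) * exp (2 * L * ?t))"
      using L(1) bh
      by (intro mult_left_mono add_mono exp_weighted_integral_bound[OF conh])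
         (auto simp: mult_le_cancel_left1)
    also have "\<dots> = norm x0 + ?B / (2 * L)"
      by (simp add: algebra_simps flip: exp_add)
    finally show "norm (T z t) \<le> norm x0 + ?B / (2 * L)" .
  qed
  then have ap: "apply_bcontfun (Bcontfun (T z)) = T z" for z
    by (rule Bcontfun_inverse)
  \<comment> \<open>The contraction factor is the Lipschitz constant \<open>L\<close> over the
    weight rate \<open>2 * L\<close>.\<close>
  have "dist (Bcontfun (T z)) (Bcontfun (T z')) \<le> (1/2) * dist z z'" for z z'
  proof (rule dist_bound)
    fix t :: real
    let ?t = "max 0 t"
    have "integral {0..?t} (h z) - integral {0..?t} (h z') = integral {0..?t} (\<lambda>s. h z s - h z' s)"
      by (intro integral_diff[symmetric] integrable_continuous_real continuous_on_subset[OF conh]) auto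
    moreover have "norm (integral {0..?t} (\<lambda>s. h z s - h z' s)) \<le> (L * dist z z') / (2 * L) * exp (2 * L * ?t)"
    proof (rule exp_weighted_integral_bound)
      fix s :: real assume "s \<ge> 0"
      have "norm (h z s - h z' s) \<le> L * norm (exp (2 * L * s) *\<^sub>R (apply_bcontfun z s - apply_bcontfun z' s))"
        unfolding h_def using L(2) by (simp add: scaleR_diff_right)
      also have "\<dots> = L * exp (2 * L * s) * dist (apply_bcontfun z s) (apply_bcontfun z' s)"
        by (simp add: dist_norm)
      also have "\<dots> \<le> L * exp (2 * L * s) * dist z z'"
        using L(1) dist_bounded by (intro mult_left_mono) auto
      finally show "norm (h z s - h z' s) \<le> L * dist z z' * exp (2 * L * s)"
        by (simp add: algebra_simps)
    qed (use L conh in \<open>auto intro: continuous_intros\<close>)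
    ultimately have "norm (integral {0..?t} (h z) - integral {0..?t} (h z')) \<le> dist z z' / 2 * exp (2 * L * ?t)"
      using L(1) by simp
    moreover have "dist (T z t) (T z' t)
        = exp (- (2 * L * ?t)) * norm (integral {0..?t} (h z) - integral {0..?t} (h z'))"
      unfolding T_def dist_norm scaleR_diff_right[symmetric] by (simp del: exp_minus)
    ultimately have "dist (T z t) (T z' t) \<le> exp (- (2 * L * ?t)) * (dist z z' / 2 * exp (2 * L * ?t))"
      by (simp del: exp_minus)
    also have "\<dots> = 1/2 * dist z z'"
      by (simp flip: exp_add)
    finally show "dist (apply_bcontfun (Bcontfun (T z)) t) (apply_bcontfun (Bcontfun (T z')) t) \<le> 1/2 * dist z z'"
      by (simp add: ap)
  qed
  then obtain z where z: "Bcontfun (T z) = z"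
    using banach_fix_type[of "1/2" "\<lambda>z. Bcontfun (T z)"] by auto
  define x where "x t = x0 + integral {0..t} (h z)" for t :: real
  have hx: "h z t = F (x t)" if "t \<ge> 0" for t
  proof -
    have "apply_bcontfun z t = T z t" using ap[of z] z by simp
    then show ?thesis using that by (simp add: h_def T_def x_def flip: exp_add)
  qed
  show ?thesis
  proof
    show "x 0 = x0" by (simp add: x_def)
    show "(x has_vector_derivative F (x t)) (at t within {0..})" if "t \<ge> 0" for t
      unfolding hx[OF that, symmetric]
      unfolding x_def
      using indefinite_integral_deriv[OF conh that, of z] by (auto intro!: derivative_eq_intros)
  qed
qed

subsection \<open>Null sets of the state space\<close>

text \<open>A flat set embeds, with Lipschitz inverse, into a null set of the model space, and so does its
  trace in every chart.\<close>

definition flat :: "state set \<Rightarrow> bool" where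
  "flat S \<longleftrightarrow> (\<exists>(q :: state \<Rightarrow> (real^3) \<times> (real^3)) C. negligible (q ` S) \<and>
      (\<forall>a\<in>S. \<forall>b\<in>S. dist a b \<le> C * dist (q a) (q b)))"

text \<open>The embedding of \<open>S\<close> is composed with \<open>\<Phi>\<close>, whose inverse
  is Lipschitz on \<open>A\<close>. This carries the exceptional set of the error system over to
  initial states of the observer.\<close>

lemma flat_vimage:
  assumes "flat S" "K \<ge> 0" "\<And>a b. a \<in> A \<Longrightarrow> b \<in> A \<Longrightarrow> dist a b \<le> K * dist (\<Phi> a) (\<Phi> b)"
  shows "flat {a \<in> A. \<Phi> a \<in> S}"
proof -
  obtain q :: "state \<Rightarrow> (real^3) \<times> (real^3)" and C where q: "negligible (q ` S)"
    "\<And>a b. a \<in> S \<Longrightarrow> b \<in> S \<Longrightarrow> dist a b \<le> C * dist (q a) (q b)"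
    using \<open>flat S\<close> unfolding flat_def by blast
  have "negligible ((q \<circ> \<Phi>) ` {a \<in> A. \<Phi> a \<in> S})"
    by (rule negligible_subset[OF q(1)]) auto
  moreover have "dist a b \<le> (K * C) * dist ((q \<circ> \<Phi>) a) ((q \<circ> \<Phi>) b)"
    if "a \<in> {a \<in> A. \<Phi> a \<in> S}" "b \<in> {a \<in> A. \<Phi> a \<in> S}" for a b
  proof -
    have "dist a b \<le> K * dist (\<Phi> a) (\<Phi> b)" using assms(3) that by simp
    also have "\<dots> \<le> K * (C * dist (q (\<Phi> a)) (q (\<Phi> b)))"
      using assms(2) q(2) that by (intro mult_left_mono) auto
    finally show ?thesis by (simp add: mult.assoc)
  qed
  ultimately show ?thesis
    unfolding flat_def by (intro exI[of _ "q \<circ> \<Phi>"] exI[of _ "K * C"]) blast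
qed

text \<open>The derivative at \<open>u0\<close> is injective, hence bounded below by some
  \<open>b\<close>. By continuity of \<open>D\<close>, the map minus this derivative has Lipschitz
  constant \<open>b / 2\<close> on a small ball, and the other half of \<open>b\<close> remains as
  expansion rate.\<close>

lemma local_parametrization_expanding:
  assumes "local_parametrization U \<phi>" "u0 \<in> U"
  obtains r B where "r > 0" "B > 0"
    "\<And>u v. u \<in> ball u0 r \<Longrightarrow> v \<in> ball u0 r \<Longrightarrow> B * dist u v \<le> dist (\<phi> u) (\<phi> v)"
proof -
  obtain D :: "(real^3) \<times> (real^3) \<Rightarrow> ((real^3) \<times> (real^3)) \<Rightarrow>\<^sub>L state"
    where D: "open U" "continuous_on U D"
      "\<And>u. u \<in> U \<Longrightarrow> (\<phi> has_derivative blinfun_apply (D u)) (at u)"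
      "\<And>u. u \<in> U \<Longrightarrow> inj (blinfun_apply (D u))"
    using assms(1) unfolding local_parametrization_def by blast
  obtain b where b: "b > 0" "\<And>h. norm (D u0 h) \<ge> b * norm h"
    using linear_inj_bounded_below_pos[OF blinfun.bounded_linear_right[THEN bounded_linear.linear] D(4)[OF \<open>u0 \<in> U\<close>]]
    by blast
  have "isCont D u0"
    using D(1,2) \<open>u0 \<in> U\<close> by (simp add: continuous_on_eq_continuous_at)
  then obtain d where d: "d > 0" "\<And>u. dist u u0 < d \<Longrightarrow> dist (D u) (D u0) < b / 2"
    unfolding continuous_at_eps_delta using b(1) by (meson half_gt_zero)
  obtain e where e: "e > 0" "ball u0 e \<subseteq> U"
    using D(1) \<open>u0 \<in> U\<close> by (meson open_contains_ball)
  define r where "r = min d e"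
  show ?thesis
  proof
    show "r > 0" "b / 2 > 0" using d e b by (auto simp: r_def)
    fix u v assume uv: "u \<in> ball u0 r" "v \<in> ball u0 r"
    have "norm ((\<phi> u - D u0 u) - (\<phi> v - D u0 v)) \<le> b / 2 * norm (u - v)"
    proof (rule differentiable_bound[OF convex_ball _ _ uv])
      fix x assume x: "x \<in> ball u0 r"
      then have "x \<in> U" "dist x u0 < d" using e by (auto simp: r_def dist_commute)
      show "((\<lambda>u. \<phi> u - D u0 u) has_derivative blinfun_apply (D x - D u0)) (at x within ball u0 r)"
        unfolding blinfun.diff_left
        by (intro has_derivative_at_withinI[OF has_derivative_diff] D(3)[OF \<open>x \<in> U\<close>]
              bounded_linear_imp_has_derivative blinfun.bounded_linear_right)
      have "norm (D x - D u0) \<le> b / 2" using d(2)[OF \<open>dist x u0 < d\<close>] by (simp add: dist_norm)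
      then show "onorm (blinfun_apply (D x - D u0)) \<le> b / 2" by (simp add: norm_blinfun.rep_eq)
    qed
    moreover have "(\<phi> u - D u0 u) - (\<phi> v - D u0 v) = (\<phi> u - \<phi> v) - D u0 (u - v)"
      by (simp add: blinfun.diff_right)
    moreover have "b * norm (u - v) \<le> norm (D u0 (u - v))" by (rule b)
    moreover have "norm (D u0 (u - v)) \<le> norm (\<phi> u - \<phi> v) + norm ((\<phi> u - \<phi> v) - D u0 (u - v))"
      using norm_triangle_sub[of "D u0 (u - v)" "\<phi> u - \<phi> v"] by (simp add: norm_minus_commute)
    ultimately show "b / 2 * dist u v \<le> dist (\<phi> u) (\<phi> v)" by (simp add: dist_norm)
  qed
qed

text \<open>In a small ball of a chart, \<open>q \<circ> \<phi>\<close> has a Lipschitz inverse on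
  the trace of \<open>P n\<close>. The trace is thus a Lipschitz image of a null set in a space of
  the same dimension, hence null; local negligibility and countable unions do the rest.\<close>

lemma measure_zero_countable_flat:
  assumes "\<And>n :: nat. flat (P n)" "N \<subseteq> (\<Union>n. P n)"
  shows "measure_zero N"
  unfolding measure_zero_def
proof (intro allI impI)
  fix U \<phi> assume lp: "local_parametrization U \<phi>"
  have 1: "negligible {u \<in> U. \<phi> u \<in> P n}" for n
  proof (subst locally_negligible_alt, safe)
    fix u0 assume "u0 \<in> U" "\<phi> u0 \<in> P n"
    obtain r B where r: "r > 0" "B > 0"
      "\<And>u v. u \<in> ball u0 r \<Longrightarrow> v \<in> ball u0 r \<Longrightarrow> B * dist u v \<le> dist (\<phi> u) (\<phi> v)"
      using local_parametrization_expanding[OF lp \<open>u0 \<in> U\<close>] by blast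
    obtain q :: "state \<Rightarrow> (real^3) \<times> (real^3)" and C where q: "negligible (q ` P n)"
      "\<And>a b. a \<in> P n \<Longrightarrow> b \<in> P n \<Longrightarrow> dist a b \<le> C * dist (q a) (q b)"
      using assms(1)[of n] unfolding flat_def by blast
    define W where "W = {u \<in> U. \<phi> u \<in> P n} \<inter> ball u0 r"
    have le: "dist u v \<le> C / B * dist (q (\<phi> u)) (q (\<phi> v))" if "u \<in> W" "v \<in> W" for u v
    proof -
      have "B * dist u v \<le> C * dist (q (\<phi> u)) (q (\<phi> v))"
        using r(3)[of u v] q(2)[of "\<phi> u" "\<phi> v"] that by (auto simp: W_def)
      then show ?thesis using r(2) by (simp add: field_simps)
    qed
    define i where "i = inv_into W (q \<circ> \<phi>)"
    have inj: "inj_on (q \<circ> \<phi>) W"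
    proof (rule inj_onI)
      fix u v assume "u \<in> W" "v \<in> W" "(q \<circ> \<phi>) u = (q \<circ> \<phi>) v"
      then show "u = v" using le[of u v] by simp
    qed
    have neg: "negligible ((q \<circ> \<phi>) ` W)"
      by (rule negligible_subset[OF q(1)]) (auto simp: W_def)
    have "negligible (i ` ((q \<circ> \<phi>) ` W))"
    proof (rule negligible_locally_Lipschitz_image[OF _ neg])
      fix x assume "x \<in> (q \<circ> \<phi>) ` W"
      then obtain u where u: "x = (q \<circ> \<phi>) u" "u \<in> W" by (rule imageE)
      have "norm (i y - i x) \<le> C / B * norm (y - x)" if "y \<in> (q \<circ> \<phi>) ` W" for y
      proof -
        from that obtain v where v: "y = (q \<circ> \<phi>) v" "v \<in> W" by (rule imageE)
        have "i x = u" "i y = v"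
          using inv_into_f_f[OF inj u(2)] inv_into_f_f[OF inj v(2)] u(1) v(1) by (simp_all add: i_def)
        then show ?thesis using le[of v u] u v by (simp add: dist_norm)
      qed
      then show "\<exists>T B. open T \<and> x \<in> T \<and> (\<forall>y\<in>(q \<circ> \<phi>) ` W \<inter> T. norm (i y - i x) \<le> B * norm (y - x))"
        by (intro exI[of _ UNIV] exI[of _ "C / B"]) auto
    qed simp
    moreover have "i ` ((q \<circ> \<phi>) ` W) = W"
      unfolding i_def by (rule inv_into_image_cancel[OF inj subset_refl])
    ultimately have "negligible W" by simp
    moreover have "openin (top_of_set {u \<in> U. \<phi> u \<in> P n}) W"
      unfolding W_def by (simp add: openin_open_Int)
    moreover have "u0 \<in> W" using \<open>u0 \<in> U\<close> \<open>\<phi> u0 \<in> P n\<close> r by (simp add: W_def)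
    ultimately show "\<exists>W. openin (top_of_set {u \<in> U. \<phi> u \<in> P n}) W \<and> u0 \<in> W \<and> negligible W" by blast
  qed
  have "negligible (\<Union>n. {u \<in> U. \<phi> u \<in> P n})"
    using 1 by (intro negligible_countable_Union) auto
  then show "negligible {u \<in> U. \<phi> u \<in> N}"
    by (rule negligible_subset) (use assms(2) in auto)
qed

subsection \<open>Rotations and the cross product\<close>

lemma bounded_bilinear_cross3: "bounded_bilinear cross3"
  using bilinear_cross bilinear_conv_bounded_bilinear by blast

lemma bounded_bilinear_matrix_vector_mult:
  "bounded_bilinear ((*v) :: real^'n^'m \<Rightarrow> real^'n \<Rightarrow> real^'m)"
  unfolding bilinear_conv_bounded_bilinear[symmetric] bilinear_def
  by (auto intro!: linearI
        simp: matrix_vector_mult_def vec_eq_iff sum.distrib algebra_simps sum_distrib_left)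

lemma bounded_bilinear_matrix_matrix_mult:
  "bounded_bilinear ((**) :: real^'n^'m \<Rightarrow> real^'k^'n \<Rightarrow> real^'k^'m)"
  unfolding bilinear_conv_bounded_bilinear[symmetric] bilinear_def
  by (auto intro!: linearI
        simp: matrix_matrix_mult_def vec_eq_iff sum.distrib algebra_simps sum_distrib_left)

lemma bounded_linear_transpose: "bounded_linear (transpose :: real^'n^'m \<Rightarrow> real^'m^'n)"
  unfolding linear_conv_bounded_linear[symmetric]
  by (auto intro!: linearI simp: transpose_def vec_eq_iff)

lemma linear_skew: "linear skew"
  by (auto intro!: linearI
        simp: matrix_eq skew_mult_vector matrix_vector_mult_add_rdistrib cross_add_left cross_mult_left
          scaleR_matrix_vector_assoc[symmetric])

lemma bounded_linear_skew: "bounded_linear skew"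
  using linear_skew linear_conv_bounded_linear by blast

lemma inner_e3: "u \<bullet> e3 = u $ 3" "e3 \<bullet> u = u $ 3"
  by (simp_all add: e3_def inner_axis inner_axis')

lemma norm_e3 [simp]: "norm e3 = 1" "e3 \<bullet> e3 = 1"
  by (simp_all add: e3_def norm_eq_sqrt_inner inner_axis_axis)

lemma rotation_matrix_transpose [intro]:
  fixes Q :: "real^3^3"
  shows "rotation_matrix Q \<Longrightarrow> rotation_matrix (transpose Q)"
  by (simp add: rotation_matrix_def orthogonal_matrix_transpose det_transpose)

lemma rotation_matrix_mult [intro]:
  fixes P Q :: "real^3^3"
  shows "rotation_matrix P \<Longrightarrow> rotation_matrix Q \<Longrightarrow> rotation_matrix (P ** Q)"
  by (simp only: rotation_matrix_def orthogonal_matrix_mul det_mul simp_thms mult_1)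

lemma rotation_matrix_inverses:
  fixes Q :: "real^3^3"
  assumes "rotation_matrix Q"
  shows "transpose Q ** Q = mat 1" "Q ** transpose Q = mat 1"
    "transpose Q *v (Q *v x) = x" "Q *v (transpose Q *v x) = x"
  using assms
  by (simp_all only: rotation_matrix_def orthogonal_matrix_def matrix_vector_mul_assoc matrix_vector_mul_lid)

lemma rotation_matrix_inner:
  fixes Q :: "real^3^3"
  assumes "rotation_matrix Q" shows "(Q *v x) \<bullet> (Q *v y) = x \<bullet> y"
proof -
  have "(Q *v x) \<bullet> (Q *v y) = (x v* transpose Q) \<bullet> (Q *v y)"
    by (simp only: vector_transpose_matrix)
  also have "\<dots> = x \<bullet> (transpose Q *v (Q *v y))"
    by (rule dot_lmul_matrix)
  finally show ?thesis by (simp only: rotation_matrix_inverses[OF assms])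
qed

lemma rotation_matrix_norm:
  fixes Q :: "real^3^3"
  assumes "rotation_matrix Q" shows "norm (Q *v x) = norm x"
  by (simp only: norm_eq_sqrt_inner rotation_matrix_inner[OF assms])

lemma transpose_skew: "transpose (skew u) = - skew u"
  by (simp add: skew_def matrix_def transpose_def vec_eq_iff forall_3 cross3_def axis_def)

lemma rotation_skew:
  assumes "rotation_matrix R" shows "R ** skew u = skew (R *v u) ** R"
  by (simp add: matrix_eq matrix_vector_mul_assoc[symmetric] skew_mult_vector cross_rotation_matrix[OF assms])

text \<open>Used to compare two attitudes through their action on three basis vectors.\<close>

lemma norm_matrix_le_columns:
  fixes D :: "real^3^3"
  shows "norm D \<le> 3 * (norm (D *v axis 1 1) + norm (D *v axis 2 1) + norm (D *v axis 3 1))"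
proof -
  have e: "\<bar>D $ i $ j\<bar> \<le> norm (D *v axis j 1)" for i j
    using component_le_norm_cart[of "D *v axis j 1" i] by (simp add: matrix_vector_mult_basis column_def)
  have "norm D \<le> (\<Sum>i\<in>UNIV. norm (D $ i))"
    unfolding norm_vec_def by (rule L2_set_le_sum) simp
  also have "\<dots> \<le> (\<Sum>i\<in>(UNIV::3 set). \<Sum>j\<in>UNIV. \<bar>D $ i $ j\<bar>)"
    by (intro sum_mono norm_le_l1_cart)
  also have "\<dots> \<le> (\<Sum>i\<in>(UNIV::3 set). \<Sum>j\<in>UNIV. norm (D *v axis j 1))"
    by (intro sum_mono e)
  also have "\<dots> = 3 * (norm (D *v axis 1 1) + norm (D *v axis 2 1) + norm (D *v axis 3 1))"
    by (simp add: sum_3)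
  finally show ?thesis .
qed

lemma cross3_eval: "(u \<times> v) $ 1 = u$2 * v$3 - u$3 * v$2" "(u \<times> v) $ 2 = u$3 * v$1 - u$1 * v$3"
   "(u \<times> v) $ 3 = u$1 * v$2 - u$2 * v$1"
  by (simp_all add: cross3_def)

lemma inner_3: "(u::real^3) \<bullet> v = u$1 * v$1 + u$2 * v$2 + u$3 * v$3"
  by (simp add: inner_vec_def sum_3)

lemma inner_cross_le: "\<bar>(u \<times> v) \<bullet> w\<bar> \<le> norm u * norm v * norm w"
proof -
  have "norm (u \<times> v) \<le> norm u * norm v"
    by (rule power2_le_imp_le) (auto simp: norm_cross power_mult_distrib)
  then show ?thesis
    using Cauchy_Schwarz_ineq2[of "u \<times> v" w] by (meson mult_right_mono norm_ge_zero order_trans)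
qed

text \<open>The Gram determinant of \<open>m\<close>, \<open>n\<close>, \<open>\<eta>\<close> is the
  squared triple product. For unit \<open>\<eta>\<close> this is the relation between sine and
  cosine of the angle formed by the components of \<open>m\<close> and \<open>n\<close> orthogonal
  to \<open>\<eta>\<close>.\<close>

lemma gram_cross:
  fixes m n \<eta> :: "real^3"
  assumes "\<eta> \<bullet> \<eta> = 1"
  shows "((m \<times> n) \<bullet> \<eta>)\<^sup>2 + (m \<bullet> n - (n \<bullet> \<eta>) * (m \<bullet> \<eta>))\<^sup>2
    = (m \<bullet> m - (m \<bullet> \<eta>)\<^sup>2) * (n \<bullet> n - (n \<bullet> \<eta>)\<^sup>2)"
proof -
  \<comment> \<open>A polynomial identity in the components that holds for arbitrary
    \<open>\<eta>\<close>; the correction term vanishes for a unit vector.\<close>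
  have "((m \<times> n) \<bullet> \<eta>)\<^sup>2 + (m \<bullet> n * (\<eta> \<bullet> \<eta>) - (n \<bullet> \<eta>) * (m \<bullet> \<eta>))\<^sup>2
    = (m \<bullet> m * (\<eta> \<bullet> \<eta>) - (m \<bullet> \<eta>)\<^sup>2) * (n \<bullet> n * (\<eta> \<bullet> \<eta>) - (n \<bullet> \<eta>)\<^sup>2) +
       (1 - \<eta> \<bullet> \<eta>) * ((m \<times> n) \<bullet> \<eta>)\<^sup>2"
    unfolding inner_3 cross3_eval by (simp add: power2_eq_square algebra_simps)
  then show ?thesis using assms by simp
qed

subsection \<open>The error dynamics as a spherical pendulum\<close>

text \<open>Boundedness is carried along because the Lipschitz constant of a product is formed from
  bounds of the factors; the pair of properties is stable under all operations from which
  \<open>f\<close> is built.\<close>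

definition bounded_Lipschitz :: "'a::metric_space set \<Rightarrow> ('a \<Rightarrow> 'b::real_normed_vector) \<Rightarrow> bool" where
  "bounded_Lipschitz S f \<longleftrightarrow> (\<exists>B. \<forall>x\<in>S. norm (f x) \<le> B) \<and> (\<exists>L. \<forall>x\<in>S. \<forall>y\<in>S. norm (f x - f y) \<le> L * dist x y)"

lemma bounded_Lipschitz_const: "bounded_Lipschitz S (\<lambda>x. c)"
  unfolding bounded_Lipschitz_def by (auto intro: exI[of _ 0])

lemma bounded_Lipschitz_compose_linear:
  assumes "bounded_linear h" "bounded_Lipschitz S f"
  shows "bounded_Lipschitz S (\<lambda>x. h (f x))"
proof -
  interpret h: bounded_linear h by fact
  obtain K where K: "K \<ge> 0" "\<And>x. norm (h x) \<le> norm x * K" using h.nonneg_bounded by blast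
  obtain B L where BL: "\<And>x. x \<in> S \<Longrightarrow> norm (f x) \<le> B" "\<And>x y. x \<in> S \<Longrightarrow> y \<in> S \<Longrightarrow> norm (f x - f y) \<le> L * dist x y"
    using assms(2) unfolding bounded_Lipschitz_def by blast
  have "norm (h (f x)) \<le> B * K" if "x \<in> S" for x
    using K(2)[of "f x"] mult_right_mono[OF BL(1)[OF that] K(1)] by linarith
  moreover have "norm (h (f x) - h (f y)) \<le> (L * K) * dist x y" if "x \<in> S" "y \<in> S" for x y
    using K(2)[of "f x - f y"] mult_right_mono[OF BL(2)[OF that] K(1)] by (simp add: h.diff algebra_simps)
  ultimately show ?thesis unfolding bounded_Lipschitz_def by blast
qed

lemma bounded_Lipschitz_bilinear:
  assumes "bounded_bilinear pr" "bounded_Lipschitz S f" "bounded_Lipschitz S h"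
  shows "bounded_Lipschitz S (\<lambda>x. pr (f x) (h x))"
proof -
  interpret p: bounded_bilinear pr by fact
  obtain K where K: "K \<ge> 0" "\<And>a b. norm (pr a b) \<le> norm a * norm b * K" using p.nonneg_bounded by blast
  obtain B L where f: "\<And>x. x \<in> S \<Longrightarrow> norm (f x) \<le> B" "\<And>x y. x \<in> S \<Longrightarrow> y \<in> S \<Longrightarrow> norm (f x - f y) \<le> L * dist x y"
    using assms(2) unfolding bounded_Lipschitz_def by blast
  obtain B' L' where h: "\<And>x. x \<in> S \<Longrightarrow> norm (h x) \<le> B'" "\<And>x y. x \<in> S \<Longrightarrow> y \<in> S \<Longrightarrow> norm (h x - h y) \<le> L' * dist x y"
    using assms(3) unfolding bounded_Lipschitz_def by blast
  have "norm (pr (f x) (h x)) \<le> B * B' * K" if "x \<in> S" for x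
  proof -
    have "norm (f x) * norm (h x) \<le> B * B'"
      using f(1)[OF that] h(1)[OF that] by (intro mult_mono) (auto intro: order_trans[OF norm_ge_zero])
    then show ?thesis using K(2)[of "f x" "h x"] K(1) mult_right_mono order_trans by blast
  qed
  moreover have "norm (pr (f x) (h x) - pr (f y) (h y)) \<le> ((L * B' + B * L') * K) * dist x y" if "x \<in> S" "y \<in> S" for x y
  proof -
    have eq: "pr (f x) (h x) - pr (f y) (h y) = pr (f x - f y) (h x) + pr (f y) (h x - h y)"
      by (simp add: p.diff_left p.diff_right)
    have "norm (pr (f x) (h x) - pr (f y) (h y)) \<le> norm (f x - f y) * norm (h x) * K + norm (f y) * norm (h x - h y) * K"
      unfolding eq using K(2)[of "f x - f y" "h x"] K(2)[of "f y" "h x - h y"] norm_triangle_ineq[of "pr (f x - f y) (h x)" "pr (f y) (h x - h y)"] by linarith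
    also have "\<dots> \<le> (L * dist x y) * B' * K + B * (L' * dist x y) * K"
      using f h that K(1)
      by (intro add_mono mult_right_mono mult_mono) (auto intro: order_trans[OF norm_ge_zero])
    finally show ?thesis by (simp add: algebra_simps)
  qed
  ultimately show ?thesis unfolding bounded_Lipschitz_def by blast
qed

lemma bounded_Lipschitz_add:
  assumes "bounded_Lipschitz S f" "bounded_Lipschitz S h"
  shows "bounded_Lipschitz S (\<lambda>x. f x + h x)"
proof -
  obtain B L where f: "\<And>x. x \<in> S \<Longrightarrow> norm (f x) \<le> B" "\<And>x y. x \<in> S \<Longrightarrow> y \<in> S \<Longrightarrow> norm (f x - f y) \<le> L * dist x y"
    using assms(1) unfolding bounded_Lipschitz_def by blast
  obtain B' L' where h: "\<And>x. x \<in> S \<Longrightarrow> norm (h x) \<le> B'" "\<And>x y. x \<in> S \<Longrightarrow> y \<in> S \<Longrightarrow> norm (h x - h y) \<le> L' * dist x y"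
    using assms(2) unfolding bounded_Lipschitz_def by blast
  have "norm (f x + h x) \<le> B + B'" if "x \<in> S" for x
    using f(1) h(1) that norm_triangle_mono by blast
  moreover have "norm ((f x + h x) - (f y + h y)) \<le> (L + L') * dist x y" if "x \<in> S" "y \<in> S" for x y
    using norm_triangle_mono[OF f(2)[OF that] h(2)[OF that]] by (simp add: algebra_simps)
  ultimately show ?thesis unfolding bounded_Lipschitz_def by blast
qed

lemma bounded_Lipschitz_minus: "bounded_Lipschitz S f \<Longrightarrow> bounded_Lipschitz S (\<lambda>x. - f x)"
  using bounded_Lipschitz_compose_linear[OF bounded_linear_minus[OF bounded_linear_ident]] by blast

lemma bounded_Lipschitz_diff:
  "bounded_Lipschitz S f \<Longrightarrow> bounded_Lipschitz S h \<Longrightarrow> bounded_Lipschitz S (\<lambda>x. f x - h x)"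
  using bounded_Lipschitz_add[OF _ bounded_Lipschitz_minus] by fastforce

lemma bounded_Lipschitz_Pair:
  assumes "bounded_Lipschitz S f" "bounded_Lipschitz S h"
  shows "bounded_Lipschitz S (\<lambda>x. (f x, h x))"
proof -
  have "bounded_Lipschitz S (\<lambda>x. (f x, 0) + (0, h x))"
    using bounded_Lipschitz_compose_linear[OF bounded_linear_Pair[OF bounded_linear_ident bounded_linear_zero] assms(1)]
      bounded_Lipschitz_compose_linear[OF bounded_linear_Pair[OF bounded_linear_zero bounded_linear_ident] assms(2)]
    by (rule bounded_Lipschitz_add)
  then show ?thesis by simp
qed

lemma bounded_Lipschitz_linear:
  assumes "bounded_linear h" "bounded S" shows "bounded_Lipschitz S h"
proof -
  have "bounded_Lipschitz S (\<lambda>x. x)"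
    using \<open>bounded S\<close> unfolding bounded_Lipschitz_def bounded_iff dist_norm by (auto intro: exI[of _ 1])
  then show ?thesis by (rule bounded_Lipschitz_compose_linear[OF assms(1)])
qed

lemma e3_nth [simp]: "e3 $ 1 = 0" "e3 $ 2 = 0" "e3 $ 3 = 1"
  by (simp_all add: e3_def axis_def)

section \<open>Adapted coordinates and their equations of motion\<close>

locale observer =
  fixes g k1v k2v k1r k2r :: real and m :: "real^3"
  assumes g: "g > 0" and m_e3: "m \<times> e3 \<noteq> 0"
    and k1v: "k1v > 0" and k2v: "k2v > 0" and k1r: "k1r > 0" and k2r: "k2r > 0"
begin

abbreviation f :: "state \<Rightarrow> state" where "f \<equiv> error_field g k1v k2v k1r k2r m"

text \<open>Damping rate of the velocity orthogonal to \<open>eta\<close>: the term with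
  \<open>k2v\<close> acts on \<open>hor\<close> alone, the term with \<open>k1v\<close> on both
  parts of the velocity.\<close>

definition "K = k1v + k2v"

text \<open>Squared length of the horizontal part of \<open>m\<close>. It is positive because
  \<open>m\<close> is not vertical, and it is the common amplitude of \<open>sn\<close> and
  \<open>cn\<close> when \<open>eta\<close> is vertical.\<close>

definition "M = (m $ 1)\<^sup>2 + (m $ 2)\<^sup>2"

lemma K: "K > 0" using k1v k2v by (simp add: K_def)

lemma M: "M > 0"
proof -
  have "m $ 1 \<noteq> 0 \<or> m $ 2 \<noteq> 0"
    using m_e3 by (auto simp: vec_eq_iff forall_3 cross3_eval e3_def axis_def)
  then show ?thesis unfolding M_def by (auto intro: add_pos_nonneg add_nonneg_pos)
qed

lemma M_eq: "M = m \<bullet> m - (m $ 3)\<^sup>2"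
  by (simp add: M_def inner_3 power2_eq_square)

definition eta :: "state \<Rightarrow> real^3" where "eta x = snd x *v e3"
definition mag :: "state \<Rightarrow> real^3" where "mag x = snd x *v m"
definition vert :: "state \<Rightarrow> real" where "vert x = fst x \<bullet> eta x"
definition hor :: "state \<Rightarrow> real^3" where "hor x = fst x - vert x *\<^sub>R eta x"
text \<open>Since \<open>mag x \<bullet> eta x = m $ 3\<close>, \<open>sn\<close> and
  \<open>cn\<close> are the triple product and the inner product of the components of
  \<open>m\<close> and \<open>mag x\<close> orthogonal to \<open>eta x\<close>: up to a common
  amplitude, sine and cosine of the heading angle about \<open>eta x\<close>.\<close>

definition sn :: "state \<Rightarrow> real" where "sn x = (m \<times> mag x) \<bullet> eta x"
definition cn :: "state \<Rightarrow> real" where "cn x = m \<bullet> mag x - m $ 3 * (m \<bullet> eta x)"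

lemma state_rotation: "x \<in> state_space \<Longrightarrow> rotation_matrix (snd x)"
  by (auto simp: state_space_def)

lemma eta_eta: "x \<in> state_space \<Longrightarrow> eta x \<bullet> eta x = 1"
  and mag_mag: "x \<in> state_space \<Longrightarrow> mag x \<bullet> mag x = m \<bullet> m"
  and mag_eta: "x \<in> state_space \<Longrightarrow> mag x \<bullet> eta x = m $ 3"
  by (simp_all add: eta_def mag_def rotation_matrix_inner[OF state_rotation] inner_e3)

lemma norm_eta: "x \<in> state_space \<Longrightarrow> norm (eta x) = 1"
  and norm_mag: "x \<in> state_space \<Longrightarrow> norm (mag x) = norm m"
  by (simp_all add: eta_def mag_def rotation_matrix_norm[OF state_rotation])

lemma hor_eta: "x \<in> state_space \<Longrightarrow> hor x \<bullet> eta x = 0"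
  by (simp add: hor_def inner_diff_left eta_eta vert_def)

lemma fst_eq: "fst x = hor x + vert x *\<^sub>R eta x"
  by (simp add: hor_def)

lemma cross_hor: "fst x \<times> eta x = hor x \<times> eta x"
  by (simp add: hor_def Cross3.left_diff_distrib cross_mult_left)

lemma snd_f: "snd (f x) *v u = - ((k1r *\<^sub>R (hor x \<times> eta x) + (k2r * sn x) *\<^sub>R eta x) \<times> (snd x *v u))"
proof -
  have "snd (f x) = - (skew (k1r *\<^sub>R (fst x \<times> eta x) + (k2r * sn x) *\<^sub>R eta x) ** snd x)"
    by (simp add: error_field_def split_beta sigma_R_def eta_def mag_def sn_def)
  then show ?thesis
    by (simp only: cross_hor matrix_vector_mul_assoc[symmetric] skew_mult_vector
      bounded_bilinear.minus_left[OF bounded_bilinear_matrix_vector_mult])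
qed

lemma fst_f:
  assumes "x \<in> state_space"
  shows "fst (f x) = g *\<^sub>R (e3 - eta x) - k1v *\<^sub>R fst x - k2v *\<^sub>R hor x
     + k1r *\<^sub>R (vert x *\<^sub>R fst x - (fst x \<bullet> fst x) *\<^sub>R eta x)"
proof -
  have "eta x \<times> (eta x \<times> fst x) = - hor x"
    by (simp add: Lagrange eta_eta[OF assms] hor_def vert_def inner_commute)
  moreover have "fst x \<times> (fst x \<times> eta x) = vert x *\<^sub>R fst x - (fst x \<bullet> fst x) *\<^sub>R eta x"
    by (simp add: Lagrange vert_def)
  ultimately show ?thesis
    by (simp add: error_field_def split_beta sigma_v_def eta_def[symmetric] matrix_vector_mult_diff_rdistrib)
qed

lemma bounded_Lipschitz_f:
  assumes "bounded S" shows "bounded_Lipschitz S f"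
proof -
  note * = bounded_Lipschitz_Pair bounded_Lipschitz_diff bounded_Lipschitz_minus bounded_Lipschitz_add
      bounded_Lipschitz_const bounded_Lipschitz_linear[OF bounded_linear_fst assms]
      bounded_Lipschitz_linear[OF bounded_linear_snd assms]
      bounded_Lipschitz_bilinear[OF bounded_bilinear_scaleR] bounded_Lipschitz_bilinear[OF bounded_bilinear_cross3]
      bounded_Lipschitz_bilinear[OF bounded_bilinear_matrix_vector_mult]
      bounded_Lipschitz_bilinear[OF bounded_bilinear_matrix_matrix_mult]
      bounded_Lipschitz_bilinear[OF bounded_bilinear_inner]
      bounded_Lipschitz_bilinear[OF bounded_bilinear_mult]
      bounded_Lipschitz_compose_linear[OF bounded_linear_skew]
  have "bounded_Lipschitz S (\<lambda>x. (g *\<^sub>R ((mat 1 - snd x) *v e3) - sigma_v k1v k2v k1r (fst x) (snd x *v e3),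
      - (skew (sigma_R k1r k2r (fst x) (snd x *v e3) m (snd x *v m)) ** snd x)))"
    unfolding sigma_v_def sigma_R_def by (intro *)
  moreover have "f = (\<lambda>x. (g *\<^sub>R ((mat 1 - snd x) *v e3) - sigma_v k1v k2v k1r (fst x) (snd x *v e3),
      - (skew (sigma_R k1r k2r (fst x) (snd x *v e3) m (snd x *v m)) ** snd x)))"
    by (auto simp: error_field_def)
  ultimately show ?thesis by simp
qed

lemma f_Lipschitz:
  assumes "bounded S"
  shows "\<exists>L>0. \<forall>x\<in>S. \<forall>y\<in>S. norm (f x - f y) \<le> L * norm (x - y)"
proof -
  obtain L where L: "\<forall>x\<in>S. \<forall>y\<in>S. norm (f x - f y) \<le> L * norm (x - y)"
    using bounded_Lipschitz_f[OF assms] unfolding bounded_Lipschitz_def dist_norm by blast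
  have "norm (f x - f y) \<le> max L 1 * norm (x - y)" if "x \<in> S" "y \<in> S" for x y
    using L[rule_format, OF that] mult_right_mono[of L "max L 1" "norm (x - y)"] by simp
  then show ?thesis by (intro exI[of _ "max L 1"]) auto
qed

context
  fixes J x t
  assumes sol: "solution_on state_space (\<lambda>_. f) J x" and t: "t \<in> J"
begin

lemma sol_in: "x t \<in> state_space"
  using sol t by (simp add: solution_on_def)

lemma sol_deriv: "(x has_vector_derivative f (x t)) (at t within J)"
  using sol t by (simp add: solution_on_def)

lemma fst_deriv: "((\<lambda>t. fst (x t)) has_vector_derivative fst (f (x t))) (at t within J)"
  by (rule bounded_linear.has_vector_derivative[OF bounded_linear_fst sol_deriv])

lemma snd_deriv: "((\<lambda>t. snd (x t) *v u) has_vector_derivative snd (f (x t)) *v u) (at t within J)"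
  by (intro bounded_linear.has_vector_derivative[OF bounded_bilinear.bounded_linear_left[OF bounded_bilinear_matrix_vector_mult]]
    bounded_linear.has_vector_derivative[OF bounded_linear_snd sol_deriv])

text \<open>The magnetic part of \<open>sigma_R\<close> is parallel to \<open>eta\<close> and does
  not rotate it; the remaining part contributes a double cross product, which is a multiple of
  \<open>hor\<close> because \<open>hor\<close> is orthogonal to the unit vector
  \<open>eta\<close>.\<close>

lemma eta_deriv: "((\<lambda>t. eta (x t)) has_vector_derivative k1r *\<^sub>R hor (x t)) (at t within J)"
proof -
  have "snd (f (x t)) *v e3 = - ((k1r *\<^sub>R (hor (x t) \<times> eta (x t)) + (k2r * sn (x t)) *\<^sub>R eta (x t)) \<times> eta (x t))"
    by (simp only: snd_f eta_def)
  then have "snd (f (x t)) *v e3 = k1r *\<^sub>R hor (x t)"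
    using hor_eta[OF sol_in] eta_eta[OF sol_in]
    by (simp add: cross_add_left cross_mult_left cross_skew[of _ "eta (x t)"] Lagrange inner_commute
        Cross3.right_diff_distrib cross_add_right cross_mult_right)
  then show ?thesis using snd_deriv[of e3] by (simp add: eta_def)
qed

lemma mag_deriv: "((\<lambda>t. mag (x t)) has_vector_derivative
    (- k1r) *\<^sub>R ((hor (x t) \<bullet> mag (x t)) *\<^sub>R eta (x t) - m $ 3 *\<^sub>R hor (x t))
    - (k2r * sn (x t)) *\<^sub>R (eta (x t) \<times> mag (x t))) (at t within J)"
proof -
  have "snd (f (x t)) *v m = - ((k1r *\<^sub>R (hor (x t) \<times> eta (x t)) + (k2r * sn (x t)) *\<^sub>R eta (x t)) \<times> mag (x t))"
    by (simp only: snd_f mag_def)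
  then have "snd (f (x t)) *v m = (- k1r) *\<^sub>R ((hor (x t) \<bullet> mag (x t)) *\<^sub>R eta (x t) - m $ 3 *\<^sub>R hor (x t))
    - (k2r * sn (x t)) *\<^sub>R (eta (x t) \<times> mag (x t))"
    using mag_eta[OF sol_in]
    by (simp add: cross_add_left cross_mult_left cross_skew[of "_ \<times> _" "mag (x t)"] Lagrange inner_commute algebra_simps)
  then show ?thesis using snd_deriv[of m] by (simp add: mag_def)
qed

text \<open>The rotation of \<open>eta\<close> contributes \<open>k1r * (hor \<bullet> hor)\<close>,
  and the last term of \<open>sigma_v\<close> contributes exactly its negative. What remains is
  linear in \<open>vert\<close> with an input depending on \<open>eta\<close> only.\<close>

lemma vert_deriv: "((\<lambda>t. vert (x t)) has_real_derivative - g * (1 - eta (x t) $ 3) - k1v * vert (x t)) (at t within J)"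
proof -
  have "((\<lambda>t. vert (x t)) has_vector_derivative
      fst (x t) \<bullet> (k1r *\<^sub>R hor (x t)) + fst (f (x t)) \<bullet> eta (x t)) (at t within J)"
    unfolding vert_def
    by (rule bounded_bilinear.has_vector_derivative[OF bounded_bilinear_inner fst_deriv eta_deriv])
  moreover have "fst (x t) \<bullet> (k1r *\<^sub>R hor (x t)) + fst (f (x t)) \<bullet> eta (x t) = - g * (1 - eta (x t) $ 3) - k1v * vert (x t)"
    unfolding fst_f[OF sol_in] using eta_eta[OF sol_in] hor_eta[OF sol_in]
    by (simp add: fst_eq inner_add_left inner_add_right inner_diff_left inner_e3 inner_commute[of "eta (x t)" "hor (x t)"] algebra_simps)
  ultimately show ?thesis by (simp add: has_real_derivative_iff_has_vector_derivative)
qed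

text \<open>All contributions of \<open>vert\<close> cancel here, which makes
  \<open>(hor, eta)\<close> autonomous. The last term is the constraint force that keeps
  \<open>hor\<close> orthogonal to the moving \<open>eta\<close>.\<close>

lemma hor_deriv: "((\<lambda>t. hor (x t)) has_vector_derivative
    g *\<^sub>R (e3 - eta (x t) $ 3 *\<^sub>R eta (x t)) - K *\<^sub>R hor (x t) - (k1r * (hor (x t) \<bullet> hor (x t))) *\<^sub>R eta (x t)) (at t within J)"
proof -
  have "((\<lambda>t. hor (x t)) has_vector_derivative
      fst (f (x t)) - (vert (x t) *\<^sub>R (k1r *\<^sub>R hor (x t)) + (- g * (1 - eta (x t) $ 3) - k1v * vert (x t)) *\<^sub>R eta (x t))) (at t within J)"
    unfolding hor_def[abs_def]
    by (intro has_vector_derivative_diff fst_deriv has_vector_derivative_scaleR vert_deriv eta_deriv[unfolded hor_def])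
  moreover have "fst (x t) \<bullet> fst (x t) = hor (x t) \<bullet> hor (x t) + (vert (x t))\<^sup>2"
    using eta_eta[OF sol_in] hor_eta[OF sol_in]
    by (simp add: fst_eq[of "x t"] inner_add_left inner_add_right inner_commute[of "eta (x t)" "hor (x t)"] power2_eq_square)
  then have "fst (f (x t)) - (vert (x t) *\<^sub>R (k1r *\<^sub>R hor (x t)) + (- g * (1 - eta (x t) $ 3) - k1v * vert (x t)) *\<^sub>R eta (x t))
    = g *\<^sub>R (e3 - eta (x t) $ 3 *\<^sub>R eta (x t)) - K *\<^sub>R hor (x t) - (k1r * (hor (x t) \<bullet> hor (x t))) *\<^sub>R eta (x t)"
    unfolding fst_f[OF sol_in]
    by (simp add: fst_eq[of "x t"] K_def vec_eq_iff algebra_simps power2_eq_square)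
  ultimately show ?thesis by simp
qed

text \<open>Apart from terms linear in \<open>hor\<close>, this and \<open>cn_deriv\<close> are the
  equations of an angle whose velocity is minus \<open>k2r\<close> times the amplitude times its
  sine: heading zero attracts and the opposite heading repels.\<close>

lemma sn_deriv: "((\<lambda>t. sn (x t)) has_real_derivative
    - (k2r * sn (x t) * cn (x t)) + k1r * (m $ 3 * ((m \<times> hor (x t)) \<bullet> eta (x t)) + (m \<times> mag (x t)) \<bullet> hor (x t))) (at t within J)"
proof -
  have "(m \<times> (eta (x t) \<times> mag (x t))) \<bullet> eta (x t) = cn (x t)"
    using eta_eta[OF sol_in] mag_eta[OF sol_in] by (simp add: Lagrange cn_def inner_diff_left)
  then have *: "(m \<times> ((- k1r) *\<^sub>R ((hor (x t) \<bullet> mag (x t)) *\<^sub>R eta (x t) - m $ 3 *\<^sub>R hor (x t))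
    - (k2r * sn (x t)) *\<^sub>R (eta (x t) \<times> mag (x t)))) \<bullet> eta (x t) =
    k1r * m $ 3 * ((m \<times> hor (x t)) \<bullet> eta (x t)) - k2r * sn (x t) * cn (x t)"
    by (simp add: Cross3.right_diff_distrib cross_add_right inner_add_left cross_mult_right inner_diff_left dot_cross_self algebra_simps)
  have "((\<lambda>t. m \<times> mag (x t)) has_vector_derivative m \<times> ((- k1r) *\<^sub>R ((hor (x t) \<bullet> mag (x t)) *\<^sub>R eta (x t) - m $ 3 *\<^sub>R hor (x t))
    - (k2r * sn (x t)) *\<^sub>R (eta (x t) \<times> mag (x t)))) (at t within J)"
    by (rule bounded_linear.has_vector_derivative[OF bounded_bilinear.bounded_linear_right[OF bounded_bilinear_cross3] mag_deriv])
  from bounded_bilinear.has_vector_derivative[OF bounded_bilinear_inner this eta_deriv]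
  show ?thesis unfolding * has_real_derivative_iff_has_vector_derivative sn_def[symmetric]
    by (rule back_subst[where P = "\<lambda>d. (_ has_vector_derivative d) _"]) (simp add: algebra_simps)
qed

lemma cn_deriv: "((\<lambda>t. cn (x t)) has_real_derivative
    k2r * (sn (x t))\<^sup>2 - k1r * (m \<bullet> eta (x t)) * (hor (x t) \<bullet> mag (x t))) (at t within J)"
proof -
  have "m \<bullet> (eta (x t) \<times> mag (x t)) = - sn (x t)"
    by (simp add: sn_def inner_3 cross3_eval algebra_simps)
  then have *: "m \<bullet> ((- k1r) *\<^sub>R ((hor (x t) \<bullet> mag (x t)) *\<^sub>R eta (x t) - m $ 3 *\<^sub>R hor (x t))
    - (k2r * sn (x t)) *\<^sub>R (eta (x t) \<times> mag (x t))) - m $ 3 * (m \<bullet> (k1r *\<^sub>R hor (x t))) =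
    k2r * (sn (x t))\<^sup>2 - k1r * (m \<bullet> eta (x t)) * (hor (x t) \<bullet> mag (x t))"
    by (simp add: inner_diff_right power2_eq_square algebra_simps)
  have inn: "bounded_linear (\<lambda>v. m \<bullet> v)" by (rule bounded_linear_inner_right)
  show ?thesis unfolding cn_def *[symmetric] has_real_derivative_iff_has_vector_derivative
    by (intro has_vector_derivative_diff bounded_linear.has_vector_derivative[OF inn]
       bounded_linear.has_vector_derivative[OF bounded_linear_mult_right] mag_deriv eta_deriv)
qed

end

text \<open>The squared amplitude varies with the tilt only, and it tends to \<open>M * M\<close> as
  \<open>eta\<close> becomes vertical.\<close>

lemma sn_cn:
  assumes "x \<in> state_space"
  shows "(sn x)\<^sup>2 + (cn x)\<^sup>2 = M * (m \<bullet> m - (m \<bullet> eta x)\<^sup>2)"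
  using gram_cross[OF eta_eta[OF assms], of m "mag x"]
  by (simp add: sn_def cn_def M_eq mag_eta[OF assms] mag_mag[OF assms] mult.commute)

end

section \<open>Invariance of the rotations, global existence and Lipschitz dependence\<close>

lemma has_real_derivative_inner:
  fixes u v :: "real \<Rightarrow> 'a::real_inner"
  assumes "(u has_vector_derivative u') F" "(v has_vector_derivative v') F" "F = at t within S"
  shows "((\<lambda>t. u t \<bullet> v t) has_real_derivative u t \<bullet> v' + u' \<bullet> v t) F"
  using bounded_bilinear.has_vector_derivative[OF bounded_bilinear_inner] assms
  by (auto simp: has_real_derivative_iff_has_vector_derivative)

lemma solution_on_subset:
  assumes "solution_on S F J x" "I \<subseteq> J" shows "solution_on S F I x"
  using assms unfolding solution_on_def by (auto intro: has_vector_derivative_within_subset)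

lemma continuous_on_det_3:
  fixes A :: "'a::topological_space \<Rightarrow> real^3^3"
  assumes "continuous_on S A" shows "continuous_on S (\<lambda>t. det (A t))"
  unfolding det_3 by (intro continuous_intros assms)

lemma norm_rotation_matrix_le:
  assumes "rotation_matrix (Q :: real^3^3)" shows "norm Q \<le> 9"
proof -
  have "norm (Q *v axis j 1) = 1" for j
    unfolding rotation_matrix_norm[OF assms] by (simp add: norm_eq_sqrt_inner inner_axis_axis)
  then show ?thesis using norm_matrix_le_columns[of Q] by simp
qed

text \<open>\<open>transpose Q ** Q\<close> has zero derivative because \<open>skew\<close> is
  antisymmetric, so orthogonality persists; the determinant is then \<open>1\<close> or
  \<open>-1\<close> and cannot pass continuously from one to the other without vanishing.\<close>

lemma rotation_matrix_invariant:
  fixes Q :: "real \<Rightarrow> real^3^3"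
  assumes Q: "\<And>t. t \<in> {0..T} \<Longrightarrow> (Q has_vector_derivative - (skew (\<sigma> t) ** Q t)) (at t within {0..T})"
    and 0: "rotation_matrix (Q 0)" and t: "t \<in> {0..T}"
  shows "rotation_matrix (Q t)"
proof -
  define A where "A t = transpose (Q t) ** Q t" for t
  have "(A has_vector_derivative 0) (at t within {0..T})" if "t \<in> {0..T}" for t
  proof -
    have "(A has_vector_derivative transpose (Q t) ** (- (skew (\<sigma> t) ** Q t)) + transpose (- (skew (\<sigma> t) ** Q t)) ** Q t) (at t within {0..T})"
      unfolding A_def
      by (intro bounded_bilinear.has_vector_derivative[OF bounded_bilinear_matrix_matrix_mult]
          bounded_linear.has_vector_derivative[OF bounded_linear_transpose] Q that)
    moreover have "transpose (- (skew (\<sigma> t) ** Q t)) = transpose (Q t) ** skew (\<sigma> t)"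
    proof -
      have "transpose (- (skew (\<sigma> t) ** Q t)) = - (transpose (Q t) ** - skew (\<sigma> t))"
        by (simp add: linear_neg[OF bounded_linear.linear[OF bounded_linear_transpose]] matrix_transpose_mul transpose_skew)
      then show ?thesis
        by (simp add: bounded_bilinear.minus_right[OF bounded_bilinear_matrix_matrix_mult])
    qed
    ultimately show ?thesis
      by (simp add: bounded_bilinear.minus_right[OF bounded_bilinear_matrix_matrix_mult] matrix_mul_assoc)
  qed
  then obtain c where c: "\<And>t. t \<in> {0..T} \<Longrightarrow> A t = c"
    using has_vector_derivative_zero_constant[of "{0..T}" A] by auto
  have A1: "transpose (Q t) ** Q t = mat 1" if "t \<in> {0..T}" for t
    using c[OF that] c[of 0] that rotation_matrix_inverses(1)[OF 0] by (simp add: A_def)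
  then have orth: "orthogonal_matrix (Q t)" if "t \<in> {0..T}" for t
    using that by (simp add: orthogonal_matrix)
  have "continuous_on {0..T} Q"
    unfolding continuous_on_eq_continuous_within using has_vector_derivative_continuous[OF Q] by blast
  then have con: "continuous_on {0..t} (\<lambda>t. det (Q t))"
    using t by (intro continuous_on_det_3) (auto elim: continuous_on_subset)
  have "det (Q t) \<noteq> -1"
  proof
    assume "det (Q t) = -1"
    moreover have "det (Q 0) = 1" using 0 by (simp add: rotation_matrix_def)
    ultimately obtain s where s: "0 \<le> s" "s \<le> t" "det (Q s) = 0"
      using IVT2'[of "\<lambda>t. det (Q t)" t 0 0] con t by auto
    then show False using det_orthogonal_matrix[OF orth[of s]] t by auto
  qed
  then show ?thesis
    unfolding rotation_matrix_def using orth[OF t] det_orthogonal_matrix by blast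
qed

context observer
begin

text \<open>The speed at which the damping \<open>k1v\<close> balances the gravity error
  \<open>g *\<^sub>R (e3 - eta)\<close>, whose norm is at most \<open>2 * g\<close>.\<close>

definition "B = 2 * g / k1v"

lemma B: "B > 0" using g k1v by (simp add: B_def)

text \<open>In the derivative of the squared speed the \<open>k1r\<close> term is orthogonal to the
  velocity and the \<open>k2v\<close> term is dissipative. Completing the square in the gravity term
  leaves decay at rate \<open>k1v\<close> of the excess over \<open>B\<close> squared.\<close>

lemma fst_bound:
  assumes sol: "solution_on state_space (\<lambda>_. f) {0..T} x" and t: "t \<in> {0..T}"
  shows "norm (fst (x t)) \<le> norm (fst (x 0)) + B"
proof -
  define E where "E t = fst (x t) \<bullet> fst (x t) - B\<^sup>2" for t
  define E' where "E' t = 2 * (fst (x t) \<bullet> fst (f (x t)))" for t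
  have "E t \<le> E 0 * exp ((- k1v) * (t - 0))"
  proof (rule derivative_le_imp_exp_le[where J = "{0..T}" and f' = E'])
    fix s assume s: "s \<in> {0..t}"
    then have s': "s \<in> {0..T}" using t by auto
    have "((\<lambda>t. fst (x t) \<bullet> fst (x t)) has_real_derivative fst (x s) \<bullet> fst (f (x s)) + fst (f (x s)) \<bullet> fst (x s)) (at s within {0..T})"
      using fst_deriv[OF sol s'] by (intro has_real_derivative_inner) auto
    then show "(E has_real_derivative E' s) (at s within {0..T})"
      unfolding E_def[abs_def] E'_def by (auto intro!: derivative_eq_intros simp: inner_commute)
    let ?w = "fst (x s)" and ?\<eta> = "eta (x s)"
    note in_s = sol_in[OF sol s']
    have "?w \<bullet> fst (f (x s)) = g * (?w \<bullet> (e3 - ?\<eta>)) - k1v * (?w \<bullet> ?w) - k2v * (?w \<bullet> hor (x s))"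
      unfolding fst_f[OF in_s] by (simp add: inner_add_right inner_diff_right vert_def algebra_simps)
    moreover have wh: "?w \<bullet> hor (x s) = hor (x s) \<bullet> hor (x s)"
      using hor_eta[OF in_s] by (simp add: fst_eq[of "x s"] inner_add_left inner_add_right inner_commute)
    moreover have "norm (e3 - ?\<eta>) \<le> 2"
      using norm_triangle_ineq4[of e3 ?\<eta>] norm_eta[OF in_s] by simp
    then have "?w \<bullet> (e3 - ?\<eta>) \<le> norm ?w * 2"
      using norm_cauchy_schwarz[of ?w "e3 - ?\<eta>"] by (meson mult_left_mono norm_ge_zero order_trans)
    then have "g * (?w \<bullet> (e3 - ?\<eta>)) \<le> g * (norm ?w * 2)"
      using g by (intro mult_left_mono) auto
    moreover have "k2v * (?w \<bullet> hor (x s)) \<ge> 0" unfolding wh using k2v by simp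
    ultimately have "E' s \<le> 2 * (g * (norm ?w * 2)) - 2 * k1v * (?w \<bullet> ?w)"
      unfolding E'_def mult.assoc by linarith
    also have "g * 2 = k1v * B" using k1v by (simp add: B_def)
    then have "2 * (g * (norm ?w * 2)) - 2 * k1v * (?w \<bullet> ?w) = k1v * (2 * (B * norm ?w) - 2 * (norm ?w)\<^sup>2)"
      by (simp add: power2_norm_eq_inner algebra_simps)
    also have "\<dots> \<le> k1v * (B\<^sup>2 - (norm ?w)\<^sup>2)"
      using k1v zero_le_power2[of "B - norm ?w"] by (intro mult_left_mono) (auto simp: power2_diff)
    finally show "E' s \<le> (- k1v) * E s" by (simp add: E_def power2_norm_eq_inner algebra_simps)
  qed (use t in auto)
  also have "\<dots> \<le> (norm (fst (x 0)))\<^sup>2 * exp ((- k1v) * (t - 0))"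
    unfolding E_def by (intro mult_right_mono) (auto simp: power2_norm_eq_inner)
  also have "\<dots> \<le> (norm (fst (x 0)))\<^sup>2 * 1"
    using t k1v by (intro mult_left_mono) auto
  finally have "(norm (fst (x t)))\<^sup>2 \<le> (norm (fst (x 0)))\<^sup>2 + B\<^sup>2" by (simp add: E_def power2_norm_eq_inner)
  also have "\<dots> \<le> (norm (fst (x 0)) + B)\<^sup>2" using B by (simp add: power2_sum)
  finally show ?thesis by (rule power2_le_imp_le) (use B in auto)
qed

lemma norm_state_le: "x \<in> state_space \<Longrightarrow> norm x \<le> norm (fst x) + 9"
  using norm_Pair_le[of "fst x" "snd x"] norm_rotation_matrix_le[OF state_rotation, of x] by simp

lemma sol_bound:
  assumes sol: "solution_on state_space (\<lambda>_. f) {0..T} x" and t: "t \<in> {0..T}"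
  shows "norm (x t) \<le> norm (x 0) + B + 9"
  using norm_state_le[OF sol_in[OF sol t]] fst_bound[OF sol t] norm_fst_le[of "fst (x 0)" "snd (x 0)"] by simp

text \<open>The state constraint is automatic, since the attitude part of \<open>f\<close> is a skew
  matrix times the attitude. Existence can thus be settled in the ambient vector space.\<close>

lemma ambient_solution:
  assumes x: "\<And>t. t \<in> {0..T} \<Longrightarrow> (x has_vector_derivative f (x t)) (at t within {0..T})"
    and 0: "x 0 \<in> state_space"
  shows "solution_on state_space (\<lambda>_. f) {0..T} x"
  unfolding solution_on_def
proof (intro ballI conjI x)
  fix t assume t: "t \<in> {0..T}"
  have "rotation_matrix (snd (x t))"
  proof (rule rotation_matrix_invariant[OF _ _ t, where Q = "\<lambda>t. snd (x t)" and
        \<sigma> = "\<lambda>t. sigma_R k1r k2r (fst (x t)) (snd (x t) *v e3) m (snd (x t) *v m)"])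
    fix s assume "s \<in> {0..T}"
    from bounded_linear.has_vector_derivative[OF bounded_linear_snd x[OF this]]
    show "((\<lambda>t. snd (x t)) has_vector_derivative
       - (skew (sigma_R k1r k2r (fst (x s)) (snd (x s) *v e3) m (snd (x s) *v m)) ** snd (x s))) (at s within {0..T})"
      by (simp add: error_field_def split_beta)
  qed (rule state_rotation[OF 0])
  then show "x t \<in> state_space" by (simp add: state_space_def split_beta)
qed

text \<open>Composing \<open>f\<close> with the projection \<open>P\<close> onto a ball makes it
  globally Lipschitz; the a priori bound shows that the solution of the modified equation never
  leaves the ball, where \<open>P\<close> is the identity.\<close>

lemma solution_exists:
  assumes x0: "x0 \<in> state_space"
  obtains x where "solution_on state_space (\<lambda>_. f) {0..} x" "x 0 = x0"
proof -
  \<comment> \<open>One more than the bound of \<open>sol_bound\<close>, so that the barrier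
    argument has a strict inequality.\<close>
  define r where "r = norm x0 + B + 10"
  have r: "r > 0" using B by (simp add: r_def add_nonneg_pos)
  define P where "P = closest_point (cball (0::state) r)"
  have cb: "convex (cball (0::state) r)" "closed (cball (0::state) r)" "cball (0::state) r \<noteq> {}"
    using r by auto
  have Pin: "P y \<in> cball 0 r" for y unfolding P_def by (rule closest_point_in_set[OF cb(2,3)])
  have Pid: "P y = y" if "norm y \<le> r" for y unfolding P_def by (rule closest_point_self) (use that in auto)
  have Pl: "norm (P y - P z) \<le> norm (y - z)" for y z
    using closest_point_lipschitz[OF cb, of y z] by (simp add: P_def dist_norm)
  obtain L where L0: "L > 0"
    and L1: "\<forall>x\<in>cball 0 r. \<forall>y\<in>cball 0 r. norm (f x - f y) \<le> L * norm (x - y)"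
    using f_Lipschitz[OF bounded_cball[of 0 "r"]] by blast
  note L = L0 L1[rule_format]
  have "norm (f (P y) - f (P z)) \<le> L * norm (y - z)" for y z
    using L Pin Pl by (meson less_imp_le mult_left_mono order_trans)
  from global_solution_Lipschitz_field[of L "\<lambda>y. f (P y)", OF L(1) this, of x0]
  obtain x where x: "x 0 = x0" "\<And>t. t \<ge> 0 \<Longrightarrow> (x has_vector_derivative f (P (x t))) (at t within {0..})" by blast
  have con: "continuous_on {0..} x"
    using x(2) by (auto simp: continuous_on_eq_continuous_within intro: has_vector_derivative_continuous)
  have part: "solution_on state_space (\<lambda>_. f) {0..t} x" if "\<And>s. s \<in> {0..t} \<Longrightarrow> norm (x s) \<le> r" for t
  proof (rule ambient_solution)
    fix s assume "s \<in> {0..t}"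
    then show "(x has_vector_derivative f (x s)) (at s within {0..t})"
      using x(2)[of s] Pid[OF that] by (auto intro: has_vector_derivative_within_subset)
  qed (simp add: x x0)
  have lt: "norm (x t) < r" if "t \<ge> 0" for t
  proof (rule continuous_barrier[of t "\<lambda>t. norm (x t)"])
    show "continuous_on {0..t} (\<lambda>t. norm (x t))"
      using con by (auto intro!: continuous_intros intro: continuous_on_subset)
    show "norm (x 0) < r" using B by (simp add: x r_def)
    fix u assume u: "u \<in> {0..t}" "\<And>s. s \<in> {0..u} \<Longrightarrow> norm (x s) \<le> r"
    from sol_bound[OF part[OF u(2)], of u u] show "norm (x u) < r" using u by (simp add: r_def x)
  qed (use that in auto)
  have "solution_on state_space (\<lambda>_. f) {0..} x"
    unfolding solution_on_def
  proof (intro ballI conjI)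
    fix t :: real assume t: "t \<in> {0..}"
    show "x t \<in> state_space"
      by (rule sol_in[OF part[of t]]) (use t lt in \<open>auto intro: less_imp_le\<close>)
    show "(x has_vector_derivative f (x t)) (at t within {0..})"
      using x(2)[of t] Pid[of "x t"] lt[of t] t by simp
  qed
  then show ?thesis using x(1) that by blast
qed

text \<open>Two estimates in one predicate: the forward one yields uniqueness, the backward one
  carries smallness of a set at time \<open>T\<close> back to its initial states.
  \<open>\<rho>\<close> bounds the initial states, hence whole trajectories.\<close>

definition flow_Lipschitz :: "real \<Rightarrow> real \<Rightarrow> bool" where
  "flow_Lipschitz \<rho> L \<longleftrightarrow> (\<forall>T x y. T \<ge> 0 \<longrightarrow>
     solution_on state_space (\<lambda>_. f) {0..T} x \<longrightarrow> solution_on state_space (\<lambda>_. f) {0..T} y \<longrightarrow>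
     norm (x 0) \<le> \<rho> \<longrightarrow> norm (y 0) \<le> \<rho> \<longrightarrow>
     dist (x T) (y T) \<le> exp (L * T) * dist (x 0) (y 0) \<and> dist (x 0) (y 0) \<le> exp (L * T) * dist (x T) (y T))"

text \<open>The derivative of the squared distance is bounded in absolute value by
  \<open>2 * L\<close> times the squared distance, so Gronwall applies from above and from
  below.\<close>

lemma flow_Lipschitz_exists: "\<exists>L. flow_Lipschitz \<rho> L"
proof -
  obtain L where L0: "L > 0"
    and L1: "\<forall>x\<in>cball 0 (\<rho> + B + 9). \<forall>y\<in>cball 0 (\<rho> + B + 9). norm (f x - f y) \<le> L * norm (x - y)"
    using f_Lipschitz[OF bounded_cball[of 0 "(\<rho> + B + 9)"]] by blast
  note L = L0 L1[rule_format]
  have main: "dist (x T) (y T) \<le> exp (L * T) * dist (x 0) (y 0) \<and> dist (x 0) (y 0) \<le> exp (L * T) * dist (x T) (y T)"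
    if sol: "solution_on state_space (\<lambda>_. f) {0..T} x" "solution_on state_space (\<lambda>_. f) {0..T} y"
      "norm (x 0) \<le> \<rho>" "norm (y 0) \<le> \<rho>" and T: "T \<ge> 0" for T x y
  proof -
    define d where "d t = x t - y t" for t
    define E where "E t = d t \<bullet> d t" for t
    define E' where "E' t = 2 * (d t \<bullet> (f (x t) - f (y t)))" for t
    have dE: "(E has_real_derivative E' t) (at t within {0..T})" if "t \<in> {0..T}" for t
    proof -
      have "(d has_vector_derivative f (x t) - f (y t)) (at t within {0..T})"
        unfolding d_def[abs_def] by (intro has_vector_derivative_diff sol_deriv[OF sol(1) that] sol_deriv[OF sol(2) that])
      from has_real_derivative_inner[OF this this refl] show ?thesis
        unfolding E_def[abs_def] E'_def by (simp add: inner_commute)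
    qed
    have E'_le: "\<bar>E' t\<bar> \<le> (2 * L) * E t" if "t \<in> {0..T}" for t
    proof -
      have "norm (f (x t) - f (y t)) \<le> L * norm (d t)"
        using sol_bound[OF sol(1) that] sol_bound[OF sol(2) that] sol(3,4) unfolding d_def by (intro L(2)) auto
      then have "norm (d t) * norm (f (x t) - f (y t)) \<le> norm (d t) * (L * norm (d t))"
        by (intro mult_left_mono) auto
      then show ?thesis
        using Cauchy_Schwarz_ineq2[of "d t" "f (x t) - f (y t)"] unfolding E'_def E_def dot_square_norm power2_eq_square
        by (simp add: algebra_simps)
    qed
    have ee: "(exp (L * T))\<^sup>2 = exp (2 * L * T)"
      by (simp add: power2_eq_square flip: exp_add)
    have "E T \<le> E 0 * exp ((2 * L) * (T - 0))"
    proof (rule derivative_le_imp_exp_le[where J = "{0..T}" and f' = E', OF T _ dE])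
      show "E' t \<le> (2 * L) * E t" if "t \<in> {0..T}" for t
        using E'_le[OF that] by (simp add: abs_le_iff)
    qed auto
    then have 1: "(norm (d T))\<^sup>2 \<le> (exp (L * T) * norm (d 0))\<^sup>2"
      unfolding power_mult_distrib ee power2_norm_eq_inner by (simp add: E_def mult.commute[of "exp _"])
    have "E 0 * exp (- (2 * L) * (T - 0)) \<le> E T"
    proof (rule derivative_ge_imp_exp_ge[where J = "{0..T}" and f' = E', OF T _ dE])
      show "- (2 * L) * E t \<le> E' t" if "t \<in> {0..T}" for t
        using E'_le[OF that] by (simp add: abs_le_iff)
    qed auto
    then have "E 0 * exp (- (2 * L) * (T - 0)) * exp (2 * L * T) \<le> E T * exp (2 * L * T)"
      by (rule mult_right_mono) simp
    then have "E 0 \<le> E T * exp (2 * L * T)"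
      by (simp add: mult.assoc flip: exp_add)
    then have 2: "(norm (d 0))\<^sup>2 \<le> (exp (L * T) * norm (d T))\<^sup>2"
      unfolding power_mult_distrib ee power2_norm_eq_inner by (simp add: E_def mult.commute[of "exp _"])
    show ?thesis
      using power2_le_imp_le[OF 1] power2_le_imp_le[OF 2] by (simp add: d_def dist_norm)
  qed
  show ?thesis
    unfolding flow_Lipschitz_def
  proof (intro exI[of _ L] allI impI)
    fix T x y assume *: "0 \<le> T" "solution_on state_space (\<lambda>_. f) {0..T} x" "solution_on state_space (\<lambda>_. f) {0..T} y"
      "norm (x 0) \<le> \<rho>" "norm (y 0) \<le> \<rho>"
    show "dist (x T) (y T) \<le> exp (L * T) * dist (x 0) (y 0) \<and> dist (x 0) (y 0) \<le> exp (L * T) * dist (x T) (y T)"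
      by (rule main[of T x y, OF *(2-5) *(1)])
  qed
qed

lemma flow_LipschitzD:
  assumes "flow_Lipschitz \<rho> L" "solution_on state_space (\<lambda>_. f) {0..T} x" "solution_on state_space (\<lambda>_. f) {0..T} y"
    and "norm (x 0) \<le> \<rho>" "norm (y 0) \<le> \<rho>" "T \<ge> 0"
  shows "dist (x T) (y T) \<le> exp (L * T) * dist (x 0) (y 0)" "dist (x 0) (y 0) \<le> exp (L * T) * dist (x T) (y T)"
proof -
  note * = assms(1)[unfolded flow_Lipschitz_def, THEN spec[where x = T], THEN spec[where x = x], THEN spec[where x = y]]
  show "dist (x T) (y T) \<le> exp (L * T) * dist (x 0) (y 0)"
    by (rule *[THEN mp, OF assms(6), THEN mp, OF assms(2), THEN mp, OF assms(3), THEN mp, OF assms(4), THEN mp, OF assms(5), THEN conjunct1])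
  show "dist (x 0) (y 0) \<le> exp (L * T) * dist (x T) (y T)"
    by (rule *[THEN mp, OF assms(6), THEN mp, OF assms(2), THEN mp, OF assms(3), THEN mp, OF assms(4), THEN mp, OF assms(5), THEN conjunct2])
qed

lemma solution_unique:
  assumes x: "solution_on state_space (\<lambda>_. f) {0..} x" and y: "solution_on state_space (\<lambda>_. f) {0..} y"
    and 0: "x 0 = y 0" and t: "t \<ge> 0"
  shows "x t = y t"
proof -
  obtain L where L: "flow_Lipschitz (norm (y 0)) L" using flow_Lipschitz_exists by blast
  have sub: "{0..t} \<subseteq> {0..}" by simp
  have "norm (x 0) \<le> norm (y 0)" using 0 by simp
  from flow_LipschitzD(1)[OF L solution_on_subset[OF x sub] solution_on_subset[OF y sub] this order_refl t]
  show ?thesis using 0 by simp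
qed

end

section \<open>Barbalat's lemma and scalar asymptotics\<close>

lemma Barbalat:
  fixes F F' F'' :: "real \<Rightarrow> real"
  assumes F: "\<And>t. t \<ge> 0 \<Longrightarrow> (F has_real_derivative F' t) (at t within {0..})"
    and F': "\<And>t. t \<ge> 0 \<Longrightarrow> (F' has_real_derivative F'' t) (at t within {0..})"
    and bnd: "\<And>t. t \<ge> 0 \<Longrightarrow> \<bar>F'' t\<bar> \<le> B"
    and lim: "(F \<longlongrightarrow> l) at_top"
  shows "(F' \<longlongrightarrow> 0) at_top"
proof (rule tendstoI)
  fix e :: real assume e: "e > 0"
  define b where "b = max B 1"
  have b: "b > 0" "\<And>t. t \<ge> 0 \<Longrightarrow> \<bar>F'' t\<bar> \<le> b" using bnd by (auto simp: b_def le_max_iff_disj)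
  \<comment> \<open>Over a window of length \<open>d\<close> the increment of \<open>F\<close> tends
    to zero, so \<open>F'\<close> is below \<open>e / 2\<close> at an intermediate point; the bound
    \<open>b\<close> on \<open>F''\<close> lets \<open>F'\<close> change by at most
    \<open>b * d = e / 2\<close> on the way back to \<open>t\<close>.\<close>
  define d where "d = e / (2 * b)"
  have d: "d > 0" using e b by (simp add: d_def)
  have "((\<lambda>t. F (t + d)) \<longlongrightarrow> l) at_top"
    unfolding add.commute[of _ d]
    by (intro filterlim_compose[OF lim] filterlim_tendsto_add_at_top[OF tendsto_const] filterlim_ident)
  then have "((\<lambda>t. F (t + d) - F t) \<longlongrightarrow> l - l) at_top" by (intro tendsto_diff lim)
  then have "\<forall>\<^sub>F t in at_top. \<bar>F (t + d) - F t\<bar> < d * e / 2"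
    using tendstoD[of "\<lambda>t. F (t + d) - F t" 0 at_top "d * e / 2"] d e by (simp add: dist_norm)
  then show "\<forall>\<^sub>F t in at_top. dist (F' t) 0 < e"
    using eventually_ge_at_top[of 0]
  proof eventually_elim
    case (elim t)
    have sub: "{t..t+d} \<subseteq> {0..}" using elim by auto
    obtain z where z: "z \<in> {t<..<t+d}" "F (t + d) - F t = (t + d - t) * F' z"
    proof (rule mvt_simple[of t "t + d" F "\<lambda>s. (*) (F' s)", THEN bexE])
      show "(F has_derivative (*) (F' s)) (at s within {t..t+d})" if "t \<le> s" "s \<le> t + d" for s
        using DERIV_subset[OF F sub, of s] that elim by (simp add: has_field_derivative_def)
    qed (use d in \<open>auto simp: mult.commute\<close>)
    then have "d * \<bar>F' z\<bar> < d * (e / 2)" using elim d by (simp add: abs_mult)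
    then have Fz: "\<bar>F' z\<bar> < e / 2" using d by simp
    have sz: "{t..z} \<subseteq> {0..}" "t \<le> z" using z elim by auto
    have "F' t + b * t \<le> F' z + b * z"
    proof (rule nonneg_derivative_imp_le[OF sz(2,1), where f' = "\<lambda>t. F'' t + b"])
      show "F'' s + b \<ge> 0" if "s \<in> {t..z}" for s
        using b(2)[of s] elim that by auto
    qed (use elim in \<open>auto intro!: derivative_eq_intros F'\<close>)
    moreover have "b * t - F' t \<le> b * z - F' z"
      by (rule nonneg_derivative_imp_le[OF sz(2,1), where f' = "\<lambda>t. b - F'' t"])
         (use b elim in \<open>auto intro!: derivative_eq_intros F' simp: abs_le_iff\<close>)
    moreover have "b * z - b * t \<le> b * d"
      using z b by (simp flip: right_diff_distrib)
    moreover have "b * d = e / 2" using b by (simp add: d_def)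
    ultimately show ?case using Fz by (simp add: dist_norm)
  qed
qed

lemma antimono_bounded_below_tendsto:
  fixes V :: "real \<Rightarrow> real"
  assumes "\<And>s t. 0 \<le> s \<Longrightarrow> s \<le> t \<Longrightarrow> V t \<le> V s" "\<And>t. t \<ge> 0 \<Longrightarrow> b \<le> V t"
  obtains l where "(V \<longlongrightarrow> l) at_top"
proof
  show "(V \<longlongrightarrow> Inf (V ` {0..})) at_top"
  proof (rule decreasing_tendsto)
    have bdd: "bdd_below (V ` {0..})" by (intro bdd_belowI[of _ b]) (use assms(2) in auto)
    show "\<forall>\<^sub>F t in at_top. Inf (V ` {0..}) \<le> V t"
      using eventually_ge_at_top[of 0] by eventually_elim (auto intro!: cInf_lower bdd)
    fix r assume "Inf (V ` {0..}) < r"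
    then obtain t where t: "t \<ge> 0" "V t < r" using cInf_lessD[of "V ` {0..}" r] by auto
    show "\<forall>\<^sub>F s in at_top. V s < r"
      using eventually_ge_at_top[of t] by eventually_elim (use t assms(1) in \<open>auto intro: le_less_trans\<close>)
  qed
qed

text \<open>After the last time \<open>s\<close> with \<open>F s \<ge> l\<close> the function lies
  below \<open>l\<close>; but there \<open>F s = l\<close>, and the positive derivative pushes it
  above. A level where the derivative is positive is crossed only upwards.\<close>

lemma derivative_level_invariant:
  fixes F F' :: "real \<Rightarrow> real"
  assumes F: "\<And>t. t \<ge> t0 \<Longrightarrow> (F has_real_derivative F' t) (at t within {0..})" and t0: "t0 \<ge> 0"
    and pos: "\<And>t. t \<ge> t0 \<Longrightarrow> F t = l \<Longrightarrow> F' t > 0" and start: "F t0 \<ge> l" and t: "t \<ge> t0"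
  shows "F t \<ge> l"
proof (rule ccontr)
  assume "\<not> F t \<ge> l"
  define S where "S = {s \<in> {t0..t}. l \<le> F s}"
  have con: "continuous_on {t0..t} F"
    unfolding continuous_on_eq_continuous_within
    using DERIV_continuous[OF DERIV_subset[OF F]] t0 by auto
  have "closed S"
    using continuous_closed_preimage[OF con closed_atLeastAtMost closed_atLeast[of l]]
    by (simp add: S_def vimage_def Int_def)
  moreover have "bounded S" by (rule bounded_subset[OF bounded_closed_interval[of t0 t]]) (auto simp: S_def)
  ultimately have "compact S" by (simp add: compact_eq_bounded_closed)
  moreover have "t0 \<in> S" using start t by (auto simp: S_def)
  ultimately obtain s where s: "s \<in> S" "\<And>u. u \<in> S \<Longrightarrow> u \<le> s"
    using compact_attains_sup[of S] by blast
  have less: "F u < l" if "s < u" "u \<le> t" for u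
    using s(1) s(2)[of u] that by (auto simp: S_def not_le[symmetric])
  have st: "t0 \<le> s" "s < t" "l \<le> F s" using s(1) \<open>\<not> F t \<ge> l\<close> by (auto simp: S_def less_le)
  have "F s = l"
  proof (rule ccontr)
    assume "F s \<noteq> l"
    then obtain u where "s \<le> u" "u \<le> t" "F u = l"
      using IVT2'[of F t l s] continuous_on_subset[OF con, of "{s..t}"] st \<open>\<not> F t \<ge> l\<close> by auto
    then show False using less[of u] \<open>F s \<noteq> l\<close> by (cases "u = s") auto
  qed
  then obtain d where "d > 0" "\<And>h. h > 0 \<Longrightarrow> s + h \<in> {0..} \<Longrightarrow> h < d \<Longrightarrow> F s < F (s + h)"
    using has_real_derivative_pos_inc_right[OF F[of s] pos[of s]] st by blast
  from this(1) this(2)[of "min (d / 2) (t - s)"] have "F s < F (s + min (d / 2) (t - s))"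
    using st t0 by auto
  moreover have "F (s + min (d / 2) (t - s)) < l" using \<open>d > 0\<close> st by (intro less) auto
  ultimately show False using \<open>F s = l\<close> by simp
qed

text \<open>The level \<open>a\<close> cannot be crossed downwards, so below \<open>b\<close> the
  function grows at rate at least \<open>c\<close> and must reach \<open>b\<close>, which it cannot
  cross downwards either.\<close>

lemma derivative_climb:
  fixes F F' :: "real \<Rightarrow> real"
  assumes F: "\<And>t. t \<ge> T \<Longrightarrow> (F has_real_derivative F' t) (at t within {0..})" and T: "T \<ge> 0"
    and pos: "\<And>t. t \<ge> T \<Longrightarrow> a \<le> F t \<Longrightarrow> F t \<le> b \<Longrightarrow> F' t \<ge> c" and c: "c > 0"
    and start: "F T \<ge> a" and ab: "a \<le> b"
  shows "\<forall>\<^sub>F t in at_top. F t \<ge> b"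
proof -
  have "\<exists>t\<ge>T. F t \<ge> b"
  proof (rule ccontr)
    assume *: "\<not> ?thesis"
    have ge: "F t \<ge> a" if "t \<ge> T" for t
      using F T _ start that
    proof (rule derivative_level_invariant)
      show "F' s > 0" if "s \<ge> T" "F s = a" for s
        using pos[of s] that ab c by linarith
    qed
    \<comment> \<open>The time by which growth at rate \<open>c\<close> covers the gap
      \<open>b - F T\<close>.\<close>
    define t where "t = T + (b - F T) / c"
    have t: "t \<ge> T" using * c by (auto simp: t_def)
    have "F T - c * T \<le> F t - c * t"
    proof (rule nonneg_derivative_imp_le[OF t, where J = "{0..}" and f' = "\<lambda>t. F' t - c"])
      show "F' s - c \<ge> 0" if "s \<in> {T..t}" for s
        using pos[of s] ge[of s] * that by auto
    qed (use T F in \<open>auto intro!: derivative_eq_intros\<close>)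
    moreover have "c * t - c * T = b - F T" using c by (simp add: t_def field_simps)
    ultimately have "F t \<ge> b" by linarith
    then show False using * t by blast
  qed
  then obtain s where s: "s \<ge> T" "F s \<ge> b" by blast
  have "F t \<ge> b" if "t \<ge> s" for t
  proof (rule derivative_level_invariant[of s F F' b t])
    show "F' u > 0" if "u \<ge> s" "F u = b" for u
      using pos[of u] that ab c s by linarith
  qed (use F T s that in auto)
  then show ?thesis unfolding eventually_at_top_linorder by blast
qed

text \<open>Once the input is below \<open>k * e / 2\<close>, the excess \<open>y - e / 2\<close>
  decays at rate \<open>k\<close>; the same bound for \<open>- y\<close> completes the
  estimate.\<close>

lemma stable_linear_decay:
  fixes y h :: "real \<Rightarrow> real"
  assumes y: "\<And>t. t \<ge> 0 \<Longrightarrow> (y has_real_derivative - k * y t - h t) (at t within {0..})"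
    and k: "k > 0" and h: "(h \<longlongrightarrow> 0) at_top"
  shows "(y \<longlongrightarrow> 0) at_top"
proof -
  have upper: "\<forall>\<^sub>F t in at_top. y t < e"
    if y: "\<And>t. t \<ge> 0 \<Longrightarrow> (y has_real_derivative - k * y t - h t) (at t within {0..})"
      and h: "(h \<longlongrightarrow> 0) at_top" and e: "e > 0" for y h :: "real \<Rightarrow> real" and e
  proof -
    have "\<forall>\<^sub>F t in at_top. \<bar>h t\<bar> < k * (e / 2)"
      using tendstoD[OF h, of "k * (e / 2)"] k e by (simp add: dist_norm)
    then obtain T0 where T0: "\<And>t. t \<ge> T0 \<Longrightarrow> \<bar>h t\<bar> < k * (e / 2)"
      unfolding eventually_at_top_linorder by blast
    define T where "T = max T0 0"
    have le: "y t - e / 2 \<le> (y T - e / 2) * exp ((- k) * (t - T))" if t: "t \<ge> T" for t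
    proof (rule derivative_le_imp_exp_le[OF t, where f' = "\<lambda>t. - k * y t - h t" and J = "{0..}"])
      show "- k * y s - h s \<le> - k * (y s - e / 2)" if "s \<in> {T..t}" for s
        using T0[of s] that by (simp add: T_def algebra_simps abs_less_iff)
    qed (use y in \<open>auto simp: T_def intro!: derivative_eq_intros\<close>)
    have "((\<lambda>t. (y T - e / 2) * exp ((- k) * (t - T))) \<longlongrightarrow> 0) at_top"
    proof (intro tendsto_mult_right_zero filterlim_compose[OF exp_at_bot])
      have "filterlim (\<lambda>t. - T + t) at_top at_top"
        by (intro filterlim_tendsto_add_at_top[OF tendsto_const] filterlim_ident)
      then show "filterlim (\<lambda>t. - k * (t - T)) at_bot at_top"
        using k by (intro filterlim_tendsto_neg_mult_at_bot[OF tendsto_const]) simp_all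
    qed
    then have "\<forall>\<^sub>F t in at_top. (y T - e / 2) * exp ((- k) * (t - T)) < e / 2"
      by (rule order_tendstoD) (use e in simp)
    then show ?thesis
      using eventually_ge_at_top[of T] by eventually_elim (use le in fastforce)
  qed
  show ?thesis
  proof (rule tendstoI)
    fix e :: real assume e: "e > 0"
    have "\<forall>\<^sub>F t in at_top. - y t < e"
      by (rule upper[where h = "\<lambda>t. - h t"]) (use y tendsto_minus[OF h] e in \<open>auto intro!: derivative_eq_intros\<close>)
    moreover have "\<forall>\<^sub>F t in at_top. y t < e" by (rule upper[OF y h e])
    ultimately show "\<forall>\<^sub>F t in at_top. dist (y t) 0 < e"
      by eventually_elim (auto simp: dist_norm abs_less_iff)
  qed
qed

subsection \<open>Convergence of the error trajectories\<close>

context observer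
begin

text \<open>Kinetic plus potential energy of the pendulum. As \<open>eta\<close> moves with velocity
  \<open>k1r *\<^sub>R hor\<close>, the weight \<open>k1r / 2\<close> is the one for which the
  exchange with gravity cancels and only the damping \<open>K\<close> remains in
  \<open>energy_deriv\<close>.\<close>

definition energy :: "state \<Rightarrow> real" where
  "energy x = k1r / 2 * (hor x \<bullet> hor x) + g * (1 - eta x $ 3)"

lemma eta_3_bounds:
  assumes "x \<in> state_space" shows "\<bar>eta x $ 3\<bar> \<le> 1"
  using component_le_norm_cart[of "eta x" 3] norm_eta[OF assms] by simp

lemma energy_nonneg: "x \<in> state_space \<Longrightarrow> energy x \<ge> 0"
  using eta_3_bounds[of x] g k1r by (auto simp: energy_def abs_le_iff intro!: add_nonneg_nonneg)

lemma hor_le_energy: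
  assumes "x \<in> state_space" shows "hor x \<bullet> hor x \<le> 2 / k1r * energy x"
proof -
  have "g * (1 - eta x $ 3) \<ge> 0" using eta_3_bounds[OF assms] g by (auto simp: abs_le_iff)
  then have "k1r / 2 * (hor x \<bullet> hor x) \<le> energy x" by (simp add: energy_def)
  then show ?thesis using k1r by (simp add: field_simps)
qed

context
  fixes J x t
  assumes sol: "solution_on state_space (\<lambda>_. f) J x" and t: "t \<in> J"
begin

lemma nth_deriv:
  fixes u :: "real \<Rightarrow> real^3"
  assumes "(u has_vector_derivative u') (at t within J)"
  shows "((\<lambda>t. u t $ i) has_real_derivative u' $ i) (at t within J)"
  using bounded_linear.has_vector_derivative[OF bounded_linear_vec_nth assms]
  by (simp add: has_real_derivative_iff_has_vector_derivative)

lemma eta_3_deriv: "((\<lambda>t. eta (x t) $ 3) has_real_derivative k1r * hor (x t) $ 3) (at t within J)"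
  using nth_deriv[OF eta_deriv[OF sol t], of 3] by simp

lemma hor_hor_deriv: "((\<lambda>t. hor (x t) \<bullet> hor (x t)) has_real_derivative
    2 * (g * hor (x t) $ 3 - K * (hor (x t) \<bullet> hor (x t)))) (at t within J)"
proof -
  have "2 * (hor (x t) \<bullet> (g *\<^sub>R (e3 - eta (x t) $ 3 *\<^sub>R eta (x t)) - K *\<^sub>R hor (x t) - (k1r * (hor (x t) \<bullet> hor (x t))) *\<^sub>R eta (x t)))
    = 2 * (g * hor (x t) $ 3 - K * (hor (x t) \<bullet> hor (x t)))"
    using hor_eta[OF sol_in[OF sol t]] by (simp add: inner_diff_right inner_e3)
  with has_real_derivative_inner[OF hor_deriv[OF sol t] hor_deriv[OF sol t] refl]
  show ?thesis by (simp add: inner_commute)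
qed

lemma hor_3_deriv: "((\<lambda>t. hor (x t) $ 3) has_real_derivative
    g * (1 - (eta (x t) $ 3)\<^sup>2) - K * hor (x t) $ 3 - k1r * (hor (x t) \<bullet> hor (x t)) * eta (x t) $ 3) (at t within J)"
  using nth_deriv[OF hor_deriv[OF sol t], of 3] by (simp add: power2_eq_square)

lemma energy_deriv: "((\<lambda>t. energy (x t)) has_real_derivative - (k1r * K * (hor (x t) \<bullet> hor (x t)))) (at t within J)"
  unfolding energy_def
  by (rule DERIV_cong, (rule derivative_intros hor_hor_deriv eta_3_deriv)+) (simp add: algebra_simps)

end

lemma energy_antimono:
  assumes sol: "solution_on state_space (\<lambda>_. f) {0..T} x" and "s \<in> {0..T}" "t \<in> {0..T}" "s \<le> t"
  shows "energy (x t) \<le> energy (x s)"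
proof -
  have "- energy (x s) \<le> - energy (x t)"
    by (rule nonneg_derivative_imp_le[OF \<open>s \<le> t\<close>, where J = "{0..T}" and f' = "\<lambda>t. k1r * K * (hor (x t) \<bullet> hor (x t))"])
       (use assms k1r K in \<open>auto intro!: derivative_eq_intros energy_deriv[OF sol]\<close>)
  then show ?thesis by simp
qed

context
  fixes x
  assumes sol: "solution_on state_space (\<lambda>_. f) {0..} x"
begin

lemma in_space: "t \<ge> 0 \<Longrightarrow> x t \<in> state_space"
  using sol_in[OF sol] by simp

lemma energy_le_initial: "t \<ge> 0 \<Longrightarrow> energy (x t) \<le> energy (x 0)"
  by (rule energy_antimono[OF solution_on_subset[OF sol, of "{0..t}"]]) auto

lemma hor_bounded: obtains P where "P > 0" "\<And>t. t \<ge> 0 \<Longrightarrow> norm (hor (x t)) \<le> P"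
proof -
  \<comment> \<open>The summand \<open>1\<close> ensures \<open>P \<ge> 1\<close>, so that
    \<open>P\<close> is at most its square and serves as a bound of the norm itself.\<close>
  define P where "P = 2 / k1r * energy (x 0) + 1"
  have "P \<ge> 1" using energy_nonneg[OF in_space[of 0]] k1r by (simp add: P_def)
  moreover have "norm (hor (x t)) \<le> P" if "t \<ge> 0" for t
  proof (rule power2_le_imp_le)
    have "(norm (hor (x t)))\<^sup>2 \<le> 2 / k1r * energy (x t)"
      using hor_le_energy[OF in_space[OF that]] by (simp add: power2_norm_eq_inner)
    also have "\<dots> \<le> 2 / k1r * energy (x 0)"
      using energy_le_initial[OF that] k1r by (intro mult_left_mono) auto
    also have "\<dots> \<le> P * 1" by (simp add: P_def)
    also have "\<dots> \<le> P * P" using \<open>P \<ge> 1\<close> by (intro mult_left_mono) auto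
    finally show "(norm (hor (x t)))\<^sup>2 \<le> P\<^sup>2" by (simp add: power2_eq_square)
  qed (use \<open>P \<ge> 1\<close> in auto)
  ultimately show ?thesis using that[of P] by simp
qed

lemma energy_tendsto: obtains l where "((\<lambda>t. energy (x t)) \<longlongrightarrow> l) at_top"
proof (rule antimono_bounded_below_tendsto)
  show "energy (x t) \<le> energy (x s)" if "0 \<le> s" "s \<le> t" for s t
    by (rule energy_antimono[OF solution_on_subset[OF sol, of "{0..t}"]]) (use that in auto)
  show "0 \<le> energy (x t)" if "t \<ge> 0" for t by (rule energy_nonneg[OF in_space[OF that]])
qed

text \<open>Barbalat for the energy: it decreases to a limit and its second derivative is bounded,
  so its derivative, a multiple of \<open>hor \<bullet> hor\<close>, tends to zero.\<close>

lemma hor_tendsto_0: "((\<lambda>t. hor (x t)) \<longlongrightarrow> 0) at_top"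
proof -
  obtain P where P: "P > 0" "\<And>t. t \<ge> 0 \<Longrightarrow> norm (hor (x t)) \<le> P" using hor_bounded by blast
  obtain l where l: "((\<lambda>t. energy (x t)) \<longlongrightarrow> l) at_top" using energy_tendsto by blast
  have "((\<lambda>t. - (k1r * K * (hor (x t) \<bullet> hor (x t)))) \<longlongrightarrow> 0) at_top"
  proof (rule Barbalat[OF _ _ _ l])
    fix t :: real assume t: "t \<ge> 0"
    then have t': "t \<in> {0..}" by simp
    show "((\<lambda>t. energy (x t)) has_real_derivative - (k1r * K * (hor (x t) \<bullet> hor (x t)))) (at t within {0..})"
      by (rule energy_deriv[OF sol t'])
    show "((\<lambda>t. - (k1r * K * (hor (x t) \<bullet> hor (x t)))) has_real_derivative
       - (k1r * K * (2 * (g * hor (x t) $ 3 - K * (hor (x t) \<bullet> hor (x t)))))) (at t within {0..})"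
      by (intro DERIV_minus DERIV_cmult hor_hor_deriv[OF sol t'])
    have "\<bar>hor (x t) $ 3\<bar> \<le> P" using component_le_norm_cart[of "hor (x t)" 3] P(2)[OF t] by linarith
    moreover have "hor (x t) \<bullet> hor (x t) \<le> P\<^sup>2" using P(2)[OF t] by (simp add: dot_square_norm power_mono)
    ultimately have "\<bar>g * hor (x t) $ 3 - K * (hor (x t) \<bullet> hor (x t))\<bar> \<le> g * P + K * P\<^sup>2"
      using g K by (intro order_trans[OF abs_triangle_ineq4] add_mono) (auto simp: abs_mult)
    moreover have ab: "\<bar>- (k1r * K * (2 * X))\<bar> = k1r * K * 2 * \<bar>X\<bar>" for X
      using k1r K by (simp add: abs_mult)
    ultimately have "k1r * K * 2 * \<bar>g * hor (x t) $ 3 - K * (hor (x t) \<bullet> hor (x t))\<bar> \<le> k1r * K * 2 * (g * P + K * P\<^sup>2)"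
      using k1r K by (intro mult_left_mono) auto
    then show "\<bar>- (k1r * K * (2 * (g * hor (x t) $ 3 - K * (hor (x t) \<bullet> hor (x t)))))\<bar> \<le> k1r * K * 2 * (g * P + K * P\<^sup>2)"
      unfolding ab by (simp only: mult.assoc)
  qed
  then have "((\<lambda>t. (- 1 / (k1r * K)) * - (k1r * K * (hor (x t) \<bullet> hor (x t)))) \<longlongrightarrow> (- 1 / (k1r * K)) * 0) at_top"
    by (rule tendsto_mult_left)
  then have "((\<lambda>t. hor (x t) \<bullet> hor (x t)) \<longlongrightarrow> 0) at_top" using k1r K by simp
  then have "((\<lambda>t. sqrt (hor (x t) \<bullet> hor (x t))) \<longlongrightarrow> sqrt 0) at_top" by (rule tendsto_real_sqrt)
  then show ?thesis by (simp add: tendsto_norm_zero_iff flip: norm_eq_sqrt_inner)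
qed

text \<open>Barbalat once more, now for the vertical component of \<open>hor\<close>, which tends to
  zero: so does its derivative \<open>?D\<close>, in which every term except
  \<open>g * (1 - (eta $ 3)\<^sup>2)\<close> is already known to vanish.\<close>

lemma eta_3_square_tendsto: "((\<lambda>t. 1 - (eta (x t) $ 3)\<^sup>2) \<longlongrightarrow> 0) at_top"
proof -
  let ?D = "\<lambda>t. g * (1 - (eta (x t) $ 3)\<^sup>2) - K * hor (x t) $ 3 - k1r * (hor (x t) \<bullet> hor (x t)) * eta (x t) $ 3"
  let ?E = "\<lambda>t. - (g * (2 * eta (x t) $ 3 * (k1r * hor (x t) $ 3))) - K * ?D t
     - k1r * (2 * (g * hor (x t) $ 3 - K * (hor (x t) \<bullet> hor (x t))) * eta (x t) $ 3 + (hor (x t) \<bullet> hor (x t)) * (k1r * hor (x t) $ 3))"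
  obtain P where P: "P > 0" "\<And>t. t \<ge> 0 \<Longrightarrow> norm (hor (x t)) \<le> P" using hor_bounded by blast
  have h3: "((\<lambda>t. hor (x t) $ 3) \<longlongrightarrow> 0) at_top"
    using tendsto_vec_nth[OF hor_tendsto_0, of 3] by simp
  have hh: "((\<lambda>t. hor (x t) \<bullet> hor (x t)) \<longlongrightarrow> 0) at_top"
    using tendsto_inner[OF hor_tendsto_0 hor_tendsto_0] by simp
  have hhe: "((\<lambda>t. (hor (x t) \<bullet> hor (x t)) * eta (x t) $ 3) \<longlongrightarrow> 0) at_top"
  proof (rule Lim_null_comparison[OF _ hh])
    show "\<forall>\<^sub>F t in at_top. norm ((hor (x t) \<bullet> hor (x t)) * eta (x t) $ 3) \<le> hor (x t) \<bullet> hor (x t)"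
      using eventually_ge_at_top[of 0]
      by eventually_elim (use eta_3_bounds[OF in_space] in \<open>auto simp: abs_mult intro!: mult_left_le\<close>)
  qed
  have "(?D \<longlongrightarrow> 0) at_top"
  proof (rule Barbalat[OF _ _ _ h3])
    fix t :: real assume t: "t \<ge> 0"
    then have t': "t \<in> {0..}" by simp
    show "((\<lambda>t. hor (x t) $ 3) has_real_derivative ?D t) (at t within {0..})"
      by (rule hor_3_deriv[OF sol t'])
    show "(?D has_real_derivative ?E t) (at t within {0..})"
      by (rule derivative_eq_intros eta_3_deriv[OF sol t'] hor_hor_deriv[OF sol t'] hor_3_deriv[OF sol t'] refl)+
         (simp add: algebra_simps power2_eq_square)
    \<comment> \<open>Only boundedness of the second derivative \<open>?E\<close> is at stake. It is
      a polynomial in these three quantities, bounded by \<open>1\<close>, \<open>P\<close> and the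
      square of \<open>P\<close>.\<close>
    define a b c where "a = eta (x t) $ 3" and "b = hor (x t) $ 3" and "c = hor (x t) \<bullet> hor (x t)"
    have a: "\<bar>a\<bar> \<le> 1" unfolding a_def by (rule eta_3_bounds[OF in_space[OF t]])
    have b: "\<bar>b\<bar> \<le> P" using component_le_norm_cart[of "hor (x t)" 3] P(2)[OF t] unfolding b_def by linarith
    have c: "\<bar>c\<bar> \<le> P\<^sup>2" using P(2)[OF t] by (simp add: c_def dot_square_norm power_mono)
    have a2: "\<bar>1 - a\<^sup>2\<bar> \<le> 1" using a abs_square_le_1[of a] by simp
    have ca: "\<bar>c * a\<bar> \<le> P\<^sup>2 * 1" unfolding abs_mult using a c by (intro mult_mono) auto
    have D: "\<bar>g * (1 - a\<^sup>2) - K * b - k1r * c * a\<bar> \<le> g * 1 + K * P + k1r * (P\<^sup>2 * 1)"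
      using g K k1r a2 b ca
      by (intro order_trans[OF abs_triangle_ineq4] add_mono) (auto simp: abs_mult mult.assoc)
    have ab: "\<bar>a * (k1r * b)\<bar> \<le> 1 * (k1r * P)"
      unfolding abs_mult using a b k1r by (intro mult_mono) auto
    have F: "\<bar>g * b - K * c\<bar> \<le> g * P + K * P\<^sup>2"
      using g K b c by (intro order_trans[OF abs_triangle_ineq4] add_mono) (auto simp: abs_mult)
    have Fa: "\<bar>(g * b - K * c) * a\<bar> \<le> (g * P + K * P\<^sup>2) * 1"
      unfolding abs_mult[of _ a] using F a by (intro mult_mono) auto
    have cb: "\<bar>c * (k1r * b)\<bar> \<le> P\<^sup>2 * (k1r * P)"
      unfolding abs_mult using b c k1r by (intro mult_mono) auto
    have "\<bar>- (g * (2 * a * (k1r * b))) - K * (g * (1 - a\<^sup>2) - K * b - k1r * c * a) - k1r * (2 * (g * b - K * c) * a + c * (k1r * b))\<bar>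
      \<le> (g * 2) * \<bar>a * (k1r * b)\<bar> + K * \<bar>g * (1 - a\<^sup>2) - K * b - k1r * c * a\<bar> + k1r * (2 * \<bar>(g * b - K * c) * a\<bar> + \<bar>c * (k1r * b)\<bar>)"
    proof -
      have *: "\<bar>- (u * A) - K * D - k1r * (2 * G + H)\<bar> \<le> u * \<bar>A\<bar> + K * \<bar>D\<bar> + k1r * (2 * \<bar>G\<bar> + \<bar>H\<bar>)" if "u > 0" for u A D G H :: real
      proof -
        have "\<bar>2 * G + H\<bar> \<le> 2 * \<bar>G\<bar> + \<bar>H\<bar>" by linarith
        then have "\<bar>k1r * (2 * G + H)\<bar> \<le> k1r * (2 * \<bar>G\<bar> + \<bar>H\<bar>)" using k1r by (simp add: abs_mult)
        moreover have "\<bar>u * A\<bar> = u * \<bar>A\<bar>" "\<bar>K * D\<bar> = K * \<bar>D\<bar>" using that K by (simp_all add: abs_mult)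
        ultimately show ?thesis by linarith
      qed
      have e: "- (g * (2 * a * (k1r * b))) = - ((g * 2) * (a * (k1r * b)))"
        "2 * (g * b - K * c) * a = 2 * ((g * b - K * c) * a)" by simp_all
      show ?thesis unfolding e by (rule *) (use g in simp)
    qed
    also have "\<dots> \<le> (g * 2) * (1 * (k1r * P)) + K * (g * 1 + K * P + k1r * (P\<^sup>2 * 1)) + k1r * (2 * ((g * P + K * P\<^sup>2) * 1) + P\<^sup>2 * (k1r * P))"
      using g K k1r ab D Fa cb by (intro add_mono mult_left_mono) auto
    finally show "\<bar>?E t\<bar> \<le> (g * 2) * (1 * (k1r * P)) + K * (g * 1 + K * P + k1r * (P\<^sup>2 * 1)) + k1r * (2 * ((g * P + K * P\<^sup>2) * 1) + P\<^sup>2 * (k1r * P))"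
      unfolding a_def b_def c_def .
  qed
  then have "((\<lambda>t. (?D t + K * hor (x t) $ 3 + k1r * ((hor (x t) \<bullet> hor (x t)) * eta (x t) $ 3)) / g) \<longlongrightarrow> (0 + K * 0 + k1r * 0) / g) at_top"
    using g by (intro tendsto_intros h3 hhe) auto
  moreover have "(?D t + K * hor (x t) $ 3 + k1r * ((hor (x t) \<bullet> hor (x t)) * eta (x t) $ 3)) / g = 1 - (eta (x t) $ 3)\<^sup>2" for t
    using g by (simp add: field_simps)
  ultimately show ?thesis by simp
qed

text \<open>The square tends to \<open>1\<close>, so \<open>eta $ 3\<close> is eventually nonzero
  and, by continuity, of constant sign; with the sign fixed, its distance to the pole is at most one
  minus its square.\<close>

lemma eta_3_tendsto: "((\<lambda>t. eta (x t) $ 3) \<longlongrightarrow> 1) at_top \<or> ((\<lambda>t. eta (x t) $ 3) \<longlongrightarrow> - 1) at_top"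
proof -
  have "\<forall>\<^sub>F t in at_top. 1 - (eta (x t) $ 3)\<^sup>2 < 1"
    by (rule order_tendstoD(2)[OF eta_3_square_tendsto]) simp
  then obtain T0 where T0: "\<And>t. t \<ge> T0 \<Longrightarrow> 1 - (eta (x t) $ 3)\<^sup>2 < 1"
    unfolding eventually_at_top_linorder by blast
  define T where "T = max T0 0"
  have nz: "eta (x t) $ 3 \<noteq> 0" if "t \<ge> T" for t using T0[of t] that by (auto simp: T_def)
  have con: "continuous_on {T..t} (\<lambda>t. eta (x t) $ 3)" for t
    unfolding continuous_on_eq_continuous_within
    using DERIV_continuous[OF DERIV_subset[OF eta_3_deriv[OF sol]]] by (auto simp: T_def)
  show ?thesis
  proof (cases "eta (x T) $ 3 > 0")
    case True
    have pos: "eta (x t) $ 3 > 0" if "t \<ge> T" for t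
    proof (rule ccontr)
      assume "\<not> ?thesis"
      then show False using IVT2'[OF _ _ that con, of 0] True nz by fastforce
    qed
    have "((\<lambda>t. eta (x t) $ 3 - 1) \<longlongrightarrow> 0) at_top"
    proof (rule Lim_null_comparison[OF _ eta_3_square_tendsto])
      show "\<forall>\<^sub>F t in at_top. norm (eta (x t) $ 3 - 1) \<le> 1 - (eta (x t) $ 3)\<^sup>2"
        using eventually_ge_at_top[of T]
      proof eventually_elim
        case (elim t)
        have "eta (x t) $ 3 \<le> 1" using eta_3_bounds[OF in_space[of t]] elim by (auto simp: T_def abs_le_iff)
        then have "eta (x t) $ 3 * eta (x t) $ 3 \<le> eta (x t) $ 3 * 1"
          using pos[OF elim] by (intro mult_left_mono) auto
        then show ?case using \<open>eta (x t) $ 3 \<le> 1\<close> by (simp add: power2_eq_square)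
      qed
    qed
    then show ?thesis using LIM_zero_cancel[of "\<lambda>t. eta (x t) $ 3" 1 at_top] by simp
  next
    case False
    then have "eta (x T) $ 3 < 0" using nz[of T] by auto
    have neg: "eta (x t) $ 3 < 0" if "t \<ge> T" for t
    proof (rule ccontr)
      assume "\<not> ?thesis"
      then show False using IVT'[OF _ _ that con, of 0] \<open>eta (x T) $ 3 < 0\<close> nz by fastforce
    qed
    have "((\<lambda>t. eta (x t) $ 3 - (- 1)) \<longlongrightarrow> 0) at_top"
    proof (rule Lim_null_comparison[OF _ eta_3_square_tendsto])
      show "\<forall>\<^sub>F t in at_top. norm (eta (x t) $ 3 - (- 1)) \<le> 1 - (eta (x t) $ 3)\<^sup>2"
        using eventually_ge_at_top[of T]
      proof eventually_elim
        case (elim t)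
        have "eta (x t) $ 3 \<ge> - 1" using eta_3_bounds[OF in_space[of t]] elim by (auto simp: T_def abs_le_iff)
        then have "(- eta (x t) $ 3) * (- eta (x t) $ 3) \<le> (- eta (x t) $ 3) * 1"
          using neg[OF elim] by (intro mult_left_mono) auto
        then show ?case using \<open>eta (x t) $ 3 \<ge> - 1\<close> by (simp add: power2_eq_square)
      qed
    qed
    then show ?thesis using LIM_zero_cancel[of "\<lambda>t. eta (x t) $ 3" "- 1" at_top] by simp
  qed
qed

end

end

section \<open>Limits of tilt, heading and velocity\<close>

lemma norm_cross_le: "norm (u \<times> v) \<le> norm u * norm v"
  by (rule power2_le_imp_le) (auto simp: norm_cross power_mult_distrib)

context observer
begin

lemma eta_dist_e3:
  assumes "x \<in> state_space" "\<sigma>\<^sup>2 = 1"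
  shows "(norm (eta x - \<sigma> *\<^sub>R e3))\<^sup>2 = 2 * (1 - \<sigma> * eta x $ 3)"
proof -
  have "(eta x - \<sigma> *\<^sub>R e3) \<bullet> (eta x - \<sigma> *\<^sub>R e3) = eta x \<bullet> eta x - 2 * \<sigma> * eta x $ 3 + \<sigma>\<^sup>2"
    by (simp add: inner_diff_left inner_diff_right inner_e3 power2_eq_square algebra_simps)
  then show ?thesis using assms eta_eta[OF assms(1)] by (simp add: power2_norm_eq_inner)
qed

lemma mag_dist_m:
  assumes "x \<in> state_space"
  shows "(norm (mag x - m))\<^sup>2 = 2 * (m \<bullet> m - cn x - m $ 3 * (m \<bullet> eta x))"
proof -
  have "(mag x - m) \<bullet> (mag x - m) = mag x \<bullet> mag x - 2 * (m \<bullet> mag x) + m \<bullet> m"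
    by (simp add: inner_diff_left inner_diff_right inner_commute)
  then show ?thesis using mag_mag[OF assms] by (simp add: power2_norm_eq_inner cn_def)
qed

text \<open>A rotation is determined by its values on \<open>e3\<close> and \<open>m\<close>, which
  are not parallel; the value on \<open>e3 \<times> m\<close> is the cross product of the two. This
  quantifies how \<open>eta\<close> and \<open>mag\<close> together control the attitude.\<close>

lemma norm_snd_diff_le:
  "\<exists>C>0. \<forall>x\<in>state_space. \<forall>x'\<in>state_space.
     norm (snd x - snd x') \<le> C * (norm (eta x - eta x') + norm (mag x - mag x'))"
proof -
  define C1 where "C1 = 1 + norm m"
  define C2 where "C2 = (\<bar>m $ 1\<bar> + \<bar>m $ 2\<bar>) * C1 / M"
  have C1: "C1 \<ge> 1" by (simp add: C1_def)
  have C2: "C2 \<ge> 0" using C1 M by (simp add: C2_def)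
  have "norm (snd x - snd x') \<le> (3 * (C2 + C2 + 1)) * (norm (eta x - eta x') + norm (mag x - mag x'))"
    if x: "x \<in> state_space" and x': "x' \<in> state_space" for x x'
  proof -
    define D where "D = snd x - snd x'"
    define S where "S = norm (eta x - eta x') + norm (mag x - mag x')"
    have De3: "D *v e3 = eta x - eta x'" and Dm: "D *v m = mag x - mag x'"
      by (simp_all add: D_def eta_def mag_def matrix_vector_mult_diff_rdistrib)
    define u where "u = m - m $ 3 *\<^sub>R e3"
    define v where "v = e3 \<times> m"
    have nu: "norm (D *v u) \<le> C1 * S"
    proof -
      have "D *v u = (mag x - mag x') - m $ 3 *\<^sub>R (eta x - eta x')"
        by (simp add: u_def matrix_vector_mult_diff_distrib De3 Dm matrix_vector_mult_scaleR)
      then have "norm (D *v u) \<le> norm (mag x - mag x') + \<bar>m $ 3\<bar> * norm (eta x - eta x')"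
        using norm_triangle_ineq4[of "mag x - mag x'" "m $ 3 *\<^sub>R (eta x - eta x')"] by simp
      also have "\<dots> \<le> C1 * norm (mag x - mag x') + C1 * norm (eta x - eta x')"
        using component_le_norm_cart[of m 3] C1
        by (intro add_mono mult_right_mono) (auto simp: C1_def mult_le_cancel_right1)
      finally show ?thesis by (simp add: S_def algebra_simps)
    qed
    have nv: "norm (D *v v) \<le> C1 * S"
    proof -
      have "snd x *v v = eta x \<times> mag x" "snd x' *v v = eta x' \<times> mag x'"
        unfolding v_def eta_def mag_def by (simp_all add: cross_rotation_matrix state_rotation x x')
      then have "D *v v = (eta x - eta x') \<times> mag x + eta x' \<times> (mag x - mag x')"
        by (simp add: D_def matrix_vector_mult_diff_rdistrib Cross3.left_diff_distrib Cross3.right_diff_distrib)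
      then have "norm (D *v v) \<le> norm (eta x - eta x') * norm m + norm (mag x - mag x')"
        using norm_triangle_ineq[of "(eta x - eta x') \<times> mag x" "eta x' \<times> (mag x - mag x')"]
          norm_cross_le[of "eta x - eta x'" "mag x"] norm_cross_le[of "eta x'" "mag x - mag x'"]
          norm_mag[OF x] norm_eta[OF x'] by simp
      also have "\<dots> \<le> norm (eta x - eta x') * C1 + norm (mag x - mag x') * C1"
        using C1 by (intro add_mono mult_left_mono) (auto simp: C1_def mult_le_cancel_left1)
      finally show ?thesis by (simp add: S_def algebra_simps)
    qed
    have S: "S \<ge> 0" by (simp add: S_def)
    have MM: "m $ 1 * m $ 1 + m $ 2 * m $ 2 = M" by (simp add: M_def power2_eq_square)
    \<comment> \<open>The horizontal part \<open>u\<close> of \<open>m\<close> and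
      \<open>v = e3 \<times> m\<close> form an orthogonal basis of the horizontal plane, both of
      squared length \<open>M\<close>.\<close>
    have e1: "axis 1 1 = (1 / M) *\<^sub>R (m $ 1 *\<^sub>R u - m $ 2 *\<^sub>R v)"
      and e2: "axis 2 1 = (1 / M) *\<^sub>R (m $ 2 *\<^sub>R u + m $ 1 *\<^sub>R v)"
      using M MM by (simp_all add: vec_eq_iff forall_3 u_def v_def cross3_eval axis_def add.commute)
    have b: "norm (D *v ((1 / M) *\<^sub>R (\<alpha> *\<^sub>R u + \<beta> *\<^sub>R v))) \<le> ((\<bar>\<alpha>\<bar> + \<bar>\<beta>\<bar>) * C1 / M) * S" for \<alpha> \<beta>
    proof -
      have "norm (D *v (\<alpha> *\<^sub>R u + \<beta> *\<^sub>R v)) \<le> \<bar>\<alpha>\<bar> * norm (D *v u) + \<bar>\<beta>\<bar> * norm (D *v v)"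
        using norm_triangle_ineq[of "\<alpha> *\<^sub>R (D *v u)" "\<beta> *\<^sub>R (D *v v)"]
        by (simp add: matrix_vector_right_distrib matrix_vector_mult_scaleR)
      also have "\<dots> \<le> \<bar>\<alpha>\<bar> * (C1 * S) + \<bar>\<beta>\<bar> * (C1 * S)"
        by (intro add_mono mult_left_mono nu nv) auto
      finally have "norm (D *v (\<alpha> *\<^sub>R u + \<beta> *\<^sub>R v)) / M \<le> (\<bar>\<alpha>\<bar> * (C1 * S) + \<bar>\<beta>\<bar> * (C1 * S)) / M"
        using M by (intro divide_right_mono) auto
      moreover have "norm (D *v ((1 / M) *\<^sub>R (\<alpha> *\<^sub>R u + \<beta> *\<^sub>R v))) = norm (D *v (\<alpha> *\<^sub>R u + \<beta> *\<^sub>R v)) / M"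
        unfolding matrix_vector_mult_scaleR using M by simp
      moreover have "(\<bar>\<alpha>\<bar> * (C1 * S) + \<bar>\<beta>\<bar> * (C1 * S)) / M = ((\<bar>\<alpha>\<bar> + \<bar>\<beta>\<bar>) * C1 / M) * S"
        by (simp add: distrib_right mult.assoc)
      ultimately show ?thesis by simp
    qed
    have "norm (D *v axis 1 1) \<le> C2 * S"
      using b[of "m $ 1" "- m $ 2"] unfolding e1 C2_def by simp
    moreover have "norm (D *v axis 2 1) \<le> C2 * S"
      using b[of "m $ 2" "m $ 1"] unfolding e2 C2_def by (simp add: add.commute)
    moreover have "norm (D *v axis 3 1) \<le> 1 * S"
      using De3 by (simp add: S_def e3_def)
    ultimately have "3 * (norm (D *v axis 1 1) + norm (D *v axis 2 1) + norm (D *v axis 3 1)) \<le> 3 * (C2 * S + C2 * S + 1 * S)"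
      by (intro mult_left_mono add_mono) auto
    then have "norm D \<le> 3 * (C2 * S + C2 * S + 1 * S)"
      using norm_matrix_le_columns[of D] by (rule order_trans[rotated])
    then show ?thesis by (simp add: D_def S_def algebra_simps)
  qed
  then show ?thesis using C2 by (intro exI[of _ "3 * (C2 + C2 + 1)"]) auto
qed

lemma dist_identity_le:
  "\<exists>C>0. \<forall>x\<in>state_space. dist x (0, mat 1) \<le> C * (norm (fst x) + norm (eta x - e3) + norm (mag x - m))"
proof -
  obtain C where C: "C > 0" "\<And>x x'. x \<in> state_space \<Longrightarrow> x' \<in> state_space \<Longrightarrow>
      norm (snd x - snd x') \<le> C * (norm (eta x - eta x') + norm (mag x - mag x'))"
    using norm_snd_diff_le by blast
  have I: "(0, mat 1) \<in> state_space" by (simp add: state_space_def rotation_matrix_def orthogonal_matrix_id)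
  have "dist x (0, mat 1) \<le> (1 + C) * (norm (fst x) + norm (eta x - e3) + norm (mag x - m))" if "x \<in> state_space" for x
  proof -
    have "dist x (0, mat 1) \<le> norm (fst x) + norm (snd x - mat 1)"
      using norm_Pair_le[of "fst x" "snd x - mat 1"] by (simp add: dist_norm minus_prod_def)
    moreover have "norm (snd x - mat 1) \<le> C * (norm (eta x - e3) + norm (mag x - m))"
      using C(2)[OF that I] by (simp add: eta_def mag_def)
    moreover have "0 \<le> C * norm (fst x)" using C(1) by simp
    ultimately show ?thesis by (simp add: algebra_simps) (smt (verit) norm_ge_zero)
  qed
  then show ?thesis using C(1) by (intro exI[of _ "1 + C"]) auto
qed

context
  fixes x
  assumes sol: "solution_on state_space (\<lambda>_. f) {0..} x"
begin

lemma eta_tendsto: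
  assumes "((\<lambda>t. eta (x t) $ 3) \<longlongrightarrow> \<sigma>) at_top" "\<sigma>\<^sup>2 = 1"
  shows "((\<lambda>t. eta (x t)) \<longlongrightarrow> \<sigma> *\<^sub>R e3) at_top"
proof -
  have "((\<lambda>t. sqrt (2 * (1 - \<sigma> * eta (x t) $ 3))) \<longlongrightarrow> sqrt (2 * (1 - \<sigma> * \<sigma>))) at_top"
    by (intro tendsto_intros assms)
  then have lim: "((\<lambda>t. sqrt (2 * (1 - \<sigma> * eta (x t) $ 3))) \<longlongrightarrow> 0) at_top"
    using assms(2) by (simp add: power2_eq_square)
  have "((\<lambda>t. eta (x t) - \<sigma> *\<^sub>R e3) \<longlongrightarrow> 0) at_top"
  proof (rule Lim_null_comparison[OF _ lim])
    show "\<forall>\<^sub>F t in at_top. norm (eta (x t) - \<sigma> *\<^sub>R e3) \<le> sqrt (2 * (1 - \<sigma> * eta (x t) $ 3))"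
      using eventually_ge_at_top[of 0]
      by eventually_elim
           (simp only: eta_dist_e3[OF in_space[OF sol] assms(2), symmetric] real_sqrt_abs abs_norm_cancel order_refl)
  qed
  then show ?thesis using LIM_zero_cancel[of "\<lambda>t. eta (x t)" "\<sigma> *\<^sub>R e3" at_top] by simp
qed

lemma hor_mag_tendsto_0: "((\<lambda>t. hor (x t) \<bullet> mag (x t)) \<longlongrightarrow> 0) at_top"
proof (rule Lim_null_comparison)
  show "((\<lambda>t. norm (hor (x t)) * norm m) \<longlongrightarrow> 0) at_top"
    using hor_tendsto_0[OF sol] by (intro tendsto_mult_left_zero) (simp add: tendsto_norm_zero)
  show "\<forall>\<^sub>F t in at_top. norm (hor (x t) \<bullet> mag (x t)) \<le> norm (hor (x t)) * norm m"
    using eventually_ge_at_top[of 0]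
  proof eventually_elim
    case (elim t)
    then show ?case
      using Cauchy_Schwarz_ineq2[of "hor (x t)" "mag (x t)"] norm_mag[OF in_space[OF sol elim]] by simp
  qed
qed

context
  assumes up: "((\<lambda>t. eta (x t) $ 3) \<longlongrightarrow> 1) at_top"
begin

lemma eta_tendsto_e3: "((\<lambda>t. eta (x t)) \<longlongrightarrow> e3) at_top"
  using eta_tendsto[OF up] by simp

lemma m_eta_tendsto: "((\<lambda>t. m \<bullet> eta (x t)) \<longlongrightarrow> m $ 3) at_top"
  using tendsto_inner[OF tendsto_const eta_tendsto_e3, of m] by (simp add: inner_e3)

lemma sn_cn_tendsto: "((\<lambda>t. (sn (x t))\<^sup>2 + (cn (x t))\<^sup>2) \<longlongrightarrow> M\<^sup>2) at_top"
proof -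
  have "((\<lambda>t. M * (m \<bullet> m - (m \<bullet> eta (x t))\<^sup>2)) \<longlongrightarrow> M * (m \<bullet> m - (m $ 3)\<^sup>2)) at_top"
    by (intro tendsto_intros m_eta_tendsto)
  then have "((\<lambda>t. M * (m \<bullet> m - (m \<bullet> eta (x t))\<^sup>2)) \<longlongrightarrow> M\<^sup>2) at_top"
    by (simp add: M_eq power2_eq_square)
  moreover have "\<forall>\<^sub>F t in at_top. M * (m \<bullet> m - (m \<bullet> eta (x t))\<^sup>2) = (sn (x t))\<^sup>2 + (cn (x t))\<^sup>2"
    using eventually_ge_at_top[of 0] by eventually_elim (simp add: sn_cn[OF in_space[OF sol]])
  ultimately show ?thesis by (rule Lim_transform_eventually)
qed

text \<open>\<open>cn\<close> obeys the logistic equation with rate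
  \<open>k2r * (M\<^sup>2 - (cn)\<^sup>2)\<close> up to a remainder \<open>r\<close> that tends to
  zero. If \<open>cn\<close> does not converge to \<open>- M\<close>, it is away from
  \<open>- M\<close> at arbitrarily late times, when \<open>r\<close> is already negligible, and
  then it climbs towards \<open>M\<close>.\<close>

lemma cn_tendsto: "((\<lambda>t. cn (x t)) \<longlongrightarrow> M) at_top \<or> ((\<lambda>t. cn (x t)) \<longlongrightarrow> - M) at_top"
proof (rule disjCI)
  assume "\<not> ((\<lambda>t. cn (x t)) \<longlongrightarrow> - M) at_top"
  then obtain e where e: "e > 0" "\<not> (\<forall>\<^sub>F t in at_top. \<bar>cn (x t) + M\<bar> < e)"
    unfolding tendsto_iff by (auto simp: dist_norm)
  define c' where "c' t = k2r * (sn (x t))\<^sup>2 - k1r * (m \<bullet> eta (x t)) * (hor (x t) \<bullet> mag (x t))" for t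
  define r where "r t = k2r * ((sn (x t))\<^sup>2 + (cn (x t))\<^sup>2 - M\<^sup>2) - k1r * (m \<bullet> eta (x t)) * (hor (x t) \<bullet> mag (x t))" for t
  have "(r \<longlongrightarrow> k2r * (M\<^sup>2 - M\<^sup>2) - k1r * m $ 3 * 0) at_top"
    unfolding r_def by (intro tendsto_intros sn_cn_tendsto m_eta_tendsto hor_mag_tendsto_0)
  then have r: "(r \<longlongrightarrow> 0) at_top" by simp
  have key: "(\<forall>\<^sub>F t in at_top. cn (x t) \<ge> M - e1) \<and> (\<forall>\<^sub>F t in at_top. \<bar>cn (x t)\<bar> < M + e1)" if e1: "e1 > 0" "e1 \<le> e" "e1 \<le> M" for e1
  proof -
    have "M\<^sup>2 < (M + e1)\<^sup>2" using M e1 by (intro power_strict_mono) auto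
    then have 1: "\<forall>\<^sub>F t in at_top. (sn (x t))\<^sup>2 + (cn (x t))\<^sup>2 < (M + e1)\<^sup>2"
      by (rule order_tendstoD(2)[OF sn_cn_tendsto])
    have cpos: "k2r * e1 * M / 2 > 0" using k2r e1 M by simp
    have 2: "\<forall>\<^sub>F t in at_top. \<bar>r t\<bar> < k2r * e1 * M / 2"
      using tendstoD[OF r cpos] by (simp add: dist_norm)
    have "\<forall>\<^sub>F t in at_top. t \<ge> 0 \<and> \<bar>cn (x t)\<bar> < M + e1 \<and> \<bar>r t\<bar> < k2r * e1 * M / 2"
      using 1 2 eventually_ge_at_top[of 0]
    proof eventually_elim
      case (elim t)
      then have "\<bar>cn (x t)\<bar>\<^sup>2 < (M + e1)\<^sup>2" using zero_le_power2[of "sn (x t)"] unfolding power2_abs by linarith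
      then have "\<bar>cn (x t)\<bar> < M + e1" by (rule power_less_imp_less_base) (use M e1 in simp)
      then show ?case using elim by simp
    qed
    then obtain T where T: "\<And>t. t \<ge> T \<Longrightarrow> t \<ge> 0 \<and> \<bar>cn (x t)\<bar> < M + e1 \<and> \<bar>r t\<bar> < k2r * e1 * M / 2"
      unfolding eventually_at_top_linorder by blast
    obtain t0 where t0: "t0 \<ge> T" "\<bar>cn (x t0) + M\<bar> \<ge> e"
      using e(2) unfolding eventually_at_top_linorder by (meson not_le)
    \<comment> \<open>The eventual bound on the absolute value rules out that \<open>cn\<close> lies
      beyond \<open>- M\<close> on the far side, so being away from \<open>- M\<close> means being
      above it.\<close>
    have start: "cn (x t0) \<ge> - M + e1" using T[OF t0(1)] t0(2) e1 by linarith
    have "\<forall>\<^sub>F t in at_top. cn (x t) \<ge> M - e1"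
    proof (rule derivative_climb[where F = "\<lambda>t. cn (x t)" and T = t0 and F' = c' and a = "- M + e1", OF _ _ _ cpos start])
      fix t assume t: "t \<ge> t0"
      then have tT: "t \<ge> T" using t0 by simp
      show "((\<lambda>t. cn (x t)) has_real_derivative c' t) (at t within {0..})"
        unfolding c'_def by (rule cn_deriv[OF sol]) (use T[OF tT] in simp)
      assume ge: "- M + e1 \<le> cn (x t)" "cn (x t) \<le> M - e1"
      \<comment> \<open>Between \<open>- M + e1\<close> and \<open>M - e1\<close> the logistic rate
        is at least \<open>k2r * e1 * M\<close>; the remainder takes at most half of it.\<close>
      have "0 \<le> (M - cn (x t) - e1) * (M + cn (x t) - e1)" using ge by (intro mult_nonneg_nonneg) auto
      then have "e1 * (2 * M - e1) \<le> M\<^sup>2 - (cn (x t))\<^sup>2" by (simp add: algebra_simps power2_eq_square)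
      moreover have "e1 * M \<le> e1 * (2 * M - e1)" using e1 by (intro mult_left_mono) auto
      ultimately have "k2r * (e1 * M) \<le> k2r * (M\<^sup>2 - (cn (x t))\<^sup>2)" using k2r by (intro mult_left_mono) auto
      moreover have "c' t = k2r * (M\<^sup>2 - (cn (x t))\<^sup>2) + r t" by (simp add: c'_def r_def algebra_simps)
      moreover have "\<bar>r t\<bar> < k2r * (e1 * M) / 2" using T[OF tT] by (simp add: mult.assoc)
      ultimately show "k2r * e1 * M / 2 \<le> c' t" unfolding mult.assoc abs_less_iff by linarith
    qed (use T[OF t0(1)] e1 in auto)
    moreover have "\<forall>\<^sub>F t in at_top. \<bar>cn (x t)\<bar> < M + e1"
      unfolding eventually_at_top_linorder using T by blast
    ultimately show ?thesis by blast
  qed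
  show "((\<lambda>t. cn (x t)) \<longlongrightarrow> M) at_top"
  proof (rule tendstoI)
    fix d :: real assume d: "d > 0"
    define e1 where "e1 = min (d / 2) (min e M)"
    have e1: "e1 > 0" "e1 \<le> e" "e1 \<le> M" "e1 < d" using d e M by (auto simp: e1_def)
    have "\<forall>\<^sub>F t in at_top. cn (x t) \<ge> M - e1" "\<forall>\<^sub>F t in at_top. \<bar>cn (x t)\<bar> < M + e1"
      using key[OF e1(1-3)] by auto
    then show "\<forall>\<^sub>F t in at_top. dist (cn (x t)) M < d"
      by eventually_elim (use e1 in \<open>auto simp: dist_norm abs_less_iff\<close>)
  qed
qed

lemma vert_tendsto_0: "((\<lambda>t. vert (x t)) \<longlongrightarrow> 0) at_top"
proof (rule stable_linear_decay[OF _ k1v])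
  show "((\<lambda>t. vert (x t)) has_real_derivative - k1v * vert (x t) - g * (1 - eta (x t) $ 3)) (at t within {0..})" if "t \<ge> 0" for t
    using vert_deriv[OF sol, of t] that by (simp add: algebra_simps)
  have "((\<lambda>t. g * (1 - eta (x t) $ 3)) \<longlongrightarrow> g * (1 - 1)) at_top" by (intro tendsto_intros up)
  then show "((\<lambda>t. g * (1 - eta (x t) $ 3)) \<longlongrightarrow> 0) at_top" by simp
qed

lemma solution_tendsto:
  assumes cn: "((\<lambda>t. cn (x t)) \<longlongrightarrow> M) at_top"
  shows "(x \<longlongrightarrow> (0, mat 1)) at_top"
proof -
  obtain C where C: "C > 0" "\<And>x. x \<in> state_space \<Longrightarrow> dist x (0, mat 1) \<le> C * (norm (fst x) + norm (eta x - e3) + norm (mag x - m))"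
    using dist_identity_le by blast
  have "((\<lambda>t. hor (x t) + vert (x t) *\<^sub>R eta (x t)) \<longlongrightarrow> 0 + 0 *\<^sub>R e3) at_top"
    by (intro tendsto_intros hor_tendsto_0[OF sol] vert_tendsto_0 eta_tendsto_e3)
  then have 1: "((\<lambda>t. fst (x t)) \<longlongrightarrow> 0) at_top" by (simp flip: fst_eq)
  have 2: "((\<lambda>t. eta (x t) - e3) \<longlongrightarrow> 0) at_top" using eta_tendsto_e3 LIM_zero by blast
  have "((\<lambda>t. sqrt (2 * (m \<bullet> m - cn (x t) - m $ 3 * (m \<bullet> eta (x t))))) \<longlongrightarrow> sqrt (2 * (m \<bullet> m - M - m $ 3 * m $ 3))) at_top"
    by (intro tendsto_intros cn m_eta_tendsto)
  then have "((\<lambda>t. sqrt (2 * (m \<bullet> m - cn (x t) - m $ 3 * (m \<bullet> eta (x t))))) \<longlongrightarrow> 0) at_top"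
    by (simp add: M_eq power2_eq_square)
  moreover have "\<forall>\<^sub>F t in at_top. sqrt (2 * (m \<bullet> m - cn (x t) - m $ 3 * (m \<bullet> eta (x t)))) = norm (mag (x t) - m)"
    using eventually_ge_at_top[of 0]
    by eventually_elim (simp only: mag_dist_m[OF in_space[OF sol], symmetric] real_sqrt_abs abs_norm_cancel)
  ultimately have 3: "((\<lambda>t. norm (mag (x t) - m)) \<longlongrightarrow> 0) at_top" by (rule Lim_transform_eventually)
  have "((\<lambda>t. C * (norm (fst (x t)) + norm (eta (x t) - e3) + norm (mag (x t) - m))) \<longlongrightarrow> C * (0 + 0 + 0)) at_top"
    by (intro tendsto_intros 3 tendsto_norm_zero 1 2)
  then have lim: "((\<lambda>t. C * (norm (fst (x t)) + norm (eta (x t) - e3) + norm (mag (x t) - m))) \<longlongrightarrow> 0) at_top" by simp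
  show ?thesis
  proof (rule metric_tendsto_imp_tendsto[OF lim])
    show "\<forall>\<^sub>F t in at_top. dist (x t) (0, mat 1) \<le> dist (C * (norm (fst (x t)) + norm (eta (x t) - e3) + norm (mag (x t) - m))) 0"
      using eventually_ge_at_top[of 0]
    proof eventually_elim
      case (elim t)
      then show ?case using C(2)[OF in_space[OF sol elim]] C(1) by (simp add: dist_norm)
    qed
  qed
qed

end

end

subsection \<open>Differences of trajectories near the poles\<close>

definition hor_field :: "state \<Rightarrow> real^3" where
  "hor_field x = g *\<^sub>R (e3 - eta x $ 3 *\<^sub>R eta x) - K *\<^sub>R hor x - (k1r * (hor x \<bullet> hor x)) *\<^sub>R eta x"

definition sn_field :: "state \<Rightarrow> real" where
  "sn_field x = - (k2r * sn x * cn x) + k1r * (m $ 3 * ((m \<times> hor x) \<bullet> eta x) + (m \<times> mag x) \<bullet> hor x)"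

text \<open>\<open>near \<sigma> \<epsilon>\<close> refers to the poles of the spherical pendulum formed by \<open>eta\<close> and \<open>hor\<close>.\<close>

definition near :: "real \<Rightarrow> real \<Rightarrow> state \<Rightarrow> bool" where
  "near \<sigma> \<epsilon> x \<longleftrightarrow> x \<in> state_space \<and> norm (eta x - \<sigma> *\<^sub>R e3) \<le> \<epsilon> \<and> norm (hor x) \<le> \<epsilon>"

text \<open>The value of \<open>mag\<close> at the equilibrium with \<open>eta = e3\<close> and
  heading sign \<open>\<tau>\<close>: \<open>m\<close> itself for \<open>\<tau> = 1\<close>, and
  \<open>m\<close> turned by half a revolution about the vertical for
  \<open>\<tau> = - 1\<close>.\<close>

definition mag_ref :: "real \<Rightarrow> real^3" where
  "mag_ref \<tau> = \<tau> *\<^sub>R (m - m $ 3 *\<^sub>R e3) + m $ 3 *\<^sub>R e3"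

lemma near_nonneg: assumes "near \<sigma> \<epsilon> a" shows "\<epsilon> \<ge> 0"
proof -
  have "norm (hor a) \<le> \<epsilon>" using assms by (simp add: near_def)
  then show ?thesis by (rule order_trans[OF norm_ge_zero])
qed

text \<open>The difference of two unit vectors is orthogonal to their sum, which is close to
  \<open>2 * \<sigma>\<close> times \<open>e3\<close>. Hence the vertical part of the difference is
  of second order.\<close>

lemma eta_diff_3:
  assumes a: "near \<sigma> \<epsilon> a" and b: "near \<sigma> \<epsilon> b" and \<sigma>: "\<sigma>\<^sup>2 = 1"
  shows "\<bar>(eta a - eta b) $ 3\<bar> \<le> \<epsilon> * norm (eta a - eta b)"
proof -
  let ?d = "eta a - eta b"
  have "?d \<bullet> (eta a + eta b) = eta a \<bullet> eta a - eta b \<bullet> eta b"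
    by (simp only: inner_diff_left inner_add_right inner_commute[of "eta b" "eta a"])
  also have "\<dots> = 0"
    using a b eta_eta by (simp add: near_def)
  finally have "?d \<bullet> (eta a + eta b) = 0" .
  moreover have "?d \<bullet> ((eta a - \<sigma> *\<^sub>R e3) + (eta b - \<sigma> *\<^sub>R e3)) = ?d \<bullet> (eta a + eta b) - 2 * (\<sigma> * ?d $ 3)"
    unfolding inner_add_right inner_diff_right inner_scaleR_right inner_e3 by linarith
  ultimately have "2 * (\<sigma> * ?d $ 3) = - (?d \<bullet> ((eta a - \<sigma> *\<^sub>R e3) + (eta b - \<sigma> *\<^sub>R e3)))"
    by linarith
  moreover have "\<bar>?d \<bullet> ((eta a - \<sigma> *\<^sub>R e3) + (eta b - \<sigma> *\<^sub>R e3))\<bar> \<le> norm ?d * (\<epsilon> + \<epsilon>)"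
    using a b by (intro order_trans[OF Cauchy_Schwarz_ineq2] mult_left_mono norm_triangle_mono) (auto simp: near_def)
  ultimately have "\<bar>2 * (\<sigma> * ?d $ 3)\<bar> \<le> norm ?d * (\<epsilon> + \<epsilon>)" by linarith
  then have "2 * (\<bar>\<sigma>\<bar> * \<bar>?d $ 3\<bar>) \<le> norm ?d * (\<epsilon> + \<epsilon>)" by (simp only: abs_mult abs_numeral)
  moreover have "\<bar>\<sigma>\<bar> = 1" using \<sigma> by (simp add: power2_eq_1_iff) auto
  ultimately show ?thesis by (simp add: algebra_simps)
qed

text \<open>Linearisation at a pole for pairs of states, with a remainder whose Lipschitz constant
  is proportional to \<open>\<epsilon>\<close>. The sign \<open>\<sigma>\<close> decides whether
  gravity restores or repels.\<close>

lemma hor_field_diff: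
  assumes a: "near \<sigma> \<epsilon> a" and b: "near \<sigma> \<epsilon> b" and \<sigma>: "\<sigma>\<^sup>2 = 1" and \<epsilon>: "\<epsilon> \<le> 1"
  shows "norm (hor_field a - hor_field b + (g * \<sigma>) *\<^sub>R (eta a - eta b) + K *\<^sub>R (hor a - hor b))
    \<le> 2 * (g + k1r) * \<epsilon> * (norm (eta a - eta b) + norm (hor a - hor b))"
proof -
  let ?d = "eta a - eta b" and ?p = "hor a - hor b"
  have ab: "a \<in> state_space" "b \<in> state_space" using a b by (auto simp: near_def)
  have \<epsilon>0: "\<epsilon> \<ge> 0" by (rule near_nonneg[OF a])
  have "\<bar>eta a $ 3 - \<sigma>\<bar> \<le> \<epsilon>"
    using component_le_norm_cart[of "eta a - \<sigma> *\<^sub>R e3" 3] a by (simp add: near_def)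
  then have 1: "norm ((eta a $ 3 - \<sigma>) *\<^sub>R ?d) \<le> \<epsilon> * norm ?d"
    by (simp add: mult_right_mono)
  have 2: "norm ((?d $ 3) *\<^sub>R eta b) \<le> \<epsilon> * norm ?d"
    using eta_diff_3[OF a b \<sigma>] norm_eta[OF ab(2)] by simp
  have 3: "norm (((hor a + hor b) \<bullet> ?p) *\<^sub>R eta a) \<le> 2 * \<epsilon> * norm ?p"
  proof -
    have "norm (hor a + hor b) \<le> \<epsilon> + \<epsilon>" using a b by (intro norm_triangle_mono) (auto simp: near_def)
    then have "\<bar>(hor a + hor b) \<bullet> ?p\<bar> \<le> (\<epsilon> + \<epsilon>) * norm ?p"
      by (intro order_trans[OF Cauchy_Schwarz_ineq2] mult_right_mono) auto
    then show ?thesis using norm_eta[OF ab(1)] by simp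
  qed
  have 4: "norm ((hor b \<bullet> hor b) *\<^sub>R ?d) \<le> 2 * \<epsilon> * norm ?d"
  proof -
    have "norm (hor b) * norm (hor b) \<le> \<epsilon> * 1"
      using b \<epsilon> \<epsilon>0 by (intro mult_mono) (auto simp: near_def)
    then have "\<bar>hor b \<bullet> hor b\<bar> * norm ?d \<le> \<epsilon> * norm ?d"
      by (intro mult_right_mono) (auto simp: dot_square_norm power2_eq_square)
    then have "norm ((hor b \<bullet> hor b) *\<^sub>R ?d) \<le> \<epsilon> * norm ?d" by simp
    moreover have "0 \<le> \<epsilon> * norm ?d" using \<epsilon>0 by simp
    ultimately show ?thesis by linarith
  qed
  \<comment> \<open>The remainder in closed form: each summand is a difference multiplied by a
    factor of order \<open>\<epsilon>\<close>.\<close>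
  have eq: "hor_field a - hor_field b + (g * \<sigma>) *\<^sub>R ?d + K *\<^sub>R ?p
    = - (g *\<^sub>R ((eta a $ 3 - \<sigma>) *\<^sub>R ?d + (?d $ 3) *\<^sub>R eta b)
      + k1r *\<^sub>R (((hor a + hor b) \<bullet> ?p) *\<^sub>R eta a + (hor b \<bullet> hor b) *\<^sub>R ?d))"
    unfolding hor_field_def
    by (simp add: vec_eq_iff inner_diff_right inner_add_left inner_commute[of "hor b" "hor a"] algebra_simps)
  have "norm (hor_field a - hor_field b + (g * \<sigma>) *\<^sub>R ?d + K *\<^sub>R ?p)
     \<le> g * norm ((eta a $ 3 - \<sigma>) *\<^sub>R ?d + (?d $ 3) *\<^sub>R eta b)
      + k1r * norm (((hor a + hor b) \<bullet> ?p) *\<^sub>R eta a + (hor b \<bullet> hor b) *\<^sub>R ?d)"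
    unfolding eq norm_minus_cancel using g k1r by (intro order_trans[OF norm_triangle_ineq]) simp
  also have "\<dots> \<le> g * (\<epsilon> * norm ?d + \<epsilon> * norm ?d) + k1r * (2 * \<epsilon> * norm ?p + 2 * \<epsilon> * norm ?d)"
    using g k1r 1 2 3 4 by (intro add_mono mult_left_mono norm_triangle_mono) auto
  also have "\<dots> \<le> g * (\<epsilon> * norm ?d + \<epsilon> * norm ?d) + k1r * (2 * \<epsilon> * norm ?p + 2 * \<epsilon> * norm ?d) + 2 * g * (\<epsilon> * norm ?p)"
    using g \<epsilon>0 by simp
  also have "\<dots> = 2 * (g + k1r) * \<epsilon> * (norm ?d + norm ?p)" by (simp add: algebra_simps)
  finally show ?thesis .
qed

section \<open>Heading differences and strict Lyapunov forms\<close>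

lemma inner_cross_diff_le:
  fixes u v w u' v' w' :: "real^3"
  shows "\<bar>(u \<times> v) \<bullet> w - (u \<times> v') \<bullet> w'\<bar> \<le> norm u * (norm (v - v') * norm w + norm v' * norm (w - w'))"
proof -
  have "(u \<times> v) \<bullet> w - (u \<times> v') \<bullet> w' = (u \<times> (v - v')) \<bullet> w + (u \<times> v') \<bullet> (w - w')"
    by (simp add: Cross3.right_diff_distrib inner_diff_left inner_diff_right)
  then show ?thesis
    using inner_cross_le[of u "v - v'" w] inner_cross_le[of u v' "w - w'"] by (simp add: algebra_simps)
qed

lemma norm_mag_ref: "\<tau>\<^sup>2 = 1 \<Longrightarrow> norm (mag_ref \<tau>) = norm m"
proof -
  assume "\<tau>\<^sup>2 = 1"
  moreover have "mag_ref \<tau> \<bullet> mag_ref \<tau> = \<tau>\<^sup>2 * ((m $ 1)\<^sup>2 + (m $ 2)\<^sup>2) + (m $ 3)\<^sup>2"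
    by (simp add: inner_3 mag_ref_def power2_eq_square algebra_simps)
  ultimately show ?thesis by (simp add: norm_eq_sqrt_inner inner_3 power2_eq_square)
qed

text \<open>Three scalar relations pin down the difference \<open>d\<close> of the two
  \<open>mag\<close>: the constant \<open>mag \<bullet> eta\<close> controls its vertical part, the
  constant norm its part along the horizontal component of \<open>m\<close>, and \<open>sn\<close>
  its part along \<open>e3 \<times> m\<close>. Each holds up to an error
  \<open>\<epsilon> * norm d\<close>.\<close>

lemma mag_diff_le:
  "\<exists>C>0. \<exists>\<epsilon>>0. \<forall>\<tau> a b. \<tau>\<^sup>2 = 1 \<longrightarrow> near 1 \<epsilon> a \<longrightarrow> near 1 \<epsilon> b \<longrightarrow>
     norm (mag a - mag_ref \<tau>) \<le> \<epsilon> \<longrightarrow> norm (mag b - mag_ref \<tau>) \<le> \<epsilon> \<longrightarrow>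
     norm (mag a - mag b) \<le> C * (norm (eta a - eta b) + \<bar>sn a - sn b\<bar>)"
proof -
  define \<mu> where "\<mu> = norm m"
  have \<mu>0: "\<mu> \<ge> 0" by (simp add: \<mu>_def)
  define P where "P = 1 + \<mu> + \<mu> * \<mu>"
  \<comment> \<open>Twice the coefficient with which \<open>S\<close> bounds \<open>norm d\<close>.
    With \<open>C * \<epsilon> = 1\<close> the error term inside \<open>S\<close> amounts to half of
    \<open>norm d\<close> and is absorbed.\<close>
  define C where "C = 2 * (P + 6 * \<mu> * (P * P) / M)"
  define \<epsilon> where "\<epsilon> = 1 / C"
  have P: "P \<ge> 1" "P \<ge> \<mu>" "P \<ge> \<mu> * \<mu>" "P \<ge> 1 + \<mu>" using \<mu>0 by (auto simp: P_def)
  have C: "C > 0" using P M \<mu>0 by (auto simp: C_def intro!: add_pos_nonneg)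
  have \<epsilon>: "\<epsilon> > 0" "C * \<epsilon> = 1" using C by (auto simp: \<epsilon>_def)
  have "norm (mag a - mag b) \<le> C * (norm (eta a - eta b) + \<bar>sn a - sn b\<bar>)"
    if \<tau>: "\<tau>\<^sup>2 = 1" and a: "near 1 \<epsilon> a" and b: "near 1 \<epsilon> b"
      and na: "norm (mag a - mag_ref \<tau>) \<le> \<epsilon>" and nb: "norm (mag b - mag_ref \<tau>) \<le> \<epsilon>" for \<tau> a b
  proof -
    define d where "d = mag a - mag b"
    define h where "h = eta a - eta b"
    define N where "N = norm d"
    define S where "S = norm h + \<bar>sn a - sn b\<bar> + \<epsilon> * N"
    have ab: "a \<in> state_space" "b \<in> state_space" and ea: "norm (eta a - e3) \<le> \<epsilon>"
      using a b by (auto simp: near_def)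
    have N: "N \<ge> 0" by (simp add: N_def)
    have S: "S \<ge> 0" "norm h \<le> S" "\<epsilon> * N \<le> S" "\<bar>sn a - sn b\<bar> + norm h + \<epsilon> * N \<le> S"
      using N \<epsilon> by (auto simp: S_def intro!: add_nonneg_nonneg)
    have d3: "\<bar>d $ 3\<bar> \<le> P * S"
    proof -
      have "d \<bullet> eta a + mag b \<bullet> h = 0"
        using mag_eta[OF ab(1)] mag_eta[OF ab(2)] by (simp add: d_def h_def inner_diff_left inner_diff_right)
      then have "d $ 3 = - (mag b \<bullet> h) - d \<bullet> (eta a - e3)"
        by (simp add: inner_diff_right inner_e3)
      moreover have "\<bar>mag b \<bullet> h\<bar> \<le> \<mu> * norm h"
        using Cauchy_Schwarz_ineq2[of "mag b" h] norm_mag[OF ab(2)] by (simp add: \<mu>_def)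
      moreover have "\<bar>d \<bullet> (eta a - e3)\<bar> \<le> N * \<epsilon>"
        unfolding N_def using ea by (intro order_trans[OF Cauchy_Schwarz_ineq2] mult_left_mono) auto
      moreover have "\<mu> * norm h \<le> \<mu> * (norm h + \<bar>sn a - sn b\<bar>)" using \<mu>0 by (intro mult_left_mono) auto
      moreover have "\<mu> * (norm h + \<bar>sn a - sn b\<bar>) + \<epsilon> * N \<le> (1 + \<mu>) * S"
        using \<mu>0 N \<epsilon> by (simp add: S_def algebra_simps)
      moreover have "(1 + \<mu>) * S \<le> P * S" using P S by (intro mult_right_mono) auto
      ultimately show ?thesis by (simp add: mult.commute[of N])
    qed
    have dm: "\<bar>d \<bullet> (m - m $ 3 *\<^sub>R e3)\<bar> \<le> 2 * (P * P) * S"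
    proof -
      have "d \<bullet> (mag a + mag b) = mag a \<bullet> mag a - mag b \<bullet> mag b"
        by (simp only: d_def inner_diff_left inner_add_right inner_commute[of "mag b" "mag a"])
      then have "d \<bullet> (mag a + mag b) = 0"
        using mag_mag[OF ab(1)] mag_mag[OF ab(2)] by simp
      then have "2 * (d \<bullet> mag_ref \<tau>) = - (d \<bullet> ((mag a - mag_ref \<tau>) + (mag b - mag_ref \<tau>)))"
        unfolding inner_add_right inner_diff_right by linarith
      moreover have "\<bar>d \<bullet> ((mag a - mag_ref \<tau>) + (mag b - mag_ref \<tau>))\<bar> \<le> N * (\<epsilon> + \<epsilon>)"
        unfolding N_def using na nb
        by (intro order_trans[OF Cauchy_Schwarz_ineq2] mult_left_mono norm_triangle_mono) auto
      ultimately have "\<bar>d \<bullet> mag_ref \<tau>\<bar> \<le> \<epsilon> * N" by (simp add: algebra_simps)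
      moreover have "\<tau> * (d \<bullet> (m - m $ 3 *\<^sub>R e3)) = d \<bullet> mag_ref \<tau> - m $ 3 * d $ 3"
        by (simp add: mag_ref_def inner_add_right inner_e3)
      moreover have "\<bar>m $ 3 * d $ 3\<bar> \<le> \<mu> * (P * S)"
        unfolding abs_mult using d3 component_le_norm_cart[of m 3] by (intro mult_mono) (auto simp: \<mu>_def)
      moreover have "\<bar>\<tau>\<bar> = 1" using \<tau> by (simp add: power2_eq_1_iff) auto
      then have "\<bar>\<tau> * (d \<bullet> (m - m $ 3 *\<^sub>R e3))\<bar> = \<bar>d \<bullet> (m - m $ 3 *\<^sub>R e3)\<bar>" by (simp add: abs_mult)
      moreover have "\<mu> * (P * S) \<le> P * (P * S)" using P S by (intro mult_right_mono) auto
      moreover have "1 * S \<le> (P * P) * S" using P S mult_mono[of 1 P 1 P] by (intro mult_right_mono) auto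
      ultimately show ?thesis using S by (simp add: mult.assoc)
    qed
    have dx: "\<bar>d \<bullet> (e3 \<times> m)\<bar> \<le> P * S"
    proof -
      have "sn a - sn b = (m \<times> d) \<bullet> eta a + (m \<times> mag b) \<bullet> h"
        by (simp add: sn_def d_def h_def Cross3.right_diff_distrib inner_diff_left inner_diff_right)
      moreover have "(m \<times> d) \<bullet> eta a = d \<bullet> (e3 \<times> m) + (m \<times> d) \<bullet> (eta a - e3)"
        by (simp add: inner_diff_right) (simp add: inner_3 cross3_eval)
      moreover have "\<bar>(m \<times> mag b) \<bullet> h\<bar> \<le> \<mu> * \<mu> * norm h"
        using inner_cross_le[of m "mag b" h] norm_mag[OF ab(2)] by (simp add: \<mu>_def)
      moreover have "\<bar>(m \<times> d) \<bullet> (eta a - e3)\<bar> \<le> \<mu> * N * \<epsilon>"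
        unfolding N_def \<mu>_def using ea by (intro order_trans[OF inner_cross_le] mult_left_mono) auto
      ultimately have "\<bar>d \<bullet> (e3 \<times> m)\<bar> \<le> \<bar>sn a - sn b\<bar> + \<mu> * \<mu> * norm h + \<mu> * N * \<epsilon>" by linarith
      also have "\<dots> \<le> P * \<bar>sn a - sn b\<bar> + P * norm h + P * N * \<epsilon>"
        using P N \<epsilon> by (intro add_mono mult_right_mono) (auto simp: mult_le_cancel_right1)
      also have "\<dots> = P * S" by (simp add: S_def algebra_simps)
      finally show ?thesis .
    qed
    have comp: "\<bar>d $ i\<bar> \<le> 3 * \<mu> * (P * P) / M * S"
      if "M * d $ i = \<alpha> * (d \<bullet> (m - m $ 3 *\<^sub>R e3)) + \<beta> * (d \<bullet> (e3 \<times> m))"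
        "\<bar>\<alpha>\<bar> \<le> \<mu>" "\<bar>\<beta>\<bar> \<le> \<mu>" for i \<alpha> \<beta>
    proof -
      have "\<bar>\<alpha> * (d \<bullet> (m - m $ 3 *\<^sub>R e3))\<bar> \<le> \<mu> * (2 * (P * P) * S)"
        unfolding abs_mult using dm that \<mu>0 by (intro mult_mono) auto
      moreover have "\<bar>\<beta> * (d \<bullet> (e3 \<times> m))\<bar> \<le> \<mu> * (P * S)"
        unfolding abs_mult using dx that \<mu>0 by (intro mult_mono) auto
      moreover have "\<mu> * (P * S) \<le> \<mu> * (P * P * S)"
        using P S \<mu>0 by (intro mult_left_mono mult_right_mono) auto
      ultimately have "\<bar>M * d $ i\<bar> \<le> 3 * \<mu> * (P * P) * S"
        unfolding that(1) by (simp add: mult.assoc)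
      then show ?thesis using M by (simp add: abs_mult field_simps)
    qed
    have "\<bar>d $ 1\<bar> \<le> 3 * \<mu> * (P * P) / M * S"
      by (rule comp[of 1 "m $ 1" "- m $ 2"])
        (use component_le_norm_cart[of m] in \<open>auto simp: M_def \<mu>_def inner_3 cross3_eval power2_eq_square algebra_simps\<close>)
    moreover have "\<bar>d $ 2\<bar> \<le> 3 * \<mu> * (P * P) / M * S"
      by (rule comp[of 2 "m $ 2" "m $ 1"])
        (use component_le_norm_cart[of m] in \<open>auto simp: M_def \<mu>_def inner_3 cross3_eval power2_eq_square algebra_simps\<close>)
    moreover have "N \<le> \<bar>d $ 1\<bar> + \<bar>d $ 2\<bar> + \<bar>d $ 3\<bar>"
      using norm_le_l1_cart[of d] by (simp add: N_def sum_3)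
    ultimately have "N \<le> P * S + 2 * (3 * \<mu> * (P * P) / M * S)"
      using d3 by linarith
    also have "\<dots> = C / 2 * S" by (simp add: C_def algebra_simps)
    also have "\<dots> = C / 2 * (norm h + \<bar>sn a - sn b\<bar>) + (C * \<epsilon>) * N / 2"
      by (simp add: S_def algebra_simps)
    finally have "N \<le> C * (norm h + \<bar>sn a - sn b\<bar>)" using \<epsilon>(2) by simp
    then show ?thesis by (simp add: N_def d_def h_def)
  qed
  then show ?thesis using C \<epsilon> by (intro exI[of _ C] exI[of _ \<epsilon>]) auto
qed

text \<open>Linearisation of the heading equation at heading sign \<open>\<tau>\<close>. The
  differences of \<open>hor\<close> and \<open>eta\<close> come without a factor
  \<open>\<epsilon>\<close>, since the pendulum drives the heading at first order; only the
  heading's own error terms are small.\<close>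

lemma sn_field_diff:
  assumes \<tau>: "\<tau>\<^sup>2 = 1" and a: "near 1 \<epsilon> a" and b: "near 1 \<epsilon> b" and \<epsilon>: "\<epsilon> \<le> 1"
    and na: "norm (mag a - mag_ref \<tau>) \<le> \<epsilon>" and nb: "norm (mag b - mag_ref \<tau>) \<le> \<epsilon>"
  shows "\<bar>sn_field a - sn_field b + k2r * \<tau> * M * (sn a - sn b)\<bar> \<le> (k2r + 2 * k1r) * (1 + norm m + norm m * norm m)\<^sup>2 *
    (\<epsilon> * \<bar>sn a - sn b\<bar> + norm (hor a - hor b) + norm (eta a - eta b) + \<epsilon> * norm (mag a - mag b))"
proof -
  define \<mu> where "\<mu> = norm m"
  define P where "P = 1 + \<mu> + \<mu> * \<mu>"
  define s where "s = \<bar>sn a - sn b\<bar>"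
  define p where "p = norm (hor a - hor b)"
  define h where "h = norm (eta a - eta b)"
  define d where "d = norm (mag a - mag b)"
  have nonneg: "\<mu> \<ge> 0" "s \<ge> 0" "p \<ge> 0" "h \<ge> 0" "d \<ge> 0" "\<epsilon> \<ge> 0"
    using near_nonneg[OF a] by (auto simp: \<mu>_def s_def p_def h_def d_def)
  have P: "P \<ge> 1" "\<mu> \<le> P" "\<mu> * \<mu> \<le> P" "\<mu> + \<mu> * \<mu> \<le> P" using nonneg by (auto simp: P_def)
  have PP: "P \<le> P * P" using P by simp
  have ab: "a \<in> state_space" "b \<in> state_space" and ea: "norm (eta a - e3) \<le> \<epsilon>" and eb: "norm (eta b - e3) \<le> \<epsilon>"
    and pa: "norm (hor a) \<le> \<epsilon>" and pb: "norm (hor b) \<le> \<epsilon>"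
    using a b by (auto simp: near_def)
  have snb: "\<bar>sn b\<bar> \<le> P * \<epsilon>"
  proof -
    have "(m \<times> mag_ref \<tau>) \<bullet> e3 = 0" by (simp add: inner_e3 cross3_eval mag_ref_def)
    then have "\<bar>sn b\<bar> \<le> \<mu> * (norm (mag b - mag_ref \<tau>) * norm (eta b) + norm (mag_ref \<tau>) * norm (eta b - e3))"
      using inner_cross_diff_le[of m "mag b" "eta b" "mag_ref \<tau>" e3] by (simp add: sn_def \<mu>_def)
    also have "\<dots> \<le> \<mu> * (\<epsilon> * 1 + \<mu> * \<epsilon>)"
      using nb eb nonneg norm_eta[OF ab(2)] norm_mag_ref[OF \<tau>]
      by (intro mult_left_mono add_mono) (auto simp: \<mu>_def intro!: mult_left_mono)
    also have "\<dots> = (\<mu> + \<mu> * \<mu>) * \<epsilon>" by (simp add: algebra_simps)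
    also have "\<dots> \<le> P * \<epsilon>" using P nonneg by (intro mult_right_mono) auto
    finally show ?thesis .
  qed
  have m3: "\<bar>m $ 3\<bar> \<le> \<mu>" using component_le_norm_cart[of m 3] by (simp add: \<mu>_def)
  have cna: "\<bar>cn a - \<tau> * M\<bar> \<le> P * \<epsilon>"
  proof -
    have "m \<bullet> mag_ref \<tau> - m $ 3 * m $ 3 = \<tau> * M"
      by (simp add: inner_3 mag_ref_def M_def power2_eq_square algebra_simps)
    then have eq: "cn a - \<tau> * M = m \<bullet> (mag a - mag_ref \<tau>) - m $ 3 * (m \<bullet> (eta a - e3))"
      unfolding cn_def inner_diff_right inner_e3 right_diff_distrib by linarith
    have "\<bar>m \<bullet> (mag a - mag_ref \<tau>)\<bar> \<le> \<mu> * \<epsilon>"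
      unfolding \<mu>_def using na by (intro order_trans[OF Cauchy_Schwarz_ineq2] mult_left_mono) auto
    moreover have "\<bar>m \<bullet> (eta a - e3)\<bar> \<le> \<mu> * \<epsilon>"
      unfolding \<mu>_def using ea by (intro order_trans[OF Cauchy_Schwarz_ineq2] mult_left_mono) auto
    then have "\<bar>m $ 3 * (m \<bullet> (eta a - e3))\<bar> \<le> \<mu> * (\<mu> * \<epsilon>)"
      unfolding abs_mult using m3 nonneg by (intro mult_mono) auto
    ultimately have "\<bar>cn a - \<tau> * M\<bar> \<le> (\<mu> + \<mu> * \<mu>) * \<epsilon>" unfolding eq by (simp add: algebra_simps)
    also have "\<dots> \<le> P * \<epsilon>" using P nonneg by (intro mult_right_mono) auto
    finally show ?thesis .
  qed
  have dcn: "\<bar>cn a - cn b\<bar> \<le> P * (d + h)"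
  proof -
    have eq: "cn a - cn b = m \<bullet> (mag a - mag b) - m $ 3 * (m \<bullet> (eta a - eta b))"
      unfolding cn_def inner_diff_right right_diff_distrib by linarith
    have "\<bar>m \<bullet> (mag a - mag b)\<bar> \<le> \<mu> * d"
      unfolding \<mu>_def d_def by (rule Cauchy_Schwarz_ineq2)
    moreover have "\<bar>m $ 3 * (m \<bullet> (eta a - eta b))\<bar> \<le> \<mu> * (\<mu> * h)"
      unfolding abs_mult h_def using m3 Cauchy_Schwarz_ineq2[of m "eta a - eta b"] nonneg
      by (intro mult_mono) (auto simp: \<mu>_def)
    ultimately have "\<bar>cn a - cn b\<bar> \<le> \<mu> * d + (\<mu> * \<mu>) * h" unfolding eq by (simp add: mult.assoc)
    also have "\<dots> \<le> P * d + P * h" using P nonneg by (intro add_mono mult_right_mono) auto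
    finally show ?thesis by (simp add: algebra_simps)
  qed
  have T1: "\<bar>m $ 3 * ((m \<times> hor a) \<bullet> eta a - (m \<times> hor b) \<bullet> eta b)\<bar> \<le> P * (p + h)"
  proof -
    have "\<bar>(m \<times> hor a) \<bullet> eta a - (m \<times> hor b) \<bullet> eta b\<bar> \<le> \<mu> * (p * 1 + 1 * h)"
      using inner_cross_diff_le[of m "hor a" "eta a" "hor b" "eta b"] norm_eta[OF ab(1)] pb \<epsilon> nonneg
        mult_left_mono[of "norm (hor b) * h" "1 * h" \<mu>] mult_right_mono[of "norm (hor b)" 1 h]
      by (simp add: \<mu>_def p_def h_def distrib_left)
    then have "\<bar>m $ 3 * ((m \<times> hor a) \<bullet> eta a - (m \<times> hor b) \<bullet> eta b)\<bar> \<le> \<mu> * (\<mu> * (p * 1 + 1 * h))"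
      unfolding abs_mult using m3 nonneg by (intro mult_mono) auto
    also have "\<dots> = (\<mu> * \<mu>) * (p + h)" by simp
    also have "\<dots> \<le> P * (p + h)" using P nonneg by (intro mult_right_mono) auto
    finally show ?thesis .
  qed
  have T2: "\<bar>(m \<times> mag a) \<bullet> hor a - (m \<times> mag b) \<bullet> hor b\<bar> \<le> P * (\<epsilon> * d + p)"
  proof -
    have "\<bar>(m \<times> mag a) \<bullet> hor a - (m \<times> mag b) \<bullet> hor b\<bar> \<le> \<mu> * (d * norm (hor a) + \<mu> * p)"
      using inner_cross_diff_le[of m "mag a" "hor a" "mag b" "hor b"] norm_mag[OF ab(2)]
      by (simp add: \<mu>_def p_def d_def)
    also have "\<dots> \<le> \<mu> * (d * \<epsilon> + \<mu> * p)"
      using nonneg pa by (intro mult_left_mono add_right_mono) auto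
    also have "\<dots> = \<mu> * (\<epsilon> * d) + (\<mu> * \<mu>) * p" by (simp add: algebra_simps)
    also have "\<dots> \<le> P * (\<epsilon> * d) + P * p" using P nonneg by (intro add_mono mult_right_mono) auto
    finally show ?thesis by (simp add: algebra_simps)
  qed
  have Q: "\<bar>(cn a - \<tau> * M) * (sn a - sn b) + sn b * (cn a - cn b)\<bar> \<le> P * P * (\<epsilon> * s + \<epsilon> * d + h)"
  proof -
    have "\<bar>(cn a - \<tau> * M) * (sn a - sn b)\<bar> \<le> (P * \<epsilon>) * s"
      unfolding abs_mult s_def using cna by (intro mult_right_mono) auto
    also have "\<dots> \<le> P * P * (\<epsilon> * s)" using PP nonneg mult_right_mono[OF PP, of "\<epsilon> * s"] by (simp add: mult.assoc)
    finally have 1: "\<bar>(cn a - \<tau> * M) * (sn a - sn b)\<bar> \<le> P * P * (\<epsilon> * s)" .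
    have "\<bar>sn b * (cn a - cn b)\<bar> \<le> (P * \<epsilon>) * (P * (d + h))"
      unfolding abs_mult using snb dcn nonneg P by (intro mult_mono) auto
    also have "\<dots> = P * P * (\<epsilon> * d + \<epsilon> * h)" by (simp add: algebra_simps)
    also have "\<dots> \<le> P * P * (\<epsilon> * d + 1 * h)"
      using P nonneg \<epsilon> by (intro mult_left_mono add_left_mono mult_right_mono) auto
    finally have 2: "\<bar>sn b * (cn a - cn b)\<bar> \<le> P * P * (\<epsilon> * d + h)" by simp
    show ?thesis using order_trans[OF abs_triangle_ineq add_mono[OF 1 2]] by (simp add: algebra_simps)
  qed
  have eq: "sn_field a - sn_field b + k2r * \<tau> * M * (sn a - sn b)
    = - (k2r * ((cn a - \<tau> * M) * (sn a - sn b) + sn b * (cn a - cn b)))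
      + k1r * (m $ 3 * ((m \<times> hor a) \<bullet> eta a - (m \<times> hor b) \<bullet> eta b) + ((m \<times> mag a) \<bullet> hor a - (m \<times> mag b) \<bullet> hor b))"
    by (simp add: sn_field_def algebra_simps)
  have TT: "\<bar>m $ 3 * ((m \<times> hor a) \<bullet> eta a - (m \<times> hor b) \<bullet> eta b) + ((m \<times> mag a) \<bullet> hor a - (m \<times> mag b) \<bullet> hor b)\<bar>
     \<le> P * (p + h) + P * (\<epsilon> * d + p)"
    by (rule order_trans[OF abs_triangle_ineq add_mono[OF T1 T2]])
  have "\<bar>sn_field a - sn_field b + k2r * \<tau> * M * (sn a - sn b)\<bar>
    \<le> k2r * (P * P * (\<epsilon> * s + \<epsilon> * d + h)) + k1r * (P * (p + h) + P * (\<epsilon> * d + p))"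
    unfolding eq
    by (rule order_trans[OF abs_triangle_ineq], rule add_mono)
       (use Q TT k1r k2r in \<open>simp_all only: abs_minus_cancel abs_mult abs_of_pos mult_le_cancel_left_pos\<close>)
  also have "\<dots> \<le> k2r * (P * P * (\<epsilon> * s + p + h + \<epsilon> * d)) + k1r * (2 * (P * P * (\<epsilon> * s + p + h + \<epsilon> * d)))"
  proof -
    have A: "P * P * (\<epsilon> * s + \<epsilon> * d + h) \<le> P * P * (\<epsilon> * s + p + h + \<epsilon> * d)"
      using nonneg P by (intro mult_left_mono) auto
    have "P * (p + h) + P * (\<epsilon> * d + p) = P * (2 * p + h + \<epsilon> * d)" by (simp add: algebra_simps)
    also have "\<dots> \<le> P * P * (2 * p + h + \<epsilon> * d)" using PP nonneg by (intro mult_right_mono) auto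
    also have "\<dots> \<le> P * P * (2 * (\<epsilon> * s + p + h + \<epsilon> * d))"
      using P nonneg by (intro mult_left_mono) (auto simp: algebra_simps)
    also have "\<dots> = 2 * (P * P * (\<epsilon> * s + p + h + \<epsilon> * d))" by simp
    finally have B: "P * (p + h) + P * (\<epsilon> * d + p) \<le> 2 * (P * P * (\<epsilon> * s + p + h + \<epsilon> * d))" .
    show ?thesis using add_mono[OF mult_left_mono[OF A] mult_left_mono[OF B]] k1r k2r by simp
  qed
  also have "\<dots> = (k2r + 2 * k1r) * P\<^sup>2 * (\<epsilon> * s + p + h + \<epsilon> * d)"
    by (simp add: power2_eq_square algebra_simps)
  finally show ?thesis unfolding P_def \<mu>_def s_def p_def h_def d_def .
qed

text \<open>Eliminating the difference of \<open>mag\<close> leaves \<open>sn\<close> as the only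
  heading variable. The result is a cascade: the pendulum acts on \<open>sn\<close>, and the error
  caused by \<open>sn\<close> itself is small.\<close>

lemma heading_diff:
  "\<exists>C>0. \<exists>\<epsilon>0>0. \<forall>\<epsilon>\<le>\<epsilon>0. \<forall>\<tau> a b. \<tau>\<^sup>2 = 1 \<longrightarrow> near 1 \<epsilon> a \<longrightarrow> near 1 \<epsilon> b \<longrightarrow>
     norm (mag a - mag_ref \<tau>) \<le> \<epsilon> \<longrightarrow> norm (mag b - mag_ref \<tau>) \<le> \<epsilon> \<longrightarrow>
     norm (mag a - mag b) \<le> C * (norm (eta a - eta b) + \<bar>sn a - sn b\<bar>) \<and>
     \<bar>sn_field a - sn_field b + k2r * \<tau> * M * (sn a - sn b)\<bar>
       \<le> C * (\<epsilon> * \<bar>sn a - sn b\<bar> + norm (hor a - hor b) + norm (eta a - eta b))"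
proof -
  obtain C1 \<epsilon>1 where C1: "C1 > 0" "\<epsilon>1 > 0" and *: "\<forall>\<tau> a b. \<tau>\<^sup>2 = 1 \<longrightarrow> near 1 \<epsilon>1 a \<longrightarrow> near 1 \<epsilon>1 b \<longrightarrow>
     norm (mag a - mag_ref \<tau>) \<le> \<epsilon>1 \<longrightarrow> norm (mag b - mag_ref \<tau>) \<le> \<epsilon>1 \<longrightarrow>
     norm (mag a - mag b) \<le> C1 * (norm (eta a - eta b) + \<bar>sn a - sn b\<bar>)"
    using mag_diff_le by blast
  define Q where "Q = (k2r + 2 * k1r) * (1 + norm m + norm m * norm m)\<^sup>2"
  have "1 + norm m + norm m * norm m > 0" by (intro add_pos_nonneg) auto
  then have "(1 + norm m + norm m * norm m)\<^sup>2 > 0" by (rule zero_less_power)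
  then have Q: "Q > 0" unfolding Q_def by (rule mult_pos_pos[rotated]) (use k1r k2r in simp)
  define C where "C = C1 + Q * (1 + C1)"
  have C: "C > 0" using C1 Q by (simp add: C_def add_pos_pos)
  have QC: "Q * C1 \<ge> 0" "Q + Q * C1 \<le> C" using C1 Q by (simp_all add: C_def algebra_simps)
  show ?thesis
  proof (rule exI[of _ C], rule conjI[OF C], rule exI[of _ "min \<epsilon>1 1"], intro conjI allI impI)
    fix \<epsilon> \<tau> a b
    assume e: "\<epsilon> \<le> min \<epsilon>1 1" and \<tau>: "\<tau>\<^sup>2 = 1" and a: "near 1 \<epsilon> a" and b: "near 1 \<epsilon> b"
      and na: "norm (mag a - mag_ref \<tau>) \<le> \<epsilon>" and nb: "norm (mag b - mag_ref \<tau>) \<le> \<epsilon>"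
    define s where "s = \<bar>sn a - sn b\<bar>"
    define p where "p = norm (hor a - hor b)"
    define h where "h = norm (eta a - eta b)"
    define d where "d = norm (mag a - mag b)"
    have nn: "s \<ge> 0" "p \<ge> 0" "h \<ge> 0" "\<epsilon> \<ge> 0" using near_nonneg[OF a] by (auto simp: s_def p_def h_def)
    have d: "d \<le> C1 * (h + s)"
      using *[THEN spec, of \<tau>, THEN spec, of a, THEN spec, of b] e \<tau> a b na nb
      by (simp add: d_def h_def s_def near_def)
    also have "\<dots> \<le> C * (h + s)" using nn Q C1 by (intro mult_right_mono) (auto simp: C_def)
    finally show "norm (mag a - mag b) \<le> C * (norm (eta a - eta b) + \<bar>sn a - sn b\<bar>)"
      by (simp add: d_def h_def s_def)
    have "\<bar>sn_field a - sn_field b + k2r * \<tau> * M * (sn a - sn b)\<bar> \<le> Q * (\<epsilon> * s + p + h + \<epsilon> * d)"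
      using sn_field_diff[OF \<tau> a b _ na nb] e by (simp add: Q_def s_def p_def h_def d_def)
    also have "\<dots> \<le> Q * (\<epsilon> * s + p + h + (C1 * h + C1 * (\<epsilon> * s)))"
    proof (intro mult_left_mono add_left_mono)
      have "\<epsilon> * d \<le> \<epsilon> * (C1 * (h + s))" using d nn by (intro mult_left_mono) auto
      also have "\<dots> = \<epsilon> * (C1 * h) + C1 * (\<epsilon> * s)" by (simp add: algebra_simps)
      also have "\<dots> \<le> 1 * (C1 * h) + C1 * (\<epsilon> * s)" using e C1 nn by (intro add_right_mono mult_right_mono) auto
      finally show "\<epsilon> * d \<le> C1 * h + C1 * (\<epsilon> * s)" by simp
    qed (use Q in simp)
    also have "\<dots> = (Q + Q * C1) * (\<epsilon> * s) + Q * p + (Q + Q * C1) * h" by (simp add: algebra_simps)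
    also have "\<dots> \<le> C * (\<epsilon> * s) + C * p + C * h"
      using QC nn by (intro add_mono mult_right_mono) auto
    finally show "\<bar>sn_field a - sn_field b + k2r * \<tau> * M * (sn a - sn b)\<bar>
       \<le> C * (\<epsilon> * \<bar>sn a - sn b\<bar> + norm (hor a - hor b) + norm (eta a - eta b))"
      by (simp add: s_def p_def h_def algebra_simps)
  qed (use C1 in auto)
qed

text \<open>Weight of the cross term in \<open>lyap\<close>. The first bound keeps its indefinite
  contribution below the damping of \<open>hor\<close>, the second keeps the form positive
  definite.\<close>

definition "e0 = min (k1r * K / (2 * k1r + K\<^sup>2 / g)) (sqrt (g * k1r) / 2)"

lemma e0: "e0 > 0" "e0 * (2 * k1r + K\<^sup>2 / g) \<le> k1r * K" "e0\<^sup>2 \<le> g * k1r / 4"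
proof -
  have pos: "2 * k1r + K\<^sup>2 / g > 0" using k1r K g by (simp add: add_pos_pos)
  show "e0 > 0" using pos k1r K g by (simp add: e0_def)
  have "e0 * (2 * k1r + K\<^sup>2 / g) \<le> k1r * K / (2 * k1r + K\<^sup>2 / g) * (2 * k1r + K\<^sup>2 / g)"
    using pos by (intro mult_right_mono) (auto simp: e0_def)
  then show "e0 * (2 * k1r + K\<^sup>2 / g) \<le> k1r * K" using pos by simp
  have "e0\<^sup>2 \<le> (sqrt (g * k1r) / 2)\<^sup>2"
    using \<open>e0 > 0\<close> min.cobounded2[of "k1r * K / (2 * k1r + K\<^sup>2 / g)" "sqrt (g * k1r) / 2"]
    by (intro power_mono) (simp_all only: e0_def[symmetric] less_imp_le)
  then show "e0\<^sup>2 \<le> g * k1r / 4" using g k1r by (simp add: power_divide)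
qed

text \<open>The cross term makes \<open>lyap\<close> a strict Lyapunov function of the linearised pendulum.\<close>

definition lyap :: "state \<Rightarrow> state \<Rightarrow> real" where
  "lyap a b = g * (norm (eta a - eta b))\<^sup>2 + k1r * (norm (hor a - hor b))\<^sup>2
     + 2 * e0 * ((hor a - hor b) \<bullet> (eta a - eta b))"

definition lyap_rate :: "state \<Rightarrow> state \<Rightarrow> real" where
  "lyap_rate a b = 2 * g * k1r * ((eta a - eta b) \<bullet> (hor a - hor b))
     + 2 * k1r * ((hor a - hor b) \<bullet> (hor_field a - hor_field b))
     + 2 * e0 * ((hor_field a - hor_field b) \<bullet> (eta a - eta b) + k1r * (norm (hor a - hor b))\<^sup>2)"

definition sqdist :: "state \<Rightarrow> state \<Rightarrow> real" where
  "sqdist a b = (norm (eta a - eta b))\<^sup>2 + (norm (hor a - hor b))\<^sup>2"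

lemma sqdist_nonneg: "sqdist a b \<ge> 0" by (simp add: sqdist_def)

lemma sum_sqdist: "(norm (hor a - hor b) + norm (eta a - eta b))\<^sup>2 \<le> 2 * sqdist a b"
  using zero_le_power2[of "norm (hor a - hor b) - norm (eta a - eta b)"]
  by (simp add: sqdist_def power2_sum power2_diff)

lemma lyap_bounds:
  "min (g / 2) (k1r / 2) * sqdist a b \<le> lyap a b" "lyap a b \<le> (g + k1r + e0) * sqdist a b"
proof -
  define x where "x = norm (eta a - eta b)"
  define y where "y = norm (hor a - hor b)"
  define z where "z = (hor a - hor b) \<bullet> (eta a - eta b)"
  have z: "\<bar>z\<bar> \<le> y * x" unfolding x_def y_def z_def by (rule Cauchy_Schwarz_ineq2)
  \<comment> \<open>Young's inequality: the cross term takes at most half of the diagonal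
    terms.\<close>
  have "0 \<le> (g * x - 2 * e0 * y)\<^sup>2" by simp
  then have "4 * g * (e0 * (y * x)) \<le> g * g * x\<^sup>2 + 4 * e0\<^sup>2 * y\<^sup>2"
    by (simp add: power2_eq_square algebra_simps)
  also have "4 * e0\<^sup>2 * y\<^sup>2 \<le> g * k1r * y\<^sup>2"
    using e0(3) by (intro mult_right_mono) auto
  finally have "g * (4 * (e0 * (y * x))) \<le> g * (g * x\<^sup>2 + k1r * y\<^sup>2)" by (simp add: algebra_simps)
  then have 1: "4 * (e0 * (y * x)) \<le> g * x\<^sup>2 + k1r * y\<^sup>2" using g by simp
  have 2: "\<bar>e0 * z\<bar> \<le> e0 * (y * x)" using z e0(1) by (simp add: abs_mult)
  have "min (g / 2) (k1r / 2) * sqdist a b \<le> g / 2 * x\<^sup>2 + k1r / 2 * y\<^sup>2"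
    unfolding sqdist_def x_def y_def distrib_left by (intro add_mono mult_right_mono) auto
  also have "\<dots> \<le> lyap a b" using 1 2 unfolding lyap_def x_def[symmetric] y_def[symmetric] z_def[symmetric] by linarith
  finally show "min (g / 2) (k1r / 2) * sqdist a b \<le> lyap a b" .
  have "2 * (y * x) \<le> x\<^sup>2 + y\<^sup>2" using zero_le_power2[of "x - y"] by (simp add: power2_diff mult.commute[of y])
  then have "e0 * (2 * (y * x)) \<le> e0 * (x\<^sup>2 + y\<^sup>2)" using e0(1) by (intro mult_left_mono) auto
  then have "lyap a b \<le> g * x\<^sup>2 + k1r * y\<^sup>2 + e0 * (x\<^sup>2 + y\<^sup>2)"
    using 2 unfolding lyap_def x_def[symmetric] y_def[symmetric] z_def[symmetric] by linarith
  also have "\<dots> \<le> g * x\<^sup>2 + k1r * y\<^sup>2 + e0 * (x\<^sup>2 + y\<^sup>2) + (g * y\<^sup>2 + k1r * x\<^sup>2)" using g k1r by simp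
  also have "\<dots> = (g + k1r + e0) * sqdist a b" by (simp add: sqdist_def x_def y_def algebra_simps)
  finally show "lyap a b \<le> (g + k1r + e0) * sqdist a b" .
qed

text \<open>The gravity terms of the two squares cancel, leaving damping in \<open>hor\<close> only;
  differentiating the cross term supplies the missing \<open>- 2 * e0 * g\<close> times the squared
  difference of \<open>eta\<close>. Close to the pole the nonlinear remainder costs a fraction of
  this.\<close>

lemma lyap_rate_le:
  "\<exists>c>0. \<exists>\<epsilon>0>0. \<forall>a b. near 1 \<epsilon>0 a \<longrightarrow> near 1 \<epsilon>0 b \<longrightarrow> lyap_rate a b \<le> - c * sqdist a b"
proof -
  \<comment> \<open>After the mixed term is absorbed, the dissipation is at least
    \<open>2 * c * sqdist\<close>; half of it pays for the nonlinear remainder.\<close>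
  define c where "c = min (k1r * K) (e0 * g) / 2"
  have c: "c > 0" using k1r K e0 g by (simp add: c_def)
  define \<epsilon>0 where "\<epsilon>0 = min 1 (c / (8 * (k1r + e0) * (g + k1r)))"
  have den: "8 * (k1r + e0) * (g + k1r) > 0" using k1r g e0 by (simp add: add_pos_pos)
  have e: "\<epsilon>0 > 0" "\<epsilon>0 \<le> 1" using c den by (simp_all add: \<epsilon>0_def)
  have e2: "8 * (k1r + e0) * (g + k1r) * \<epsilon>0 \<le> c"
  proof -
    have *: "D * min 1 (c / D) \<le> c" if "D > 0" for D
      using mult_left_mono[OF min.cobounded2[of 1 "c / D"], of D] that by simp
    show ?thesis unfolding \<epsilon>0_def by (rule *[OF den])
  qed
  have "lyap_rate a b \<le> - c * sqdist a b" if a: "near 1 \<epsilon>0 a" and b: "near 1 \<epsilon>0 b" for a b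
  proof -
    define h where "h = eta a - eta b"
    define p where "p = hor a - hor b"
    define x where "x = norm h"
    define y where "y = norm p"
    define r where "r = hor_field a - hor_field b + (g * 1) *\<^sub>R h + K *\<^sub>R p"
    have r: "norm r \<le> 2 * (g + k1r) * \<epsilon>0 * (x + y)"
      unfolding r_def x_def y_def h_def p_def by (rule hor_field_diff[OF a b _ e(2)]) simp
    have F: "hor_field a - hor_field b = r - g *\<^sub>R h - K *\<^sub>R p" by (simp add: r_def)
    have "lyap_rate a b = - 2 * k1r * K * y\<^sup>2 - 2 * e0 * g * x\<^sup>2 + 2 * e0 * k1r * y\<^sup>2 - 2 * (e0 * K * (p \<bullet> h))
        + 2 * (k1r * (p \<bullet> r)) + 2 * (e0 * (h \<bullet> r))"
      unfolding lyap_rate_def h_def[symmetric] p_def[symmetric] F x_def y_def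
      by (simp add: inner_diff_right inner_diff_left power2_norm_eq_inner inner_commute[of h p] inner_commute[of r h] algebra_simps)
    moreover have "\<bar>e0 * K * (p \<bullet> h)\<bar> \<le> e0 * K * (y * x)"
      using Cauchy_Schwarz_ineq2[of p h] e0(1) K by (simp add: abs_mult x_def y_def)
    \<comment> \<open>Young's inequality with weights matched to the dissipation
      \<open>e0 * g\<close> in \<open>x\<close>; the part in \<open>y\<close> is what the first
      bound on \<open>e0\<close> anticipates.\<close>
    moreover have "2 * (e0 * K * (y * x)) \<le> e0 * g * x\<^sup>2 + e0 * (K\<^sup>2 / g) * y\<^sup>2"
    proof -
      have "0 \<le> e0 / g * (g * x - K * y)\<^sup>2" using e0(1) g by simp
      also have "\<dots> = e0 * g * x\<^sup>2 - 2 * (e0 * K * (y * x)) + e0 * (K\<^sup>2 / g) * y\<^sup>2"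
        using g by (simp add: power2_diff power_mult_distrib field_simps power2_eq_square)
      finally show ?thesis by simp
    qed
    moreover have "k1r * (p \<bullet> r) + e0 * (h \<bullet> r) \<le> c / 2 * (x\<^sup>2 + y\<^sup>2)"
    proof -
      have "p \<bullet> r \<le> (x + y) * norm r"
        using norm_cauchy_schwarz[of p r] by (rule order_trans) (auto simp: x_def y_def intro!: mult_right_mono)
      moreover have "h \<bullet> r \<le> (x + y) * norm r"
        using norm_cauchy_schwarz[of h r] by (rule order_trans) (auto simp: x_def y_def intro!: mult_right_mono)
      ultimately have "k1r * (p \<bullet> r) + e0 * (h \<bullet> r) \<le> k1r * ((x + y) * norm r) + e0 * ((x + y) * norm r)"
        using k1r e0(1) by (intro add_mono mult_left_mono) auto
      also have "\<dots> = (k1r + e0) * (x + y) * norm r" by (simp add: algebra_simps)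
      also have "\<dots> \<le> (k1r + e0) * (x + y) * (2 * (g + k1r) * \<epsilon>0 * (x + y))"
        using k1r e0(1) r by (intro mult_left_mono) (auto simp: x_def y_def)
      also have "\<dots> = (8 * (k1r + e0) * (g + k1r) * \<epsilon>0) * ((x + y)\<^sup>2 / 4)"
        by (simp add: power2_eq_square field_simps)
      also have "\<dots> \<le> c * ((x + y)\<^sup>2 / 4)" using e2 by (intro mult_right_mono) auto
      also have "\<dots> \<le> c * ((x\<^sup>2 + y\<^sup>2) / 2)"
        using c zero_le_power2[of "x - y"] by (intro mult_left_mono) (auto simp: power2_sum power2_diff)
      finally show ?thesis by simp
    qed
    moreover have "e0 * (2 * k1r + K\<^sup>2 / g) * y\<^sup>2 \<le> k1r * K * y\<^sup>2"
      using e0(2) by (intro mult_right_mono) auto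
    moreover have "e0 * (2 * k1r + K\<^sup>2 / g) * y\<^sup>2 = 2 * e0 * k1r * y\<^sup>2 + e0 * (K\<^sup>2 / g) * y\<^sup>2"
      by (simp add: algebra_simps)
    moreover have "2 * c * x\<^sup>2 \<le> e0 * g * x\<^sup>2" "2 * c * y\<^sup>2 \<le> k1r * K * y\<^sup>2"
      by (auto simp: c_def intro!: mult_right_mono)
    ultimately have "lyap_rate a b \<le> - c * (x\<^sup>2 + y\<^sup>2)" by (simp add: algebra_simps)
    then show ?thesis by (simp add: sqdist_def x_def y_def h_def p_def)
  qed
  then show ?thesis using c e by blast
qed

text \<open>Young's inequality for the error of the heading equation. Half of the leading term
  \<open>2 * \<rho> * s\<^sup>2\<close> of the derivative of the squared heading difference
  survives, and the pendulum enters through \<open>X\<close> only.\<close>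

lemma heading_product_bound:
  fixes s F X C \<epsilon> \<rho> :: real
  assumes "\<bar>F\<bar> \<le> C * (\<epsilon> * \<bar>s\<bar> + X)" "C * \<epsilon> \<le> \<rho> / 4" "\<rho> > 0"
  shows "2 * \<bar>s * F\<bar> \<le> \<rho> * s\<^sup>2 + 2 * C\<^sup>2 / \<rho> * X\<^sup>2"
proof -
  have "\<bar>s * F\<bar> \<le> \<bar>s\<bar> * (C * (\<epsilon> * \<bar>s\<bar> + X))"
    unfolding abs_mult using assms(1) by (intro mult_left_mono) auto
  also have "\<dots> = (C * \<epsilon>) * s\<^sup>2 + \<bar>s\<bar> * (C * X)" by (simp add: power2_eq_square algebra_simps)
  finally have 1: "\<bar>s * F\<bar> \<le> (C * \<epsilon>) * s\<^sup>2 + \<bar>s\<bar> * (C * X)" .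
  have 2: "(C * \<epsilon>) * s\<^sup>2 \<le> \<rho> / 4 * s\<^sup>2" using assms(2) by (intro mult_right_mono) auto
  have "0 \<le> (\<rho> / 2 * \<bar>s\<bar> - C * X)\<^sup>2" by simp
  then have "\<rho> * (\<bar>s\<bar> * (C * X)) \<le> \<rho>\<^sup>2 / 4 * s\<^sup>2 + C\<^sup>2 * X\<^sup>2"
    by (simp add: power2_diff power_mult_distrib power_divide algebra_simps)
  then have "\<bar>s\<bar> * (C * X) \<le> (\<rho>\<^sup>2 / 4 * s\<^sup>2 + C\<^sup>2 * X\<^sup>2) / \<rho>" using assms(3) by (simp add: field_simps)
  also have "\<dots> = \<rho> / 4 * s\<^sup>2 + C\<^sup>2 / \<rho> * X\<^sup>2" using assms(3) by (simp add: power2_eq_square field_simps)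
  finally show ?thesis using 1 2 by simp
qed

lemma near_mono: "near \<sigma> \<epsilon> x \<Longrightarrow> \<epsilon> \<le> \<epsilon>' \<Longrightarrow> near \<sigma> \<epsilon>' x"
  by (auto simp: near_def)

lemma lyap_nonneg: "lyap a b \<ge> 0"
proof -
  have "0 \<le> min (g / 2) (k1r / 2) * sqdist a b" using g k1r sqdist_nonneg by simp
  then show ?thesis using lyap_bounds(1) by (rule order_trans)
qed

text \<open>One quadratic form for each heading sign, with \<open>A\<close> large enough that the
  pendulum's dissipation pays for its influence downstream. At the reversed heading the form
  \<open>sn\<^sup>2 - A * lyap\<close> of differences grows, which is the cone condition; at the
  correct heading \<open>A * lyap + vert\<^sup>2 + sn\<^sup>2\<close> decays.\<close>

lemma heading_rates:
  "\<exists>C>0. \<exists>A>0. \<exists>\<kappa>>0. \<exists>\<epsilon>>0. \<forall>\<tau> a b. \<tau>\<^sup>2 = 1 \<longrightarrow> near 1 \<epsilon> a \<longrightarrow> near 1 \<epsilon> b \<longrightarrow>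
     norm (mag a - mag_ref \<tau>) \<le> \<epsilon> \<longrightarrow> norm (mag b - mag_ref \<tau>) \<le> \<epsilon> \<longrightarrow>
     norm (mag a - mag b) \<le> C * (norm (eta a - eta b) + \<bar>sn a - sn b\<bar>) \<and>
     (\<tau> = - 1 \<longrightarrow> 2 * (sn a - sn b) * (sn_field a - sn_field b) - A * lyap_rate a b
         \<ge> \<kappa> * ((sn a - sn b)\<^sup>2 - A * lyap a b)) \<and>
     (\<tau> = 1 \<longrightarrow> A * lyap_rate a b + 2 * (vert a - vert b) * (g * (eta a - eta b) $ 3 - k1v * (vert a - vert b))
         + 2 * (sn a - sn b) * (sn_field a - sn_field b)
         \<le> - \<kappa> * (A * lyap a b + (vert a - vert b)\<^sup>2 + (sn a - sn b)\<^sup>2))"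
proof -
  obtain C \<epsilon>1 where C: "C > 0" "\<epsilon>1 > 0" and CC: "\<forall>\<epsilon>\<le>\<epsilon>1. \<forall>\<tau> a b. \<tau>\<^sup>2 = 1 \<longrightarrow> near 1 \<epsilon> a \<longrightarrow> near 1 \<epsilon> b \<longrightarrow>
     norm (mag a - mag_ref \<tau>) \<le> \<epsilon> \<longrightarrow> norm (mag b - mag_ref \<tau>) \<le> \<epsilon> \<longrightarrow>
     norm (mag a - mag b) \<le> C * (norm (eta a - eta b) + \<bar>sn a - sn b\<bar>) \<and>
     \<bar>sn_field a - sn_field b + k2r * \<tau> * M * (sn a - sn b)\<bar>
       \<le> C * (\<epsilon> * \<bar>sn a - sn b\<bar> + norm (hor a - hor b) + norm (eta a - eta b))"
    using heading_diff by blast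
  obtain c \<epsilon>2 where c: "c > 0" "\<epsilon>2 > 0" and cc: "\<forall>a b. near 1 \<epsilon>2 a \<longrightarrow> near 1 \<epsilon>2 b \<longrightarrow> lyap_rate a b \<le> - c * sqdist a b"
    using lyap_rate_le by blast
  define \<rho> where "\<rho> = k2r * M"
  have \<rho>: "\<rho> > 0" using k2r M by (simp add: \<rho>_def)
  \<comment> \<open>The three summands pay for the coupling into \<open>vert\<close>, for the
    coupling into \<open>sn\<close>, and for the decay of \<open>lyap\<close> itself.\<close>
  define A where "A = (g\<^sup>2 / k1v + 4 * C\<^sup>2 / \<rho> + 1) / c"
  have pos: "g\<^sup>2 / k1v > 0" "4 * C\<^sup>2 / \<rho> > 0" using g k1v C \<rho> by simp_all
  have A: "A > 0" using pos c by (simp add: A_def add_pos_pos)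
  have Ac: "A * c = g\<^sup>2 / k1v + 4 * C\<^sup>2 / \<rho> + 1" using c by (simp add: A_def)
  define c4 where "c4 = g + k1r + e0"
  have c4: "c4 > 0" using g k1r e0 by (simp add: c4_def)
  \<comment> \<open>\<open>A * lyap\<close> is at most \<open>A * c4 * sqdist\<close>, while one
    unit of \<open>sqdist\<close> is left for its decay; the other two entries are the rates left
    for \<open>vert\<close> and \<open>sn\<close>.\<close>
  define \<kappa> where "\<kappa> = min (1 / (A * c4)) (min k1v \<rho>)"
  have \<kappa>: "\<kappa> > 0" "\<kappa> \<le> k1v" "\<kappa> \<le> \<rho>" "\<kappa> * A * c4 \<le> 1"
  proof -
    show "\<kappa> > 0" "\<kappa> \<le> k1v" "\<kappa> \<le> \<rho>" using A c4 k1v \<rho> by (auto simp: \<kappa>_def)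
    have "\<kappa> * (A * c4) \<le> 1 / (A * c4) * (A * c4)"
      unfolding \<kappa>_def using A c4 by (intro mult_right_mono min.cobounded1) auto
    then show "\<kappa> * A * c4 \<le> 1" using A c4 by simp
  qed
  define \<epsilon> where "\<epsilon> = min (min \<epsilon>1 \<epsilon>2) (\<rho> / (4 * C))"
  have \<epsilon>: "\<epsilon> > 0" "\<epsilon> \<le> \<epsilon>1" "\<epsilon> \<le> \<epsilon>2" using C c \<rho> by (auto simp: \<epsilon>_def)
  have C\<epsilon>: "C * \<epsilon> \<le> \<rho> / 4"
    using mult_left_mono[OF min.cobounded2[of "min \<epsilon>1 \<epsilon>2" "\<rho> / (4 * C)"], of C] C by (simp add: \<epsilon>_def)
  show ?thesis
  proof (rule exI[of _ C], rule conjI[OF C(1)], rule exI[of _ A], rule conjI[OF A],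
      rule exI[of _ \<kappa>], rule conjI[OF \<kappa>(1)], rule exI[of _ \<epsilon>], rule conjI[OF \<epsilon>(1)], intro allI impI conjI)
    fix \<tau> a b
    assume \<tau>: "\<tau>\<^sup>2 = 1" and a: "near 1 \<epsilon> a" and b: "near 1 \<epsilon> b"
      and na: "norm (mag a - mag_ref \<tau>) \<le> \<epsilon>" and nb: "norm (mag b - mag_ref \<tau>) \<le> \<epsilon>"
    note CC' = CC[THEN spec, of \<epsilon>, THEN mp, OF \<epsilon>(2), THEN spec, of \<tau>, THEN spec, of a, THEN spec, of b,
        THEN mp, OF \<tau>, THEN mp, OF a, THEN mp, OF b, THEN mp, OF na, THEN mp, OF nb]
    show "norm (mag a - mag b) \<le> C * (norm (eta a - eta b) + \<bar>sn a - sn b\<bar>)"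
      by (rule CC'[THEN conjunct1])
    define s where "s = sn a - sn b"
    define F where "F = sn_field a - sn_field b"
    define X where "X = norm (hor a - hor b) + norm (eta a - eta b)"
    define N where "N = sqdist a b"
    have N: "N \<ge> 0" by (simp add: N_def sqdist_nonneg)
    have XN: "X\<^sup>2 \<le> 2 * N" unfolding X_def N_def by (rule sum_sqdist)
    have L: "lyap_rate a b \<le> - c * N" unfolding N_def
      by (rule cc[THEN spec, of a, THEN spec, of b, THEN mp, OF near_mono[OF a \<epsilon>(3)], THEN mp, OF near_mono[OF b \<epsilon>(3)]])
    have l: "0 \<le> lyap a b" "lyap a b \<le> c4 * N" using lyap_nonneg lyap_bounds(2) by (auto simp: c4_def N_def)
    have "\<bar>F + \<tau> * \<rho> * s\<bar> \<le> C * (\<epsilon> * \<bar>s\<bar> + X)"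
      using CC'[THEN conjunct2] by (simp add: F_def s_def \<rho>_def X_def algebra_simps)
    then have "2 * \<bar>s * (F + \<tau> * \<rho> * s)\<bar> \<le> \<rho> * s\<^sup>2 + 2 * C\<^sup>2 / \<rho> * X\<^sup>2"
      by (rule heading_product_bound[OF _ C\<epsilon> \<rho>])
    also have "\<dots> \<le> \<rho> * s\<^sup>2 + 2 * C\<^sup>2 / \<rho> * (2 * N)"
      using XN \<rho> by (intro add_left_mono mult_left_mono) auto
    finally have prod: "2 * \<bar>s * (F + \<tau> * \<rho> * s)\<bar> \<le> \<rho> * s\<^sup>2 + 4 * C\<^sup>2 / \<rho> * N" by simp
    have AL: "A * lyap_rate a b \<le> - (g\<^sup>2 / k1v * N + 4 * C\<^sup>2 / \<rho> * N + N)"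
    proof -
      have "A * lyap_rate a b \<le> A * (- c * N)" using L A by (intro mult_left_mono) auto
      also have "\<dots> = - ((A * c) * N)" by simp
      finally show ?thesis unfolding Ac by (simp add: algebra_simps)
    qed
    have gN: "0 \<le> g\<^sup>2 / k1v * N" by (intro mult_nonneg_nonneg less_imp_le[OF pos(1)] N)
    {
      assume "\<tau> = - 1"
      then have "s * (F + \<tau> * \<rho> * s) = s * F - \<rho> * s\<^sup>2" by (simp add: power2_eq_square algebra_simps)
      then have "2 * (s * F) - A * lyap_rate a b \<ge> \<rho> * s\<^sup>2"
        using prod AL N gN by linarith
      moreover have "\<kappa> * s\<^sup>2 \<le> \<rho> * s\<^sup>2" using \<kappa> by (intro mult_right_mono) auto
      moreover have "0 \<le> \<kappa> * (A * lyap a b)" using \<kappa> A l by simp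
      ultimately show "2 * (sn a - sn b) * (sn_field a - sn_field b) - A * lyap_rate a b
         \<ge> \<kappa> * ((sn a - sn b)\<^sup>2 - A * lyap a b)"
        unfolding s_def[symmetric] F_def[symmetric] right_diff_distrib mult.assoc by linarith
    }
    {
      assume "\<tau> = 1"
      then have sF: "s * (F + \<tau> * \<rho> * s) = s * F + \<rho> * s\<^sup>2" by (simp add: power2_eq_square algebra_simps)
      define y where "y = vert a - vert b"
      define h where "h = (eta a - eta b) $ 3"
      have h: "h\<^sup>2 \<le> N"
      proof -
        have "\<bar>h\<bar>\<^sup>2 \<le> (norm (eta a - eta b))\<^sup>2"
          unfolding h_def by (intro power_mono component_le_norm_cart) auto
        then show ?thesis by (simp add: N_def sqdist_def add_increasing2)
      qed
      have "0 \<le> (k1v * y - g * h)\<^sup>2 / k1v" using k1v by simp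
      also have "\<dots> = k1v * y\<^sup>2 - 2 * (y * (g * h)) + g\<^sup>2 / k1v * h\<^sup>2"
        using k1v by (simp add: power2_eq_square field_simps)
      also have "\<dots> \<le> k1v * y\<^sup>2 - 2 * (y * (g * h)) + g\<^sup>2 / k1v * N"
        using h pos by (intro add_left_mono mult_left_mono) auto
      finally have yy: "2 * (y * (g * h - k1v * y)) \<le> g\<^sup>2 / k1v * N - k1v * y\<^sup>2"
        by (simp add: right_diff_distrib power2_eq_square algebra_simps)
      have "A * lyap_rate a b + 2 * (y * (g * h - k1v * y)) + 2 * (s * F) \<le> - (N + k1v * y\<^sup>2 + \<rho> * s\<^sup>2)"
        using AL yy prod sF by linarith
      moreover have "\<kappa> * (A * lyap a b) \<le> \<kappa> * (A * (c4 * N))"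
        using l \<kappa> A by (intro mult_left_mono) auto
      moreover have "(\<kappa> * A * c4) * N \<le> 1 * N" using \<kappa> N by (intro mult_right_mono) auto
      moreover have "\<kappa> * y\<^sup>2 \<le> k1v * y\<^sup>2" "\<kappa> * s\<^sup>2 \<le> \<rho> * s\<^sup>2" using \<kappa> by (auto intro!: mult_right_mono)
      ultimately have "A * lyap_rate a b + 2 * (y * (g * h - k1v * y)) + 2 * (s * F) \<le> - (\<kappa> * (A * lyap a b) + \<kappa> * y\<^sup>2 + \<kappa> * s\<^sup>2)"
        unfolding mult.assoc by linarith
      then show "A * lyap_rate a b + 2 * (vert a - vert b) * (g * (eta a - eta b) $ 3 - k1v * (vert a - vert b))
         + 2 * (sn a - sn b) * (sn_field a - sn_field b)
         \<le> - \<kappa> * (A * lyap a b + (vert a - vert b)\<^sup>2 + (sn a - sn b)\<^sup>2)"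
        unfolding y_def[symmetric] s_def[symmetric] F_def[symmetric] h_def[symmetric] by (simp add: algebra_simps)
    }
  qed
qed

context
  fixes J a b t
  assumes a: "solution_on state_space (\<lambda>_. f) J a" and b: "solution_on state_space (\<lambda>_. f) J b" and t: "t \<in> J"
begin

lemma eta_diff_deriv: "((\<lambda>t. eta (a t) - eta (b t)) has_vector_derivative k1r *\<^sub>R (hor (a t) - hor (b t))) (at t within J)"
  unfolding scaleR_diff_right by (intro has_vector_derivative_diff eta_deriv[OF a t] eta_deriv[OF b t])

lemma hor_diff_deriv: "((\<lambda>t. hor (a t) - hor (b t)) has_vector_derivative hor_field (a t) - hor_field (b t)) (at t within J)"
  unfolding hor_field_def by (intro has_vector_derivative_diff hor_deriv[OF a t] hor_deriv[OF b t])

lemma lyap_deriv: "((\<lambda>t. lyap (a t) (b t)) has_real_derivative lyap_rate (a t) (b t)) (at t within J)"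
proof -
  have "((\<lambda>t. g * ((eta (a t) - eta (b t)) \<bullet> (eta (a t) - eta (b t))) + k1r * ((hor (a t) - hor (b t)) \<bullet> (hor (a t) - hor (b t)))
     + 2 * e0 * ((hor (a t) - hor (b t)) \<bullet> (eta (a t) - eta (b t)))) has_real_derivative
     g * ((eta (a t) - eta (b t)) \<bullet> (k1r *\<^sub>R (hor (a t) - hor (b t))) + (k1r *\<^sub>R (hor (a t) - hor (b t))) \<bullet> (eta (a t) - eta (b t)))
     + k1r * ((hor (a t) - hor (b t)) \<bullet> (hor_field (a t) - hor_field (b t)) + (hor_field (a t) - hor_field (b t)) \<bullet> (hor (a t) - hor (b t)))
     + 2 * e0 * ((hor (a t) - hor (b t)) \<bullet> (k1r *\<^sub>R (hor (a t) - hor (b t))) + (hor_field (a t) - hor_field (b t)) \<bullet> (eta (a t) - eta (b t)))) (at t within J)"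
    by (intro DERIV_add DERIV_cmult has_real_derivative_inner[OF _ _ refl] eta_diff_deriv hor_diff_deriv)
  moreover have "g * (h \<bullet> (k1r *\<^sub>R p) + (k1r *\<^sub>R p) \<bullet> h) + k1r * (p \<bullet> F + F \<bullet> p) + 2 * e0 * (p \<bullet> (k1r *\<^sub>R p) + F \<bullet> h)
     = 2 * g * k1r * (h \<bullet> p) + 2 * k1r * (p \<bullet> F) + 2 * e0 * (F \<bullet> h + k1r * (p \<bullet> p))" for h p F :: "real^3"
    by (simp add: inner_commute[of p h] inner_commute[of F p] algebra_simps)
  ultimately show ?thesis
    unfolding lyap_def lyap_rate_def power2_norm_eq_inner by (rule DERIV_cong)
qed

lemma sn_diff_square_deriv: "((\<lambda>t. (sn (a t) - sn (b t))\<^sup>2) has_real_derivative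
    2 * (sn (a t) - sn (b t)) * (sn_field (a t) - sn_field (b t))) (at t within J)"
  unfolding sn_field_def
  by (rule DERIV_cong[OF DERIV_power[OF DERIV_diff[OF sn_deriv[OF a t] sn_deriv[OF b t]]]]) simp

lemma vert_diff_square_deriv: "((\<lambda>t. (vert (a t) - vert (b t))\<^sup>2) has_real_derivative
    2 * (vert (a t) - vert (b t)) * (g * (eta (a t) - eta (b t)) $ 3 - k1v * (vert (a t) - vert (b t)))) (at t within J)"
  by (rule DERIV_cong[OF DERIV_power[OF DERIV_diff[OF vert_deriv[OF a t] vert_deriv[OF b t]]]])
     (simp add: algebra_simps)

end

subsection \<open>Exponential stability\<close>

definition origin :: state where "origin = (0, mat 1)"

lemma origin_simps [simp]: "fst origin = 0" "snd origin = mat 1" "eta origin = e3" "mag origin = m"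
  "vert origin = 0" "hor origin = 0" "sn origin = 0" "mag_ref 1 = m"
  by (simp_all add: origin_def eta_def mag_def vert_def hor_def sn_def mag_ref_def)

lemma origin_in: "origin \<in> state_space"
  by (simp add: origin_def state_space_def rotation_matrix_def orthogonal_matrix_id)

lemma f_origin: "f origin = 0"
proof -
  have "skew 0 = 0" by (simp add: linear_0[OF linear_skew])
  then have "f origin = (0, 0)"
    by (simp add: origin_def error_field_def sigma_v_def sigma_R_def)
  then show ?thesis by (simp add: zero_prod_def)
qed

lemma origin_equilibrium: "origin \<in> equilibria state_space f"
  using origin_in f_origin by (simp add: equilibria_def)

lemma solution_origin: "solution_on state_space (\<lambda>_. f) J (\<lambda>_. origin)"
  using origin_in by (simp add: solution_on_def f_origin)

text \<open>Distance to \<open>origin\<close> in adapted coordinates. The deviation of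
  \<open>mag\<close> is absent because near \<open>origin\<close> it is controlled by those of
  \<open>eta\<close> and \<open>sn\<close>.\<close>

definition defect :: "state \<Rightarrow> real" where
  "defect x = norm (hor x) + norm (eta x - e3) + \<bar>vert x\<bar> + \<bar>sn x\<bar>"

lemma defect_le_dist:
  "\<exists>C>0. \<forall>x\<in>state_space. defect x \<le> C * dist x origin \<and> norm (mag x - m) \<le> C * dist x origin
      \<and> norm (eta x - e3) \<le> C * dist x origin \<and> norm (hor x) \<le> C * dist x origin"
proof -
  obtain Q where Q: "Q > 0" "\<And>A (v::real^3). norm ((A::real^3^3) *v v) \<le> norm A * norm v * Q"
    using bounded_bilinear.pos_bounded[OF bounded_bilinear_matrix_vector_mult] by blast
  define \<mu> where "\<mu> = norm m"
  define C where "C = 2 + Q + \<mu> * Q + \<mu> * (\<mu> * Q) + \<mu> * (\<mu> * Q)"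
  have \<mu>: "\<mu> \<ge> 0" by (simp add: \<mu>_def)
  have C: "C > 0" unfolding C_def using Q \<mu> by (intro add_pos_nonneg) auto
  have "defect x \<le> C * d \<and> norm (mag x - m) \<le> C * d \<and> norm (eta x - e3) \<le> C * d \<and> norm (hor x) \<le> C * d"
    if x: "x \<in> state_space" and d_def: "d = dist x origin" for x d
  proof -
    have d: "d \<ge> 0" "norm (fst x) \<le> d" "norm (snd x - mat 1) \<le> d"
      using norm_fst_le[of "fst x" "snd x - mat 1"] norm_snd_le[of "snd x - mat 1" "fst x"]
      by (simp_all add: d_def dist_norm origin_def minus_prod_def)
    have e: "norm (eta x - e3) \<le> Q * d"
    proof -
      have "eta x - e3 = (snd x - mat 1) *v e3" by (simp add: eta_def matrix_vector_mult_diff_rdistrib)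
      then have "norm (eta x - e3) \<le> norm (snd x - mat 1) * 1 * Q" using Q(2)[of "snd x - mat 1" e3] by simp
      also have "\<dots> \<le> d * 1 * Q" using d Q by (intro mult_right_mono) auto
      finally show ?thesis by (simp add: mult.commute)
    qed
    have n: "norm (mag x - m) \<le> \<mu> * Q * d"
    proof -
      have "mag x - m = (snd x - mat 1) *v m" by (simp add: mag_def matrix_vector_mult_diff_rdistrib)
      then have "norm (mag x - m) \<le> norm (snd x - mat 1) * \<mu> * Q" using Q(2)[of "snd x - mat 1" m] by (simp add: \<mu>_def)
      also have "\<dots> \<le> d * \<mu> * Q" using d Q \<mu> by (intro mult_right_mono) auto
      finally show ?thesis by (simp add: mult_ac)
    qed
    have v: "\<bar>vert x\<bar> \<le> d"
      using Cauchy_Schwarz_ineq2[of "fst x" "eta x"] norm_eta[OF x] d by (simp add: vert_def)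
    have h: "norm (hor x) \<le> d"
    proof (rule power2_le_imp_le)
      have "hor x \<bullet> hor x = fst x \<bullet> fst x - (vert x)\<^sup>2"
        using eta_eta[OF x] by (simp add: hor_def inner_diff_left inner_diff_right vert_def inner_commute power2_eq_square)
      then have "(norm (hor x))\<^sup>2 \<le> (norm (fst x))\<^sup>2" by (simp add: power2_norm_eq_inner)
      also have "\<dots> \<le> d\<^sup>2" using d by (intro power_mono) auto
      finally show "(norm (hor x))\<^sup>2 \<le> d\<^sup>2" .
    qed (use d in simp)
    have s: "\<bar>sn x\<bar> \<le> \<mu> * (\<mu> * Q * d + \<mu> * (Q * d))"
    proof -
      have "\<bar>sn x\<bar> \<le> \<mu> * (norm (mag x - m) * 1 + \<mu> * norm (eta x - e3))"
        using inner_cross_diff_le[of m "mag x" "eta x" m e3] norm_eta[OF x] by (simp add: sn_def \<mu>_def)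
      also have "\<dots> \<le> \<mu> * (\<mu> * Q * d * 1 + \<mu> * (Q * d))"
        using e n \<mu> by (intro mult_left_mono add_mono mult_right_mono) auto
      finally show ?thesis by simp
    qed
    have nn: "0 \<le> Q * d" "0 \<le> \<mu> * Q * d" "0 \<le> \<mu> * (\<mu> * Q * d)" using Q \<mu> d by auto
    have Cd: "C * d = d + d + Q * d + \<mu> * Q * d + \<mu> * (\<mu> * Q * d) + \<mu> * (\<mu> * Q * d)"
      by (simp add: C_def algebra_simps)
    have s': "\<bar>sn x\<bar> \<le> \<mu> * (\<mu> * Q * d) + \<mu> * (\<mu> * Q * d)" using s by (simp add: algebra_simps)
    show ?thesis unfolding Cd defect_def using e n v h s' nn d by auto
  qed
  then show ?thesis using C by blast
qed

lemma defect_square_bounds: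
  "(defect x)\<^sup>2 \<le> 4 * (sqdist x origin + (vert x)\<^sup>2 + (sn x)\<^sup>2)"
  "sqdist x origin + (vert x)\<^sup>2 + (sn x)\<^sup>2 \<le> (defect x)\<^sup>2"
proof -
  have 1: "(a + b + c + d)\<^sup>2 \<le> 4 * (b\<^sup>2 + a\<^sup>2 + c\<^sup>2 + d\<^sup>2)" for a b c d :: real
  proof -
    have "0 \<le> (a - b)\<^sup>2 + (a - c)\<^sup>2 + (a - d)\<^sup>2 + (b - c)\<^sup>2 + (b - d)\<^sup>2 + (c - d)\<^sup>2" by simp
    then show ?thesis by (simp add: power2_eq_square algebra_simps)
  qed
  have 2: "b\<^sup>2 + a\<^sup>2 + c\<^sup>2 + d\<^sup>2 \<le> (a + b + c + d)\<^sup>2" if "a \<ge> 0" "b \<ge> 0" "c \<ge> 0" "d \<ge> 0" for a b c d :: real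
  proof -
    have "0 \<le> a * b + a * c + a * d + b * c + b * d + c * d" using that by simp
    then show ?thesis by (simp add: power2_eq_square algebra_simps)
  qed
  show "(defect x)\<^sup>2 \<le> 4 * (sqdist x origin + (vert x)\<^sup>2 + (sn x)\<^sup>2)"
    using 1[of "norm (hor x)" "norm (eta x - e3)" "\<bar>vert x\<bar>" "\<bar>sn x\<bar>"] by (simp add: defect_def sqdist_def)
  show "sqdist x origin + (vert x)\<^sup>2 + (sn x)\<^sup>2 \<le> (defect x)\<^sup>2"
    using 2[of "norm (hor x)" "norm (eta x - e3)" "\<bar>vert x\<bar>" "\<bar>sn x\<bar>"] by (simp add: defect_def sqdist_def)
qed

text \<open>Near the origin \<open>W = A lyap + vert\<^sup>2 + sn\<^sup>2\<close> is equivalent to the squared distance and decays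
  exponentially.\<close>

lemma origin_exponentially_stable: "locally_exponentially_stable state_space f origin"
proof -
  obtain C A \<kappa> \<epsilon> where pos: "C > 0" "A > 0" "\<kappa> > 0" "\<epsilon> > 0" and rates: "\<forall>\<tau> a b. \<tau>\<^sup>2 = 1 \<longrightarrow> near 1 \<epsilon> a \<longrightarrow> near 1 \<epsilon> b \<longrightarrow>
     norm (mag a - mag_ref \<tau>) \<le> \<epsilon> \<longrightarrow> norm (mag b - mag_ref \<tau>) \<le> \<epsilon> \<longrightarrow>
     norm (mag a - mag b) \<le> C * (norm (eta a - eta b) + \<bar>sn a - sn b\<bar>) \<and>
     (\<tau> = - 1 \<longrightarrow> 2 * (sn a - sn b) * (sn_field a - sn_field b) - A * lyap_rate a b
         \<ge> \<kappa> * ((sn a - sn b)\<^sup>2 - A * lyap a b)) \<and>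
     (\<tau> = 1 \<longrightarrow> A * lyap_rate a b + 2 * (vert a - vert b) * (g * (eta a - eta b) $ 3 - k1v * (vert a - vert b))
         + 2 * (sn a - sn b) * (sn_field a - sn_field b)
         \<le> - \<kappa> * (A * lyap a b + (vert a - vert b)\<^sup>2 + (sn a - sn b)\<^sup>2))"
    using heading_rates by blast
  obtain D where D: "D > 0" "\<And>x. x \<in> state_space \<Longrightarrow> defect x \<le> D * dist x origin \<and> norm (mag x - m) \<le> D * dist x origin
      \<and> norm (eta x - e3) \<le> D * dist x origin \<and> norm (hor x) \<le> D * dist x origin"
    using defect_le_dist by blast
  obtain G where G: "G > 0" "\<And>x. x \<in> state_space \<Longrightarrow> dist x origin \<le> G * (norm (fst x) + norm (eta x - e3) + norm (mag x - m))"
    using dist_identity_le unfolding origin_def by blast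
  \<comment> \<open>In the ball of this radius \<open>D\<close> times the distance is at most
    \<open>\<epsilon>\<close>, so the rates hold throughout it.\<close>
  define r where "r = \<epsilon> / D"
  have r: "r > 0" "D * r = \<epsilon>" using pos D by (simp_all add: r_def)
  define W where "W x = A * lyap x origin + (vert x)\<^sup>2 + (sn x)\<^sup>2" for x
  have near_r: "near 1 \<epsilon> x" "norm (mag x - m) \<le> \<epsilon>" if "x \<in> state_space" "dist x origin \<le> r" for x
  proof -
    have "D * dist x origin \<le> \<epsilon>" using mult_left_mono[OF that(2), of D] D(1) r by simp
    then show "near 1 \<epsilon> x" "norm (mag x - m) \<le> \<epsilon>" using D(2)[OF that(1)] that(1) by (auto simp: near_def)
  qed
  have near_0: "near 1 \<epsilon> origin" "norm (mag origin - mag_ref 1) \<le> \<epsilon>"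
    using pos origin_in by (auto simp: near_def)
  have rate: "norm (mag x - m) \<le> C * (norm (eta x - e3) + \<bar>sn x\<bar>)"
    "A * lyap_rate x origin + 2 * (vert x - vert origin) * (g * (eta x - eta origin) $ 3 - k1v * (vert x - vert origin))
       + 2 * (sn x - sn origin) * (sn_field x - sn_field origin) \<le> - \<kappa> * W x"
    if "x \<in> state_space" "dist x origin \<le> r" for x
    using rates[THEN spec, of 1, THEN spec, of x, THEN spec, of origin] near_r[OF that] near_0
    by (simp_all add: W_def)
  define a1 where "a1 = min (A * min (g / 2) (k1r / 2)) 1"
  have a1: "a1 > 0" using pos g k1r by (simp add: a1_def)
  define a2 where "a2 = A * (g + k1r + e0) + 1"
  have a2: "a2 > 0" using pos g k1r e0 by (simp add: a2_def add_pos_pos)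
  have W_upper: "W x \<le> a2 * (D * dist x origin)\<^sup>2" if "x \<in> state_space" for x
  proof -
    have "A * lyap x origin \<le> A * ((g + k1r + e0) * sqdist x origin)"
      using pos lyap_bounds(2) by (intro mult_left_mono) auto
    moreover have "0 \<le> A * (g + k1r + e0) * ((vert x)\<^sup>2 + (sn x)\<^sup>2)"
      using pos g k1r e0 by (intro mult_nonneg_nonneg) auto
    ultimately have "W x \<le> a2 * (sqdist x origin + (vert x)\<^sup>2 + (sn x)\<^sup>2)"
      using sqdist_nonneg[of x origin] by (simp add: W_def a2_def algebra_simps)
    also have "\<dots> \<le> a2 * (defect x)\<^sup>2" using a2 defect_square_bounds(2) by (intro mult_left_mono) auto
    also have "\<dots> \<le> a2 * (D * dist x origin)\<^sup>2"
      using a2 D(2)[OF that] by (intro mult_left_mono power_mono) (auto simp: defect_def intro!: add_nonneg_nonneg)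
    finally show ?thesis .
  qed
  have W_lower: "a1 * (defect x)\<^sup>2 \<le> 4 * W x" for x
  proof -
    have "a1 * (defect x)\<^sup>2 \<le> a1 * (4 * (sqdist x origin + (vert x)\<^sup>2 + (sn x)\<^sup>2))"
      using a1 defect_square_bounds(1) by (intro mult_left_mono) auto
    also have "\<dots> = 4 * (a1 * sqdist x origin + a1 * (vert x)\<^sup>2 + a1 * (sn x)\<^sup>2)" by (simp add: algebra_simps)
    also have "\<dots> \<le> 4 * ((A * min (g / 2) (k1r / 2)) * sqdist x origin + 1 * (vert x)\<^sup>2 + 1 * (sn x)\<^sup>2)"
      using sqdist_nonneg by (intro mult_left_mono add_mono mult_right_mono) (auto simp: a1_def)
    also have "\<dots> \<le> 4 * W x"
      using pos lyap_bounds(1)[of x origin] mult_left_mono[of "min (g / 2) (k1r / 2) * sqdist x origin" "lyap x origin" A]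
      by (simp add: W_def mult.assoc)
    finally show ?thesis .
  qed
  define G1 where "G1 = G * (1 + C)"
  have G1: "G1 > 0" using G pos by (simp add: G1_def)
  have dist_defect: "dist x origin \<le> G1 * defect x" if "x \<in> state_space" "dist x origin \<le> r" for x
  proof -
    have "norm (fst x) \<le> norm (hor x) + \<bar>vert x\<bar>"
      using norm_triangle_ineq[of "hor x" "vert x *\<^sub>R eta x"] norm_eta[OF that(1)] by (simp flip: fst_eq)
    moreover have "0 \<le> C * (norm (hor x) + \<bar>vert x\<bar>)" using pos by simp
    ultimately have "norm (fst x) + norm (eta x - e3) + norm (mag x - m) \<le> (1 + C) * defect x"
      using rate(1)[OF that] by (simp add: defect_def algebra_simps)
    then have "G * (norm (fst x) + norm (eta x - e3) + norm (mag x - m)) \<le> G * ((1 + C) * defect x)"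
      using G(1) by (intro mult_left_mono) auto
    then show ?thesis using G(2)[OF that(1)] by (simp add: G1_def)
  qed
  \<comment> \<open>The square root compares the upper and lower quadratic bounds of
    \<open>W\<close>; \<open>D\<close> and \<open>G1\<close> translate between distance and
    defect.\<close>
  define B where "B = sqrt (4 * a2 / a1) * (D * G1)"
  have B: "B > 0" using a1 a2 D(1) G1 by (simp add: B_def)
  have decay: "dist (x t) origin \<le> B * exp (- (\<kappa> / 2) * t) * dist (x 0) origin"
    if sol: "solution_on state_space (\<lambda>_. f) {0..T} x" and t: "t \<in> {0..T}" and cl: "\<And>s. s \<in> {0..t} \<Longrightarrow> dist (x s) origin \<le> r" for T x t
  proof -
    have "W (x t) \<le> W (x 0) * exp ((- \<kappa>) * (t - 0))"
    proof (rule derivative_le_imp_exp_le[where J = "{0..T}" and f = "\<lambda>t. W (x t)" and a = 0 and b = t])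
      fix s assume s: "s \<in> {0..t}"
      then have sT: "s \<in> {0..T}" using t by auto
      let ?R = "A * lyap_rate (x s) origin + 2 * (vert (x s) - vert origin) * (g * (eta (x s) - eta origin) $ 3 - k1v * (vert (x s) - vert origin))
        + 2 * (sn (x s) - sn origin) * (sn_field (x s) - sn_field origin)"
      have "((\<lambda>t. A * lyap (x t) origin + (vert (x t) - vert origin)\<^sup>2 + (sn (x t) - sn origin)\<^sup>2) has_real_derivative ?R) (at s within {0..T})"
        by (intro DERIV_add DERIV_cmult lyap_deriv[OF sol solution_origin sT] vert_diff_square_deriv[OF sol solution_origin sT]
            sn_diff_square_deriv[OF sol solution_origin sT])
      then show "((\<lambda>t. W (x t)) has_real_derivative ?R) (at s within {0..T})" by (simp add: W_def)
      show "?R \<le> - \<kappa> * W (x s)"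
        by (rule rate(2)[OF sol_in[OF sol sT] cl[OF s]])
    qed (use t in auto)
    also have "\<dots> \<le> a2 * (D * dist (x 0) origin)\<^sup>2 * exp ((- \<kappa>) * (t - 0))"
      using W_upper[OF sol_in[OF sol, of 0]] t by (intro mult_right_mono) auto
    finally have "4 * W (x t) \<le> 4 * a2 * (D * dist (x 0) origin)\<^sup>2 * exp (- \<kappa> * t)" by simp
    with W_lower[of "x t"] have "a1 * (defect (x t))\<^sup>2 \<le> 4 * a2 * (D * dist (x 0) origin)\<^sup>2 * exp (- \<kappa> * t)"
      by (rule order_trans)
    then have "(defect (x t))\<^sup>2 \<le> 4 * a2 / a1 * (D * dist (x 0) origin)\<^sup>2 * exp (- \<kappa> * t)"
      using a1 by (simp add: field_simps)
    also have "\<dots> = (sqrt (4 * a2 / a1) * (D * dist (x 0) origin) * exp (- (\<kappa> / 2) * t))\<^sup>2"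
    proof -
      have "exp (- \<kappa> * t) = (exp (- (\<kappa> / 2) * t))\<^sup>2" by (simp add: power2_eq_square flip: exp_add)
      moreover have "4 * a2 / a1 = (sqrt (4 * a2 / a1))\<^sup>2" using a1 a2 by simp
      ultimately show ?thesis by (simp only: power_mult_distrib)
    qed
    finally have "defect (x t) \<le> sqrt (4 * a2 / a1) * (D * dist (x 0) origin) * exp (- (\<kappa> / 2) * t)"
      by (rule power2_le_imp_le) (use a1 a2 D(1) in simp)
    then have "G1 * defect (x t) \<le> G1 * (sqrt (4 * a2 / a1) * (D * dist (x 0) origin) * exp (- (\<kappa> / 2) * t))"
      using G1 by (intro mult_left_mono) auto
    moreover have "dist (x t) origin \<le> G1 * defect (x t)"
      by (rule dist_defect[OF sol_in[OF sol t] cl]) (use t in auto)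
    ultimately show ?thesis by (simp add: B_def mult_ac)
  qed
  \<comment> \<open>\<open>decay\<close> presumes that the trajectory has stayed in the ball of
    radius \<open>r\<close>. Starting within \<open>r / B\<close> keeps its conclusion strictly
    inside this ball, so the barrier argument closes.\<close>
  define \<delta> where "\<delta> = min r (r / B)"
  have \<delta>: "\<delta> > 0" using r B by (simp add: \<delta>_def)
  have "dist (x t) origin \<le> B * exp (- (\<kappa> / 2) * t) * dist (x 0) origin"
    if sol: "solution_on state_space (\<lambda>_. f) {0..T} x" and 0: "dist (x 0) origin < \<delta>" and t: "t \<in> {0..T}" for T x t
  proof -
    have lt: "dist (x s) origin < r" if "s \<in> {0..T}" for s
    proof (rule continuous_barrier[of T "\<lambda>s. dist (x s) origin"])
      have "continuous_on {0..T} x"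
        unfolding continuous_on_eq_continuous_within
        using has_vector_derivative_continuous[OF sol_deriv[OF sol]] by blast
      then show "continuous_on {0..T} (\<lambda>s. dist (x s) origin)" by (intro continuous_intros)
      show "dist (x 0) origin < r" using 0 by (simp add: \<delta>_def)
      fix u assume u: "u \<in> {0..T}" and cl: "\<And>s. s \<in> {0..u} \<Longrightarrow> dist (x s) origin \<le> r"
      have "dist (x u) origin \<le> B * exp (- (\<kappa> / 2) * u) * dist (x 0) origin" by (rule decay[OF sol u cl])
      also have "\<dots> \<le> B * 1 * dist (x 0) origin"
        using B pos u by (intro mult_right_mono mult_left_mono) auto
      also have "\<dots> < r" using 0 B by (simp add: \<delta>_def field_simps)
      finally show "dist (x u) origin < r" .
    qed (rule that)
    show ?thesis by (rule decay[OF sol t]) (use lt t in \<open>auto intro!: less_imp_le\<close>)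
  qed
  then show ?thesis
    unfolding locally_exponentially_stable_def using origin_equilibrium \<delta> B pos(3)
    by (intro conjI exI[of _ \<delta>] exI[of _ B] exI[of _ "\<kappa> / 2"]) auto
qed

lemma origin_stable: "stable_equilibrium state_space f origin"
proof -
  obtain \<delta> C r where *: "\<delta> > 0" "C > 0" "r > 0" and
    decay: "\<forall>T>0. \<forall>x. solution_on state_space (\<lambda>_. f) {0..T} x \<and> dist (x 0) origin < \<delta> \<longrightarrow>
        (\<forall>t\<in>{0..T}. dist (x t) origin \<le> C * exp (- r * t) * dist (x 0) origin)"
    using origin_exponentially_stable unfolding locally_exponentially_stable_def by blast
  show ?thesis
    unfolding stable_equilibrium_def
  proof (intro conjI origin_equilibrium allI impI)
    fix \<epsilon> :: real assume \<epsilon>: "\<epsilon> > 0"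
    show "\<exists>\<delta>>0. \<forall>T>0. \<forall>x. solution_on state_space (\<lambda>_. f) {0..T} x \<and> dist (x 0) origin < \<delta> \<longrightarrow>
        (\<forall>t\<in>{0..T}. dist (x t) origin < \<epsilon>)"
    proof (rule exI[of _ "min \<delta> (\<epsilon> / C)"], intro conjI allI impI ballI)
      fix T :: real and x t
      assume T: "T > 0" and x: "solution_on state_space (\<lambda>_. f) {0..T} x \<and> dist (x 0) origin < min \<delta> (\<epsilon> / C)" and t: "t \<in> {0..T}"
      have "dist (x t) origin \<le> C * exp (- r * t) * dist (x 0) origin"
        using decay[THEN spec, of T, THEN mp, OF T, THEN spec, of x] x t by auto
      also have "\<dots> \<le> C * 1 * dist (x 0) origin" using * t by (intro mult_right_mono mult_left_mono) auto
      also have "\<dots> < \<epsilon>" using x * by (simp add: field_simps)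
      finally show "dist (x t) origin < \<epsilon>" .
    qed (use * \<epsilon> in auto)
  qed
qed

end

subsection \<open>Null basins of the unstable equilibria\<close>

text \<open>A positive value would grow exponentially and exceed the bound. Applied to a cone form
  of two trajectories, it forbids that their difference be dominated by its unstable part.\<close>

lemma bounded_growth_nonpos:
  fixes E E' :: "real \<Rightarrow> real"
  assumes E: "\<And>t. t \<ge> T \<Longrightarrow> (E has_real_derivative E' t) (at t within {0..})" and T: "T \<ge> 0"
    and growth: "\<And>t. t \<ge> T \<Longrightarrow> E' t \<ge> \<kappa> * E t" and \<kappa>: "\<kappa> > 0"
    and bnd: "\<And>t. t \<ge> T \<Longrightarrow> E t \<le> B"
  shows "E T \<le> 0"
proof (rule ccontr)
  assume "\<not> E T \<le> 0"
  then have pos: "E T > 0" by simp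
  \<comment> \<open>At this time already the linear lower bound for the exponential reaches
    \<open>E T + \<bar>B\<bar>\<close>.\<close>
  define t where "t = T + \<bar>B\<bar> / (\<kappa> * E T)"
  have t: "t \<ge> T" using pos \<kappa> by (simp add: t_def)
  have "E T * exp (\<kappa> * (t - T)) \<le> E t"
    by (rule derivative_ge_imp_exp_ge[OF t, where J = "{0..}" and f' = E']) (use E T growth in auto)
  moreover have "E T * (1 + \<kappa> * (t - T)) \<le> E T * exp (\<kappa> * (t - T))"
    using pos exp_ge_add_one_self by (intro mult_left_mono) auto
  moreover have "E T * (1 + \<kappa> * (t - T)) = E T + \<bar>B\<bar>" using pos \<kappa> by (simp add: t_def field_simps)
  ultimately show False using bnd[OF t] pos by linarith
qed

context observer
begin

definition "disc = sqrt (K\<^sup>2 + 4 * k1r * g)"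
definition "ap = (K + disc) / (2 * k1r)"
definition "am = (K - disc) / (2 * k1r)"

text \<open>\<open>ap\<close> and \<open>am\<close> are the roots of \<open>k1r * z\<^sup>2 - K * z - g\<close>, so that \<open>hor + ap * eta\<close> and
  \<open>hor + am * eta\<close> are the unstable and the stable coordinate of the pendulum linearised at the
  maximum \<open>\<eta> = - e3\<close> of its potential.\<close>

lemma ap_am: "ap > 0" "am < 0" "ap * (ap * k1r - K) = g" "am * (am * k1r - K) = g"
proof -
  have d2: "disc\<^sup>2 = K\<^sup>2 + 4 * k1r * g" using k1r g by (simp add: disc_def)
  have "K\<^sup>2 < disc\<^sup>2" unfolding d2 using k1r g by simp
  moreover have "disc \<ge> 0" using k1r g by (simp add: disc_def)
  ultimately have d: "disc > K" by (rule power_less_imp_less_base)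
  show "ap > 0" "am < 0" using d K k1r by (simp_all add: ap_def am_def divide_neg_pos)
  have *: "z / (2 * k1r) * (z / (2 * k1r) * k1r - K) = (z\<^sup>2 - 2 * K * z) / (4 * k1r)" for z
    using k1r by (simp add: power2_eq_square field_simps)
  have "(K + disc)\<^sup>2 - 2 * K * (K + disc) = 4 * k1r * g" "(K - disc)\<^sup>2 - 2 * K * (K - disc) = 4 * k1r * g"
    using d2 by (simp_all add: power2_eq_square algebra_simps)
  then show "ap * (ap * k1r - K) = g" "am * (am * k1r - K) = g"
    unfolding ap_def am_def * using k1r by simp_all
qed

definition mode :: "real \<Rightarrow> state \<Rightarrow> real^3" where "mode z x = hor x + z *\<^sub>R eta x"

text \<open>Positive exactly when the unstable coordinate of the difference outweighs the stable
  one.\<close>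

definition cone :: "state \<Rightarrow> state \<Rightarrow> real" where
  "cone a b = (norm (mode ap a - mode ap b))\<^sup>2 - (norm (mode am a - mode am b))\<^sup>2"

definition mode_field :: "real \<Rightarrow> state \<Rightarrow> real^3" where
  "mode_field z x = hor_field x + (z * k1r) *\<^sub>R hor x"

definition cone_rate :: "state \<Rightarrow> state \<Rightarrow> real" where
  "cone_rate a b = 2 * ((mode ap a - mode ap b) \<bullet> (mode_field ap a - mode_field ap b))
    - 2 * ((mode am a - mode am b) \<bullet> (mode_field am a - mode_field am b))"

text \<open>The two modes diagonalise the linearised pendulum with rates \<open>g / ap > 0\<close>
  and \<open>g / am < 0\<close>, so \<open>cone\<close> grows along pairs of trajectories. Where it
  is nonpositive the stable mode controls everything, and its vertical component is of second order,
  which leaves two coordinates for four pendulum dimensions.\<close>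

lemma bottom_cone:
  "\<exists>C>0. \<exists>\<kappa>>0. \<exists>\<epsilon>>0. \<epsilon> \<le> 1 / 2 \<and> (\<forall>a b. near (- 1) \<epsilon> a \<longrightarrow> near (- 1) \<epsilon> b \<longrightarrow> cone_rate a b \<ge> \<kappa> * cone a b \<and>
      (cone a b \<le> 0 \<longrightarrow> norm (eta a - eta b) + norm (hor a - hor b)
         \<le> C * (\<bar>(mode am a - mode am b) $ 1\<bar> + \<bar>(mode am a - mode am b) $ 2\<bar>)))"
proof -
  \<comment> \<open>Bound for recovering the differences of \<open>eta\<close> and
    \<open>hor\<close> from their two modes.\<close>
  define c1 where "c1 = (1 + ap) / (ap - am) + 1"
  have c1: "c1 > 0" using ap_am by (simp add: c1_def add_pos_pos)
  define \<kappa> where "\<kappa> = min (g / ap) (- g / am)"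
  have \<kappa>: "\<kappa> > 0" using g ap_am by (simp add: \<kappa>_def divide_pos_neg)
  define C0 where "C0 = 2 * (g + k1r)"
  have C0: "C0 > 0" using g k1r by (simp add: C0_def)
  \<comment> \<open>The second entry makes the nonlinear remainder at most the surplus in growth,
    the third keeps the vertical component of the stable mode below half its norm, and
    \<open>1 / 2\<close> is also used to absorb an error in \<open>mag\<close> later on.\<close>
  define \<epsilon> where "\<epsilon> = min (1 / 2) (min (\<kappa> / (4 * C0 * c1)) (1 / (4 * (1 - am) * c1)))"
  have \<epsilon>: "\<epsilon> > 0" "\<epsilon> \<le> 1 / 2" using \<kappa> C0 c1 ap_am by (simp_all add: \<epsilon>_def)
  have e1: "4 * C0 * c1 * \<epsilon> \<le> \<kappa>"
  proof -
    have "\<epsilon> \<le> \<kappa> / (4 * C0 * c1)" by (simp add: \<epsilon>_def)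
    then show ?thesis using C0 c1 by (simp add: field_simps)
  qed
  have e2: "4 * (1 - am) * c1 * \<epsilon> \<le> 1"
  proof -
    have "\<epsilon> \<le> 1 / (4 * (1 - am) * c1)" by (simp add: \<epsilon>_def)
    moreover have "4 * (1 - am) * c1 > 0" using ap_am c1 by simp
    ultimately show ?thesis by (simp add: pos_le_divide_eq mult.commute)
  qed
  have "cone_rate a b \<ge> \<kappa> * cone a b \<and> (cone a b \<le> 0 \<longrightarrow> norm (eta a - eta b) + norm (hor a - hor b)
         \<le> (4 * c1) * (\<bar>(mode am a - mode am b) $ 1\<bar> + \<bar>(mode am a - mode am b) $ 2\<bar>))"
    if a: "near (- 1) \<epsilon> a" and b: "near (- 1) \<epsilon> b" for a b
  proof -
    define h where "h = eta a - eta b"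
    define p where "p = hor a - hor b"
    define u where "u = p + ap *\<^sub>R h"
    define v where "v = p + am *\<^sub>R h"
    have uv: "mode ap a - mode ap b = u" "mode am a - mode am b = v"
      by (simp_all add: mode_def u_def v_def p_def h_def scaleR_diff_right)
    define P where "P = norm u"
    define Q where "Q = norm v"
    have PQ: "P \<ge> 0" "Q \<ge> 0" by (simp_all add: P_def Q_def)
    define r where "r = hor_field a - hor_field b + (g * - 1) *\<^sub>R h + K *\<^sub>R p"
    have ab: "a \<in> state_space" "b \<in> state_space" using a b by (auto simp: near_def)
    have hb: "norm h \<le> (P + Q) / (ap - am)"
    proof -
      have "u - v = (ap - am) *\<^sub>R h" by (simp add: u_def v_def scaleR_diff_left)
      then have "(ap - am) * norm h \<le> P + Q"
        using norm_triangle_ineq4[of u v] ap_am by (simp add: P_def Q_def)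
      then show ?thesis using ap_am by (simp add: field_simps)
    qed
    have "norm p \<le> P + ap * norm h"
      using norm_triangle_ineq4[of u "ap *\<^sub>R h"] ap_am by (simp add: u_def P_def)
    then have "norm h + norm p \<le> P + (1 + ap) * norm h" by (simp add: algebra_simps)
    also have "\<dots> \<le> (P + Q) + (1 + ap) * ((P + Q) / (ap - am))"
      using hb PQ ap_am by (intro add_mono mult_left_mono) auto
    also have "\<dots> = c1 * (P + Q)" by (simp add: c1_def algebra_simps)
    finally have hp: "norm h + norm p \<le> c1 * (P + Q)" .
    have "norm r \<le> C0 * \<epsilon> * (norm h + norm p)"
      unfolding r_def C0_def h_def p_def by (rule hor_field_diff[OF a b _ order_trans[OF \<epsilon>(2)]]) simp_all
    also have "\<dots> \<le> C0 * \<epsilon> * (c1 * (P + Q))" using C0 \<epsilon> hp by (intro mult_left_mono) auto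
    finally have r: "norm r \<le> C0 * \<epsilon> * (c1 * (P + Q))" .
    \<comment> \<open>As \<open>z\<close> is a root of the quadratic,
      \<open>g / z = z * k1r - K\<close>, and the linear part is the mode itself multiplied by this
      rate.\<close>
    have mf: "mode_field z a - mode_field z b = (g / z) *\<^sub>R (p + z *\<^sub>R h) + r"
      if "z \<noteq> 0" "z * (z * k1r - K) = g" for z
    proof -
      have "g / z = z * k1r - K" using that by (simp add: field_simps)
      moreover have "mode_field z a - mode_field z b = r + g *\<^sub>R h + (z * k1r - K) *\<^sub>R p"
        by (simp add: mode_field_def r_def p_def h_def algebra_simps)
      moreover have "(z * k1r - K) * z = g" using that(2) by (simp add: mult.commute)
      ultimately show ?thesis by (simp add: scaleR_add_right)
    qed
    have mfu: "mode_field ap a - mode_field ap b = (g / ap) *\<^sub>R u + r"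
      and mfv: "mode_field am a - mode_field am b = (g / am) *\<^sub>R v + r"
      using mf[of ap] mf[of am] ap_am by (simp_all add: u_def v_def)
    have rate: "cone_rate a b = 2 * (g / ap) * P\<^sup>2 - 2 * (g / am) * Q\<^sup>2 + 2 * ((u - v) \<bullet> r)"
      unfolding cone_rate_def uv mfu mfv P_def Q_def power2_norm_eq_inner
      by (simp add: inner_add_right inner_diff_left algebra_simps)
    have "\<bar>(u - v) \<bullet> r\<bar> \<le> (P + Q) * (C0 * \<epsilon> * (c1 * (P + Q)))"
      using r PQ norm_triangle_ineq4[of u v]
      by (intro order_trans[OF Cauchy_Schwarz_ineq2] mult_mono) (auto simp: P_def Q_def)
    also have "\<dots> = (4 * C0 * c1 * \<epsilon>) * ((P + Q)\<^sup>2 / 4)" by (simp add: power2_eq_square)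
    also have "\<dots> \<le> \<kappa> * ((P + Q)\<^sup>2 / 4)" using e1 by (intro mult_right_mono) auto
    also have "\<dots> \<le> \<kappa> * ((P\<^sup>2 + Q\<^sup>2) / 2)"
      using \<kappa> zero_le_power2[of "P - Q"] by (intro mult_left_mono) (auto simp: power2_sum power2_diff)
    finally have "- \<kappa> * (P\<^sup>2 + Q\<^sup>2) \<le> 2 * ((u - v) \<bullet> r)" by (simp add: abs_le_iff)
    moreover have "\<kappa> \<le> g / ap" "\<kappa> \<le> - (g / am)" by (simp_all add: \<kappa>_def)
    then have "\<kappa> * P\<^sup>2 \<le> (g / ap) * P\<^sup>2" "\<kappa> * Q\<^sup>2 \<le> (- (g / am)) * Q\<^sup>2"
      by (intro mult_right_mono; simp)+
    ultimately have "cone_rate a b \<ge> \<kappa> * (P\<^sup>2 + Q\<^sup>2)"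
      unfolding rate mult.assoc distrib_left mult_minus_left by linarith
    moreover have "\<kappa> * (P\<^sup>2 + Q\<^sup>2) \<ge> \<kappa> * cone a b"
      using \<kappa> unfolding cone_def uv P_def[symmetric] Q_def[symmetric] by (intro mult_left_mono) auto
    ultimately have 1: "cone_rate a b \<ge> \<kappa> * cone a b" by linarith
    have 2: "norm h + norm p \<le> (4 * c1) * (\<bar>v $ 1\<bar> + \<bar>v $ 2\<bar>)" if "cone a b \<le> 0"
    proof -
      have "P\<^sup>2 \<le> Q\<^sup>2" using that unfolding cone_def uv P_def Q_def by simp
      then have "P \<le> Q" using PQ by (rule_tac power2_le_imp_le)
      then have "c1 * (P + Q) \<le> c1 * (2 * Q)" using c1 by (intro mult_left_mono) auto
      then have hpQ: "norm h + norm p \<le> 2 * c1 * Q" using hp by simp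
      have h3: "\<bar>h $ 3\<bar> \<le> \<epsilon> * norm h" unfolding h_def by (rule eta_diff_3[OF a b]) simp
      have "p \<bullet> eta a + hor b \<bullet> h = 0"
        using hor_eta[OF ab(1)] hor_eta[OF ab(2)] by (simp add: p_def h_def inner_diff_left inner_diff_right)
      then have "p $ 3 = hor b \<bullet> h + p \<bullet> (eta a + e3)" by (simp add: inner_add_right inner_e3)
      moreover have "\<bar>hor b \<bullet> h\<bar> \<le> \<epsilon> * norm h"
        using b by (intro order_trans[OF Cauchy_Schwarz_ineq2] mult_right_mono) (auto simp: near_def)
      moreover have "\<bar>p \<bullet> (eta a + e3)\<bar> \<le> norm p * \<epsilon>"
        using a by (intro order_trans[OF Cauchy_Schwarz_ineq2] mult_left_mono) (auto simp: near_def)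
      ultimately have p3: "\<bar>p $ 3\<bar> \<le> \<epsilon> * (norm h + norm p)" by (simp add: algebra_simps)
      have "\<bar>v $ 3\<bar> \<le> \<bar>p $ 3\<bar> + \<bar>am * h $ 3\<bar>" by (simp add: v_def abs_triangle_ineq)
      also have "\<dots> \<le> \<epsilon> * (norm h + norm p) + (- am) * (\<epsilon> * norm h)"
        using p3 h3 ap_am by (intro add_mono) (auto simp: abs_mult)
      also have "\<dots> \<le> \<epsilon> * (norm h + norm p) + (- am) * (\<epsilon> * (norm h + norm p))"
        using \<epsilon> ap_am by (intro add_left_mono mult_left_mono) auto
      also have "\<dots> = (1 - am) * \<epsilon> * (norm h + norm p)" by (simp add: algebra_simps)
      also have "\<dots> \<le> (1 - am) * \<epsilon> * (2 * c1 * Q)" using \<epsilon> ap_am hpQ by (intro mult_left_mono) auto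
      also have "\<dots> = (4 * (1 - am) * c1 * \<epsilon>) * (Q / 2)" by simp
      also have "\<dots> \<le> 1 * (Q / 2)" using e2 PQ by (intro mult_right_mono) auto
      finally have "\<bar>v $ 3\<bar> \<le> Q / 2" by simp
      moreover have "Q \<le> \<bar>v $ 1\<bar> + \<bar>v $ 2\<bar> + \<bar>v $ 3\<bar>"
        using norm_le_l1_cart[of v] by (simp add: Q_def sum_3)
      ultimately have "Q \<le> 2 * (\<bar>v $ 1\<bar> + \<bar>v $ 2\<bar>)" by simp
      then have "2 * c1 * Q \<le> 2 * c1 * (2 * (\<bar>v $ 1\<bar> + \<bar>v $ 2\<bar>))" using c1 by (intro mult_left_mono) auto
      also have "\<dots> = (4 * c1) * (\<bar>v $ 1\<bar> + \<bar>v $ 2\<bar>)" by simp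
      finally show ?thesis using hpQ by (rule order_trans[rotated])
    qed
    show ?thesis unfolding uv using 1 2 by (auto simp: h_def p_def)
  qed
  moreover have "4 * c1 > 0" using c1 by simp
  ultimately show ?thesis using \<kappa> \<epsilon> by blast
qed

context
  fixes J a b t
  assumes a: "solution_on state_space (\<lambda>_. f) J a" and b: "solution_on state_space (\<lambda>_. f) J b" and t: "t \<in> J"
begin

lemma mode_diff_deriv: "((\<lambda>t. mode z (a t) - mode z (b t)) has_vector_derivative mode_field z (a t) - mode_field z (b t)) (at t within J)"
proof -
  have "((\<lambda>t. mode z (x t)) has_vector_derivative mode_field z (x t)) (at t within J)"
    if x: "solution_on state_space (\<lambda>_. f) J x" for x
    using has_vector_derivative_add[OF hor_deriv[OF x t]
        bounded_linear.has_vector_derivative[OF bounded_linear_scaleR_right eta_deriv[OF x t], of z]]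
    unfolding mode_def mode_field_def hor_field_def by (simp only: scaleR_scaleR)
  then show ?thesis using a b by (intro has_vector_derivative_diff) auto
qed

lemma cone_deriv: "((\<lambda>t. cone (a t) (b t)) has_real_derivative cone_rate (a t) (b t)) (at t within J)"
  unfolding cone_def power2_norm_eq_inner
  by (rule DERIV_cong[OF DERIV_diff[OF has_real_derivative_inner[OF mode_diff_deriv mode_diff_deriv refl]
        has_real_derivative_inner[OF mode_diff_deriv mode_diff_deriv refl]]])
     (simp add: cone_rate_def inner_commute)

end

section \<open>The flow and the sets of captured trajectories\<close>

definition flow :: "state \<Rightarrow> real \<Rightarrow> state" where
  "flow x0 = (SOME x. solution_on state_space (\<lambda>_. f) {0..} x \<and> x 0 = x0)"

lemma flow:
  assumes "x0 \<in> state_space"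
  shows flow_solution: "solution_on state_space (\<lambda>_. f) {0..} (flow x0)" and flow_0: "flow x0 0 = x0"
proof -
  obtain x where "solution_on state_space (\<lambda>_. f) {0..} x \<and> x 0 = x0"
    using solution_exists[OF assms] by blast
  then have "\<exists>x. solution_on state_space (\<lambda>_. f) {0..} x \<and> x 0 = x0"
    by (rule exI[where x = x])
  then have "solution_on state_space (\<lambda>_. f) {0..} (flow x0) \<and> flow x0 0 = x0"
    unfolding flow_def by (rule someI_ex)
  then show "solution_on state_space (\<lambda>_. f) {0..} (flow x0)" "flow x0 0 = x0" by auto
qed

lemma flow_eq:
  assumes "solution_on state_space (\<lambda>_. f) {0..} x" "t \<ge> 0"
  shows "x t = flow (x 0) t"
proof -
  have 0: "x 0 \<in> state_space" using assms(1) by (simp add: solution_on_def)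
  show ?thesis by (rule solution_unique[OF assms(1) flow_solution[OF 0] _ assms(2)]) (simp add: flow_0[OF 0])
qed

text \<open>The backward flow is Lipschitz on bounded sets.\<close>

lemma flat_if_flat_later:
  fixes q :: "state \<Rightarrow> (real^3) \<times> (real^3)"
  assumes S: "\<And>a. a \<in> S \<Longrightarrow> a \<in> state_space \<and> norm a \<le> \<rho>"
    and n: "n \<ge> 0" and neg: "negligible (range q)"
    and le: "\<And>a b. a \<in> S \<Longrightarrow> b \<in> S \<Longrightarrow> dist (flow a n) (flow b n) \<le> C * dist (q (flow a n)) (q (flow b n))"
  shows "flat S"
proof -
  obtain L where L: "flow_Lipschitz \<rho> L" using flow_Lipschitz_exists by blast
  have sub: "{0..n} \<subseteq> {0..}" by simp
  have "dist a b \<le> (exp (L * n) * C) * dist (q (flow a n)) (q (flow b n))" if "a \<in> S" "b \<in> S" for a b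
  proof -
    note sa = solution_on_subset[OF flow_solution sub] and f0 = flow_0
    have "dist (flow a 0) (flow b 0) \<le> exp (L * n) * dist (flow a n) (flow b n)"
      by (rule flow_LipschitzD(2)[OF L sa sa _ _ n]) (use S that f0 in auto)
    also have "\<dots> \<le> exp (L * n) * (C * dist (q (flow a n)) (q (flow b n)))"
      using le[OF that] by (intro mult_left_mono) auto
    finally show ?thesis using S that f0 by (simp add: mult.assoc)
  qed
  moreover have "negligible ((\<lambda>a. q (flow a n)) ` S)"
    by (rule negligible_subset[OF neg]) auto
  ultimately show ?thesis
    unfolding flat_def by (intro exI[of _ "\<lambda>a. q (flow a n)"] exI[of _ "exp (L * n) * C"]) auto
qed

text \<open>Captured states are described by five numbers placed in six slots; the slot left at zero
  puts them into this hyperplane.\<close>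

lemma negligible_hyperplane_3: "negligible {u :: (real^3) \<times> (real^3). snd u $ 3 = 0}"
proof -
  have "negligible {u :: (real^3) \<times> (real^3). (0, axis 3 1) \<bullet> u = 0}"
    by (rule negligible_hyperplane) (simp add: prod_eq_iff axis_eq_0_iff)
  then show ?thesis by (simp add: inner_prod_def inner_axis')
qed

lemma component_le_dist:
  fixes u v :: "(real^3) \<times> (real^3)"
  shows "\<bar>fst u $ i - fst v $ i\<bar> \<le> dist u v" "\<bar>snd u $ i - snd v $ i\<bar> \<le> dist u v" "norm (fst u - fst v) \<le> dist u v"
proof -
  have 1: "norm (fst u - fst v) \<le> dist u v" "norm (snd u - snd v) \<le> dist u v"
    using norm_fst_le[of "fst (u - v)" "snd (u - v)"] norm_snd_le[of "snd (u - v)" "fst (u - v)"]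
    by (simp_all add: dist_norm minus_prod_def)
  show "norm (fst u - fst v) \<le> dist u v" by (rule 1)
  show "\<bar>fst u $ i - fst v $ i\<bar> \<le> dist u v"
    using component_le_norm_cart[of "fst u - fst v" i] 1 by simp
  show "\<bar>snd u $ i - snd v $ i\<bar> \<le> dist u v"
    using component_le_norm_cart[of "snd u - snd v" i] 1 by simp
qed

lemma fst_diff: "fst a - fst b = (hor a - hor b) + (vert a - vert b) *\<^sub>R eta a + vert b *\<^sub>R (eta a - eta b)"
  by (simp add: hor_def algebra_simps)

lemma norm_fst_diff_le:
  assumes "a \<in> state_space"
  shows "norm (fst a - fst b) \<le> norm (hor a - hor b) + \<bar>vert a - vert b\<bar> + \<bar>vert b\<bar> * norm (eta a - eta b)"
  using norm_triangle_ineq[of "(hor a - hor b) + (vert a - vert b) *\<^sub>R eta a" "vert b *\<^sub>R (eta a - eta b)"]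
    norm_triangle_ineq[of "hor a - hor b" "(vert a - vert b) *\<^sub>R eta a"] norm_eta[OF assms]
  unfolding fst_diff[of a b] by simp

lemma vert_flow_bound:
  assumes "x0 \<in> state_space" "t \<ge> 0"
  shows "\<bar>vert (flow x0 t)\<bar> \<le> norm x0 + B"
proof -
  have sol: "solution_on state_space (\<lambda>_. f) {0..t} (flow x0)"
    by (rule solution_on_subset[OF flow_solution[OF assms(1)]]) auto
  have "\<bar>vert (flow x0 t)\<bar> \<le> norm (fst (flow x0 t))"
    using Cauchy_Schwarz_ineq2[of "fst (flow x0 t)" "eta (flow x0 t)"] norm_eta[OF sol_in[OF sol, of t]] assms(2)
    by (simp add: vert_def)
  also have "\<dots> \<le> norm (fst x0) + B"
    using fst_bound[OF sol, of t] assms by (simp add: flow_0)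
  also have "\<dots> \<le> norm x0 + B" using norm_fst_le[of "fst x0" "snd x0"] by simp
  finally show ?thesis .
qed

text \<open>Parametrised by the time \<open>n\<close> of final entry and by a norm bound
  \<open>\<rho>\<close>, so that the constants are uniform on each set while natural parameters
  exhaust all captured trajectories.\<close>

definition down_set :: "real \<Rightarrow> real \<Rightarrow> real \<Rightarrow> state set" where
  "down_set \<epsilon> n \<rho> = {x0 \<in> state_space. norm x0 \<le> \<rho> \<and> (\<forall>t\<ge>n. near (- 1) \<epsilon> (flow x0 t))}"

definition up_set :: "real \<Rightarrow> real \<Rightarrow> real \<Rightarrow> state set" where
  "up_set \<epsilon> n \<rho> = {x0 \<in> state_space. norm x0 \<le> \<rho> \<and>
     (\<forall>t\<ge>n. near 1 \<epsilon> (flow x0 t) \<and> norm (mag (flow x0 t) - mag_ref (- 1)) \<le> \<epsilon>)}"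

text \<open>Two trajectories that stay near the lower pole have \<open>cone \<le> 0\<close>, since
  \<open>cone\<close> would otherwise grow although it is bounded. At time \<open>n\<close> the
  state is then fixed, in a Lipschitz way, by two coordinates of the stable mode,
  \<open>vert\<close>, and two components of \<open>mag\<close>. Two numbers for one heading angle
  are redundant, but five in all are still fewer than six.\<close>

lemma flat_down_set: "\<exists>\<epsilon>>0. \<forall>n\<ge>0. \<forall>\<rho>. flat (down_set \<epsilon> n \<rho>)"
proof -
  obtain C \<kappa> \<epsilon> where pos: "C > 0" "\<kappa> > 0" "\<epsilon> > 0" "\<epsilon> \<le> 1 / 2"
    and cone: "\<forall>a b. near (- 1) \<epsilon> a \<longrightarrow> near (- 1) \<epsilon> b \<longrightarrow> cone_rate a b \<ge> \<kappa> * cone a b \<and>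
      (cone a b \<le> 0 \<longrightarrow> norm (eta a - eta b) + norm (hor a - hor b)
         \<le> C * (\<bar>(mode am a - mode am b) $ 1\<bar> + \<bar>(mode am a - mode am b) $ 2\<bar>))"
    using bottom_cone by blast
  obtain Cs where Cs: "Cs > 0" "\<And>x x'. x \<in> state_space \<Longrightarrow> x' \<in> state_space \<Longrightarrow>
      norm (snd x - snd x') \<le> Cs * (norm (eta x - eta x') + norm (mag x - mag x'))"
    using norm_snd_diff_le by blast
  define q where "q z = (vector [mode am z $ 1, mode am z $ 2, vert z] :: real^3, vector [mag z $ 1, mag z $ 2, 0] :: real^3)" for z
  have neg: "negligible (range q)"
    by (rule negligible_subset[OF negligible_hyperplane_3]) (auto simp: q_def)
  have "flat (down_set \<epsilon> n \<rho>)" if n: "n \<ge> 0" for n \<rho>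
  proof (rule flat_if_flat_later[OF _ n neg])
    define V where "V = \<bar>\<rho>\<bar> + B"
    have V: "V \<ge> 0" using B by (simp add: V_def)
    fix a0 b0 assume a0: "a0 \<in> down_set \<epsilon> n \<rho>" and b0: "b0 \<in> down_set \<epsilon> n \<rho>"
    then have ss: "a0 \<in> state_space" "b0 \<in> state_space" and nr: "norm b0 \<le> \<rho>"
      and near: "\<And>t. t \<ge> n \<Longrightarrow> near (- 1) \<epsilon> (flow a0 t)" "\<And>t. t \<ge> n \<Longrightarrow> near (- 1) \<epsilon> (flow b0 t)"
      by (auto simp: down_set_def)
    have "cone (flow a0 n) (flow b0 n) \<le> 0"
    proof (rule bounded_growth_nonpos[where E = "\<lambda>t. cone (flow a0 t) (flow b0 t)", OF _ n _ pos(2)])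
      fix t assume t: "t \<ge> n"
      then have t0: "t \<in> {0..}" using n by simp
      show "((\<lambda>t. cone (flow a0 t) (flow b0 t)) has_real_derivative cone_rate (flow a0 t) (flow b0 t)) (at t within {0..})"
        by (rule cone_deriv[OF flow_solution[OF ss(1)] flow_solution[OF ss(2)] t0])
      show "cone_rate (flow a0 t) (flow b0 t) \<ge> \<kappa> * cone (flow a0 t) (flow b0 t)"
        using cone near t by blast
      let ?a = "flow a0 t" and ?b = "flow b0 t"
      have "norm (mode ap x) \<le> 1 + ap" if "near (- 1) \<epsilon> x" for x
      proof -
        have "norm (mode ap x) \<le> norm (hor x) + norm (ap *\<^sub>R eta x)" unfolding mode_def by (rule norm_triangle_ineq)
        also have "\<dots> \<le> 1 + ap" using that pos(4) ap_am norm_eta[of x] by (simp add: near_def)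
        finally show ?thesis .
      qed
      then have "norm (mode ap ?a - mode ap ?b) \<le> (1 + ap) + (1 + ap)"
        using near[OF t] by (intro order_trans[OF norm_triangle_ineq4] add_mono) auto
      then have "(norm (mode ap ?a - mode ap ?b))\<^sup>2 \<le> ((1 + ap) + (1 + ap))\<^sup>2" by (intro power_mono) auto
      then show "cone ?a ?b \<le> ((1 + ap) + (1 + ap))\<^sup>2" 
        unfolding cone_def using zero_le_power2[of "norm (mode am ?a - mode am ?b)"] by linarith
    qed
    moreover define a b where "a = flow a0 n" and "b = flow b0 n"
    ultimately have hp: "norm (eta a - eta b) + norm (hor a - hor b)
         \<le> C * (\<bar>(mode am a - mode am b) $ 1\<bar> + \<bar>(mode am a - mode am b) $ 2\<bar>)"
      using cone[THEN spec, of a, THEN spec, of b] near[of n] by (simp add: a_def b_def)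
    have na: "near (- 1) \<epsilon> a" and nb: "near (- 1) \<epsilon> b" using near[of n] by (auto simp: a_def b_def)
    then have ab: "a \<in> state_space" "b \<in> state_space" by (auto simp: near_def)
    define D where "D = dist (q a) (q b)"
    have D: "\<bar>(mode am a - mode am b) $ 1\<bar> \<le> D" "\<bar>(mode am a - mode am b) $ 2\<bar> \<le> D" "\<bar>vert a - vert b\<bar> \<le> D"
      "\<bar>(mag a - mag b) $ 1\<bar> \<le> D" "\<bar>(mag a - mag b) $ 2\<bar> \<le> D"
      using component_le_dist(1)[of "q a" 1 "q b"] component_le_dist(1)[of "q a" 2 "q b"] component_le_dist(1)[of "q a" 3 "q b"]
        component_le_dist(2)[of "q a" 1 "q b"] component_le_dist(2)[of "q a" 2 "q b"]
      by (simp_all add: q_def D_def)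
    have D0: "D \<ge> 0" by (simp add: D_def)
    have "C * (\<bar>(mode am a - mode am b) $ 1\<bar> + \<bar>(mode am a - mode am b) $ 2\<bar>) \<le> C * (D + D)"
      using pos D by (intro mult_left_mono add_mono) auto
    then have hp: "norm (eta a - eta b) + norm (hor a - hor b) \<le> 2 * C * D" using hp by simp
    then have h: "norm (eta a - eta b) \<le> 2 * C * D" using norm_ge_zero[of "hor a - hor b"] by linarith
    have vb: "\<bar>vert b\<bar> \<le> V"
      using vert_flow_bound[OF ss(2) n] nr by (simp add: b_def V_def)
    have "\<bar>vert b\<bar> * norm (eta a - eta b) \<le> V * (2 * C * D)"
      using vb h V by (intro mult_mono) auto
    then have w: "norm (fst a - fst b) \<le> 2 * C * D + D + V * (2 * C * D)"
      using norm_fst_diff_le[OF ab(1), of b] hp D norm_ge_zero[of "eta a - eta b"] by linarith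
    define d where "d = mag a - mag b"
    have "d \<bullet> eta a + mag b \<bullet> (eta a - eta b) = 0"
      using mag_eta[OF ab(1)] mag_eta[OF ab(2)] by (simp add: d_def inner_diff_left inner_diff_right)
    \<comment> \<open>The vertical component of the difference of \<open>mag\<close> follows from
      the constant \<open>mag \<bullet> eta\<close>; the last summand is at most half of
      \<open>norm d\<close> and is absorbed.\<close>
    then have d3: "d $ 3 = mag b \<bullet> (eta a - eta b) + d \<bullet> (eta a - (- 1) *\<^sub>R e3)"
      by (simp add: inner_add_right inner_e3)
    have "\<bar>mag b \<bullet> (eta a - eta b)\<bar> \<le> norm m * (2 * C * D)"
      using norm_mag[OF ab(2)] h by (intro order_trans[OF Cauchy_Schwarz_ineq2] mult_mono) auto
    moreover have "\<bar>d \<bullet> (eta a - (- 1) *\<^sub>R e3)\<bar> \<le> norm d * (1 / 2)"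
      using na pos(4) by (intro order_trans[OF Cauchy_Schwarz_ineq2] mult_left_mono) (auto simp: near_def)
    moreover have "norm d \<le> \<bar>d $ 1\<bar> + \<bar>d $ 2\<bar> + \<bar>d $ 3\<bar>"
      using norm_le_l1_cart[of d] by (simp add: sum_3)
    moreover have "\<bar>d $ 1\<bar> \<le> D" "\<bar>d $ 2\<bar> \<le> D" using D by (simp_all add: d_def)
    ultimately have nd: "norm d \<le> 4 * D + 2 * (norm m * (2 * C * D))" using d3 by linarith
    have "norm (snd a - snd b) \<le> Cs * (norm (eta a - eta b) + norm (mag a - mag b))" by (rule Cs(2)[OF ab])
    also have "\<dots> \<le> Cs * (2 * C * D + (4 * D + 2 * (norm m * (2 * C * D))))"
      using Cs nd h by (intro mult_left_mono add_mono) (auto simp: d_def)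
    finally have s: "norm (snd a - snd b) \<le> Cs * (2 * C * D + (4 * D + 2 * (norm m * (2 * C * D))))" .
    have "dist a b \<le> norm (fst a - fst b) + norm (snd a - snd b)"
      using norm_Pair_le[of "fst a - fst b" "snd a - snd b"] by (simp add: dist_norm minus_prod_def)
    also have "\<dots> \<le> (2 * C * D + D + V * (2 * C * D)) + Cs * (2 * C * D + (4 * D + 2 * (norm m * (2 * C * D))))"
      using w s by (rule add_mono)
    also have "\<dots> = (2 * C + 1 + V * (2 * C) + Cs * (2 * C + (4 + 2 * (norm m * (2 * C))))) * D"
      by (simp add: algebra_simps)
    finally show "dist (flow a0 n) (flow b0 n) \<le> (2 * C + 1 + V * (2 * C) + Cs * (2 * C + (4 + 2 * (norm m * (2 * C))))) * dist (q (flow a0 n)) (q (flow b0 n))"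
      by (simp add: a_def b_def D_def)
  qed (auto simp: down_set_def)
  then show ?thesis using pos by blast
qed

lemma sn_bound: "x \<in> state_space \<Longrightarrow> \<bar>sn x\<bar> \<le> norm m * norm m"
  using inner_cross_le[of m "mag x" "eta x"] norm_mag[of x] norm_eta[of x] by (simp add: sn_def)

text \<open>Velocity and tilt are five numbers. The sixth, the heading, would separate exponentially
  unless the difference of \<open>sn\<close> is dominated by \<open>lyap\<close>, that is, by
  differences of \<open>eta\<close> and \<open>hor\<close>, which the five numbers control.\<close>

lemma flat_up_set: "\<exists>\<epsilon>>0. \<forall>n\<ge>0. \<forall>\<rho>. flat (up_set \<epsilon> n \<rho>)"
proof -
  obtain C A \<kappa> \<epsilon>1 where pos: "C > 0" "A > 0" "\<kappa> > 0" "\<epsilon>1 > 0" and rates: "\<forall>\<tau> a b. \<tau>\<^sup>2 = 1 \<longrightarrow> near 1 \<epsilon>1 a \<longrightarrow> near 1 \<epsilon>1 b \<longrightarrow>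
     norm (mag a - mag_ref \<tau>) \<le> \<epsilon>1 \<longrightarrow> norm (mag b - mag_ref \<tau>) \<le> \<epsilon>1 \<longrightarrow>
     norm (mag a - mag b) \<le> C * (norm (eta a - eta b) + \<bar>sn a - sn b\<bar>) \<and>
     (\<tau> = - 1 \<longrightarrow> 2 * (sn a - sn b) * (sn_field a - sn_field b) - A * lyap_rate a b
         \<ge> \<kappa> * ((sn a - sn b)\<^sup>2 - A * lyap a b)) \<and>
     (\<tau> = 1 \<longrightarrow> A * lyap_rate a b + 2 * (vert a - vert b) * (g * (eta a - eta b) $ 3 - k1v * (vert a - vert b))
         + 2 * (sn a - sn b) * (sn_field a - sn_field b)
         \<le> - \<kappa> * (A * lyap a b + (vert a - vert b)\<^sup>2 + (sn a - sn b)\<^sup>2))"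
    using heading_rates by blast
  obtain Cs where Cs: "Cs > 0" "\<And>x x'. x \<in> state_space \<Longrightarrow> x' \<in> state_space \<Longrightarrow>
      norm (snd x - snd x') \<le> Cs * (norm (eta x - eta x') + norm (mag x - mag x'))"
    using norm_snd_diff_le by blast
  define \<epsilon> where "\<epsilon> = min \<epsilon>1 (1 / 2)"
  have \<epsilon>: "\<epsilon> > 0" "\<epsilon> \<le> \<epsilon>1" "\<epsilon> \<le> 1 / 2" using pos by (auto simp: \<epsilon>_def)
  have rate: "norm (mag a - mag b) \<le> C * (norm (eta a - eta b) + \<bar>sn a - sn b\<bar>)"
      "2 * (sn a - sn b) * (sn_field a - sn_field b) - A * lyap_rate a b \<ge> \<kappa> * ((sn a - sn b)\<^sup>2 - A * lyap a b)"
    if "near 1 \<epsilon> a" "near 1 \<epsilon> b" "norm (mag a - mag_ref (- 1)) \<le> \<epsilon>" "norm (mag b - mag_ref (- 1)) \<le> \<epsilon>" for a b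
    using rates[THEN spec, of "- 1", THEN spec, of a, THEN spec, of b]
      near_mono[OF that(1) \<epsilon>(2)] near_mono[OF that(2) \<epsilon>(2)] order_trans[OF that(3) \<epsilon>(2)] order_trans[OF that(4) \<epsilon>(2)]
    by simp_all
  define q where "q z = (fst z, vector [eta z $ 1, eta z $ 2, 0] :: real^3)" for z :: state
  have neg: "negligible (range q)"
    by (rule negligible_subset[OF negligible_hyperplane_3]) (auto simp: q_def)
  \<comment> \<open>Slope of the cone: the squared difference of \<open>sn\<close> is at most
    \<open>A * lyap\<close>, hence at most the square of \<open>c\<close> times
    \<open>sqdist\<close>.\<close>
  define c where "c = sqrt (A * (g + k1r + e0))"
  have c: "c \<ge> 0" using pos g k1r e0 by (simp add: c_def)
  have "flat (up_set \<epsilon> n \<rho>)" if n: "n \<ge> 0" for n \<rho>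
  proof (rule flat_if_flat_later[OF _ n neg])
    define V where "V = \<bar>\<rho>\<bar> + B"
    have V: "V \<ge> 0" using B by (simp add: V_def)
    fix a0 b0 assume a0: "a0 \<in> up_set \<epsilon> n \<rho>" and b0: "b0 \<in> up_set \<epsilon> n \<rho>"
    then have ss: "a0 \<in> state_space" "b0 \<in> state_space" and nr: "norm b0 \<le> \<rho>"
      and near: "\<And>t. t \<ge> n \<Longrightarrow> near 1 \<epsilon> (flow a0 t)" "\<And>t. t \<ge> n \<Longrightarrow> near 1 \<epsilon> (flow b0 t)"
        "\<And>t. t \<ge> n \<Longrightarrow> norm (mag (flow a0 t) - mag_ref (- 1)) \<le> \<epsilon>"
        "\<And>t. t \<ge> n \<Longrightarrow> norm (mag (flow b0 t) - mag_ref (- 1)) \<le> \<epsilon>"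
      by (auto simp: up_set_def)
    have cone: "(sn (flow a0 n) - sn (flow b0 n))\<^sup>2 - A * lyap (flow a0 n) (flow b0 n) \<le> 0"
    proof (rule bounded_growth_nonpos[where E = "\<lambda>t. (sn (flow a0 t) - sn (flow b0 t))\<^sup>2 - A * lyap (flow a0 t) (flow b0 t)", OF _ n _ pos(3)])
      fix t assume t: "t \<ge> n"
      then have t0: "t \<in> {0..}" using n by simp
      let ?a = "flow a0 t" and ?b = "flow b0 t"
      show "((\<lambda>t. (sn (flow a0 t) - sn (flow b0 t))\<^sup>2 - A * lyap (flow a0 t) (flow b0 t)) has_real_derivative
          2 * (sn ?a - sn ?b) * (sn_field ?a - sn_field ?b) - A * lyap_rate ?a ?b) (at t within {0..})"
        by (intro DERIV_diff DERIV_cmult sn_diff_square_deriv[OF flow_solution[OF ss(1)] flow_solution[OF ss(2)] t0]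
              lyap_deriv[OF flow_solution[OF ss(1)] flow_solution[OF ss(2)] t0])
      show "2 * (sn ?a - sn ?b) * (sn_field ?a - sn_field ?b) - A * lyap_rate ?a ?b \<ge> \<kappa> * ((sn ?a - sn ?b)\<^sup>2 - A * lyap ?a ?b)"
        by (rule rate(2)[OF near(1)[OF t] near(2)[OF t] near(3)[OF t] near(4)[OF t]])
      have "?a \<in> state_space" "?b \<in> state_space" using near[OF t] by (auto simp: near_def)
      then have "\<bar>sn ?a - sn ?b\<bar> \<le> 2 * (norm m * norm m)" using sn_bound[of ?a] sn_bound[of ?b] by linarith
      then have "\<bar>sn ?a - sn ?b\<bar>\<^sup>2 \<le> (2 * (norm m * norm m))\<^sup>2" by (intro power_mono) auto
      moreover have "0 \<le> A * lyap ?a ?b" using pos lyap_nonneg by simp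
      ultimately show "(sn ?a - sn ?b)\<^sup>2 - A * lyap ?a ?b \<le> (2 * (norm m * norm m))\<^sup>2" by simp
    qed
    define a b where "a = flow a0 n" and "b = flow b0 n"
    have na: "near 1 \<epsilon> a" and nb: "near 1 \<epsilon> b" using near(1,2)[of n] by (auto simp: a_def b_def)
    then have ab: "a \<in> state_space" "b \<in> state_space" by (auto simp: near_def)
    define h where "h = norm (eta a - eta b)"
    define p where "p = norm (hor a - hor b)"
    define s where "s = \<bar>sn a - sn b\<bar>"
    define D where "D = dist (q a) (q b)"
    have nn: "h \<ge> 0" "p \<ge> 0" "s \<ge> 0" "D \<ge> 0" by (auto simp: h_def p_def s_def D_def)
    have D: "norm (fst a - fst b) \<le> D" "\<bar>(eta a - eta b) $ 1\<bar> \<le> D" "\<bar>(eta a - eta b) $ 2\<bar> \<le> D"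
      using component_le_dist(3)[of "q a" "q b"] component_le_dist(2)[of "q a" 1 "q b"] component_le_dist(2)[of "q a" 2 "q b"]
      by (simp_all add: q_def D_def)
    have h: "h \<le> 4 * D"
    proof -
      have "\<bar>(eta a - eta b) $ 3\<bar> \<le> \<epsilon> * h" unfolding h_def by (rule eta_diff_3[OF na nb]) simp
      also have "\<dots> \<le> 1 / 2 * h" using \<epsilon> nn by (intro mult_right_mono) auto
      finally have "\<bar>(eta a - eta b) $ 3\<bar> \<le> 1 / 2 * h" .
      moreover have "h \<le> \<bar>(eta a - eta b) $ 1\<bar> + \<bar>(eta a - eta b) $ 2\<bar> + \<bar>(eta a - eta b) $ 3\<bar>"
        using norm_le_l1_cart[of "eta a - eta b"] by (simp add: h_def sum_3)
      ultimately show ?thesis using D by linarith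
    qed
    have vb: "\<bar>vert b\<bar> \<le> V" using vert_flow_bound[OF ss(2) n] nr by (simp add: b_def V_def)
    have nfb: "\<bar>fst b \<bullet> (eta a - eta b)\<bar> \<le> V * h"
    proof -
      have sol: "solution_on state_space (\<lambda>_. f) {0..n} (flow b0)"
        by (rule solution_on_subset[OF flow_solution[OF ss(2)]]) auto
      have "norm (fst b) \<le> norm (fst b0) + B"
        using fst_bound[OF sol, of n] n ss by (simp add: flow_0 b_def)
      also have "\<dots> \<le> V" using norm_fst_le[of "fst b0" "snd b0"] nr by (simp add: V_def)
      finally show ?thesis unfolding h_def by (intro order_trans[OF Cauchy_Schwarz_ineq2] mult_right_mono) auto
    qed
    have vd: "\<bar>vert a - vert b\<bar> \<le> D + V * h"
    proof -
      have "vert a - vert b = (fst a - fst b) \<bullet> eta a + fst b \<bullet> (eta a - eta b)"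
        by (simp add: vert_def inner_diff_left inner_diff_right)
      moreover have "\<bar>(fst a - fst b) \<bullet> eta a\<bar> \<le> D"
        using Cauchy_Schwarz_ineq2[of "fst a - fst b" "eta a"] norm_eta[OF ab(1)] D by simp
      ultimately show ?thesis using nfb by linarith
    qed
    have p: "p \<le> 2 * D + 2 * (V * h)"
    proof -
      have "hor a - hor b = (fst a - fst b) - ((vert a - vert b) *\<^sub>R eta a + vert b *\<^sub>R (eta a - eta b))"
        unfolding fst_diff[of a b] by simp
      then have "p \<le> norm (fst a - fst b) + norm ((vert a - vert b) *\<^sub>R eta a + vert b *\<^sub>R (eta a - eta b))"
        unfolding p_def by (simp only: norm_triangle_ineq4)
      also have "\<dots> \<le> norm (fst a - fst b) + (norm ((vert a - vert b) *\<^sub>R eta a) + norm (vert b *\<^sub>R (eta a - eta b)))"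
        by (intro add_left_mono norm_triangle_ineq)
      also have "\<dots> \<le> D + ((D + V * h) + V * h)"
        using D vd vb norm_eta[OF ab(1)] by (intro add_mono) (auto simp: h_def intro!: mult_right_mono)
      finally show ?thesis by simp
    qed
    have s: "s \<le> c * (p + h)"
    proof (rule power2_le_imp_le)
      have "s\<^sup>2 \<le> A * lyap a b" using cone by (simp add: s_def a_def b_def)
      also have "\<dots> \<le> A * ((g + k1r + e0) * sqdist a b)" using pos lyap_bounds(2) by (intro mult_left_mono) auto
      also have "\<dots> = c\<^sup>2 * (h\<^sup>2 + p\<^sup>2)" using pos g k1r e0 by (simp add: c_def sqdist_def h_def p_def)
      also have "\<dots> \<le> c\<^sup>2 * (p + h)\<^sup>2" using nn by (intro mult_left_mono) (auto simp: power2_sum)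
      finally show "s\<^sup>2 \<le> (c * (p + h))\<^sup>2" by (simp add: power_mult_distrib)
    qed (use c nn in simp)
    define H where "H = 4 * D"
    define P where "P = 2 * D + 2 * (V * H)"
    have hH: "h \<le> H" using h by (simp add: H_def)
    have "V * h \<le> V * H" using V hH by (rule mult_left_mono[rotated])
    then have pP: "p \<le> P" using p by (simp add: P_def)
    have "c * (p + h) \<le> c * (P + H)" using c pP hH by (intro mult_left_mono) auto
    then have sS: "s \<le> c * (P + H)" using s by simp
    have nd: "norm (mag a - mag b) \<le> C * (h + s)"
      using rate(1)[OF na nb] near(3,4)[of n] by (simp add: a_def b_def h_def s_def)
    also have "\<dots> \<le> C * (H + c * (P + H))" using pos hH sS by (intro mult_left_mono) auto
    finally have nd: "norm (mag a - mag b) \<le> C * (H + c * (P + H))" .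
    have "norm (snd a - snd b) \<le> Cs * (h + norm (mag a - mag b))" unfolding h_def by (rule Cs(2)[OF ab])
    also have "\<dots> \<le> Cs * (H + C * (H + c * (P + H)))" using Cs nd hH by (intro mult_left_mono add_mono) auto
    finally have sd: "norm (snd a - snd b) \<le> Cs * (H + C * (H + c * (P + H)))" .
    have "dist a b \<le> norm (fst a - fst b) + norm (snd a - snd b)"
      using norm_Pair_le[of "fst a - fst b" "snd a - snd b"] by (simp add: dist_norm minus_prod_def)
    also have "\<dots> \<le> D + Cs * (H + C * (H + c * (P + H)))"
      using D sd by (intro add_mono) auto
    also have "\<dots> = (1 + Cs * (4 + C * (4 + c * (2 + 2 * (V * 4) + 4)))) * D"
      by (simp add: H_def P_def algebra_simps)
    finally show "dist (flow a0 n) (flow b0 n) \<le> (1 + Cs * (4 + C * (4 + c * (2 + 2 * (V * 4) + 4)))) * dist (q (flow a0 n)) (q (flow b0 n))"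
      by (simp add: a_def b_def D_def)
  qed (auto simp: up_set_def)
  then show ?thesis using \<epsilon> by blast
qed

subsection \<open>Equilibria\<close>

text \<open>The squared distance to \<open>mag_ref (- 1)\<close> involves only the fixed norm of
  \<open>mag\<close>, \<open>cn\<close>, and the inner products of \<open>mag\<close> with
  \<open>e3\<close> and of \<open>m\<close> with \<open>eta\<close>. The inner product with
  \<open>e3\<close> converges because it differs from the constant \<open>mag \<bullet> eta\<close>
  by the vanishing \<open>h\<close>.\<close>

lemma mag_tendsto_ref:
  assumes sol: "solution_on state_space (\<lambda>_. f) {0..} x"
    and up: "((\<lambda>t. eta (x t) $ 3) \<longlongrightarrow> 1) at_top" and cn: "((\<lambda>t. cn (x t)) \<longlongrightarrow> - M) at_top"
  shows "((\<lambda>t. mag (x t)) \<longlongrightarrow> mag_ref (- 1)) at_top"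
proof -
  define h where "h t = mag (x t) \<bullet> (eta (x t) - e3)" for t
  have h: "(h \<longlongrightarrow> 0) at_top"
  proof (rule Lim_null_comparison)
    have "((\<lambda>t. eta (x t) - e3) \<longlongrightarrow> 0) at_top" using eta_tendsto_e3[OF sol up] LIM_zero by blast
    then show "((\<lambda>t. norm m * norm (eta (x t) - e3)) \<longlongrightarrow> 0) at_top"
      by (intro tendsto_mult_right_zero) (simp add: tendsto_norm_zero)
    show "\<forall>\<^sub>F t in at_top. norm (h t) \<le> norm m * norm (eta (x t) - e3)"
      using eventually_ge_at_top[of 0]
    proof eventually_elim
      case (elim t)
      then show ?case
        using Cauchy_Schwarz_ineq2[of "mag (x t)" "eta (x t) - e3"] norm_mag[OF in_space[OF sol elim]] by (simp add: h_def)
    qed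
  qed
  let ?F = "\<lambda>t. 2 * (m \<bullet> m) - 4 * m $ 3 * (m $ 3 - h t) + 2 * (cn (x t) + m $ 3 * (m \<bullet> eta (x t)))"
  have eq: "(norm (mag (x t) - mag_ref (- 1)))\<^sup>2 = ?F t" if "t \<ge> 0" for t
  proof -
    note ss = in_space[OF sol that]
    have ref: "mag_ref (- 1) = 2 *\<^sub>R (m $ 3 *\<^sub>R e3) - m" by (simp add: mag_ref_def vec_eq_iff algebra_simps)
    have "mag (x t) \<bullet> mag_ref (- 1) = 2 * (m $ 3 * (mag (x t) \<bullet> e3)) - m \<bullet> mag (x t)"
      by (simp add: ref inner_diff_right inner_commute)
    moreover have "mag (x t) \<bullet> e3 = m $ 3 - h t"
      using mag_eta[OF ss] by (simp add: h_def inner_diff_right)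
    moreover have "m \<bullet> mag (x t) = cn (x t) + m $ 3 * (m \<bullet> eta (x t))" by (simp add: cn_def)
    moreover have "mag_ref (- 1) \<bullet> mag_ref (- 1) = m \<bullet> m"
      using norm_mag_ref[of "- 1"] by (simp add: norm_eq_sqrt_inner)
    moreover have "(norm (mag (x t) - mag_ref (- 1)))\<^sup>2 = mag (x t) \<bullet> mag (x t) - 2 * (mag (x t) \<bullet> mag_ref (- 1)) + mag_ref (- 1) \<bullet> mag_ref (- 1)"
      by (simp only: power2_norm_eq_inner inner_diff_left inner_diff_right inner_commute[of "mag_ref (- 1)" "mag (x t)"])
    ultimately show ?thesis using mag_mag[OF ss] by (simp add: algebra_simps)
  qed
  have "((\<lambda>t. sqrt (?F t)) \<longlongrightarrow> sqrt (2 * (m \<bullet> m) - 4 * m $ 3 * (m $ 3 - 0) + 2 * (- M + m $ 3 * m $ 3))) at_top"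
    by (intro tendsto_intros h cn m_eta_tendsto[OF sol up])
  then have lim: "((\<lambda>t. sqrt (?F t)) \<longlongrightarrow> 0) at_top" by (simp add: M_eq power2_eq_square)
  have "((\<lambda>t. mag (x t) - mag_ref (- 1)) \<longlongrightarrow> 0) at_top"
  proof (rule Lim_null_comparison[OF _ lim])
    show "\<forall>\<^sub>F t in at_top. norm (mag (x t) - mag_ref (- 1)) \<le> sqrt (?F t)"
      using eventually_ge_at_top[of 0]
      by eventually_elim (simp only: eq[symmetric] real_sqrt_abs abs_norm_cancel order_refl)
  qed
  then show ?thesis using LIM_zero_cancel[of "\<lambda>t. mag (x t)" "mag_ref (- 1)" at_top] by simp
qed

text \<open>A trajectory that misses \<open>origin\<close> has \<open>eta $ 3\<close> tending to
  \<open>- 1\<close>, or it has \<open>eta $ 3\<close> tending to \<open>1\<close> and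
  \<open>cn\<close> tending to \<open>- M\<close>. From some natural time on it is near that pole or
  that heading, so its initial state lies in a \<open>down_set\<close> or an
  \<open>up_set\<close>.\<close>

lemma exceptional_set_cover:
  "\<exists>P :: nat \<Rightarrow> state set. (\<forall>n. flat (P n)) \<and> {x0 \<in> state_space. \<not> attracted state_space f origin x0} \<subseteq> (\<Union>n. P n)"
proof -
  obtain \<epsilon>1 where e1: "\<epsilon>1 > 0" "\<forall>n\<ge>0. \<forall>\<rho>. flat (down_set \<epsilon>1 n \<rho>)" using flat_down_set by blast
  obtain \<epsilon>2 where e2: "\<epsilon>2 > 0" "\<forall>n\<ge>0. \<forall>\<rho>. flat (up_set \<epsilon>2 n \<rho>)" using flat_up_set by blast
  \<comment> \<open>Both families and their two natural parameters are enumerated by a single index;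
    the outer component selects the family.\<close>
  define P where "P j = (let (i, l) = prod_decode j; (n, k) = prod_decode l in
      if i = 0 then down_set \<epsilon>1 (real n) (real k) else up_set \<epsilon>2 (real n) (real k))" for j
  have Pd: "P (prod_encode (0, prod_encode (n, k))) = down_set \<epsilon>1 (real n) (real k)"
    and Pu: "P (prod_encode (1, prod_encode (n, k))) = up_set \<epsilon>2 (real n) (real k)" for n k
    by (simp_all add: P_def)
  have "flat (P j)" for j
    using e1(2) e2(2) by (simp add: P_def Let_def split_beta)
  moreover have "x0 \<in> (\<Union>n. P n)" if x0: "x0 \<in> state_space" and na: "\<not> attracted state_space f origin x0" for x0
  proof -
    obtain x where sol: "solution_on state_space (\<lambda>_. f) {0..} x" and x: "x 0 = x0" and nc: "\<not> (x \<longlongrightarrow> origin) at_top"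
      using na flow_solution[OF x0] flow_0[OF x0] unfolding attracted_def by blast
    have fl: "flow x0 t = x t" if "t \<ge> 0" for t using flow_eq[OF sol that] x by simp
    obtain k :: nat where k: "norm x0 \<le> real k" using real_arch_simple by blast
    have hor0: "\<forall>\<^sub>F t in at_top. norm (hor (x t)) < e" if "e > 0" for e
      using tendstoD[OF hor_tendsto_0[OF sol] that] by (simp add: dist_norm)
    consider "((\<lambda>t. eta (x t) $ 3) \<longlongrightarrow> - 1) at_top"
      | "((\<lambda>t. eta (x t) $ 3) \<longlongrightarrow> 1) at_top" "((\<lambda>t. cn (x t)) \<longlongrightarrow> - M) at_top"
      using eta_3_tendsto[OF sol] cn_tendsto[OF sol] solution_tendsto[OF sol] nc unfolding origin_def by blast
    then show ?thesis
    proof cases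
      case 1
      have "((\<lambda>t. eta (x t)) \<longlongrightarrow> (- 1) *\<^sub>R e3) at_top" by (rule eta_tendsto[OF sol 1]) simp
      from tendstoD[OF this e1(1)] have "\<forall>\<^sub>F t in at_top. norm (eta (x t) - (- 1) *\<^sub>R e3) < \<epsilon>1"
        by (simp only: dist_norm)
      then have "\<forall>\<^sub>F t in at_top. near (- 1) \<epsilon>1 (flow x0 t)"
        using hor0[OF e1(1)] eventually_ge_at_top[of 0]
        by eventually_elim (use fl in_space[OF sol] in \<open>auto simp: near_def\<close>)
      then obtain T where T: "\<And>t. t \<ge> T \<Longrightarrow> near (- 1) \<epsilon>1 (flow x0 t)"
        unfolding eventually_at_top_linorder by blast
      obtain n :: nat where "T \<le> real n" using real_arch_simple by blast
      then have "x0 \<in> down_set \<epsilon>1 (real n) (real k)" using x0 k T by (simp add: down_set_def)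
      then show ?thesis using Pd by blast
    next
      case 2
      have "\<forall>\<^sub>F t in at_top. norm (eta (x t) - e3) < \<epsilon>2"
        using tendstoD[OF eta_tendsto_e3[OF sol 2(1)] e2(1)] by (simp add: dist_norm)
      moreover have "\<forall>\<^sub>F t in at_top. norm (mag (x t) - mag_ref (- 1)) < \<epsilon>2"
        using tendstoD[OF mag_tendsto_ref[OF sol 2] e2(1)] by (simp add: dist_norm)
      ultimately have "\<forall>\<^sub>F t in at_top. near 1 \<epsilon>2 (flow x0 t) \<and> norm (mag (flow x0 t) - mag_ref (- 1)) \<le> \<epsilon>2"
        using hor0[OF e2(1)] eventually_ge_at_top[of 0]
        by eventually_elim (use fl in_space[OF sol] in \<open>auto simp: near_def\<close>)
      then obtain T where T: "\<And>t. t \<ge> T \<Longrightarrow> near 1 \<epsilon>2 (flow x0 t) \<and> norm (mag (flow x0 t) - mag_ref (- 1)) \<le> \<epsilon>2"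
        unfolding eventually_at_top_linorder by blast
      obtain n :: nat where "T \<le> real n" using real_arch_simple by blast
      then have "x0 \<in> up_set \<epsilon>2 (real n) (real k)" using x0 k T by (simp add: up_set_def)
      then show ?thesis using Pu by blast
    qed
  qed
  ultimately show ?thesis by (intro exI[of _ P]) auto
qed

lemma origin_almost_globally_stable: "almost_globally_asymptotically_stable f origin"
proof -
  obtain P :: "nat \<Rightarrow> state set" where "\<And>n. flat (P n)"
    "{x0 \<in> state_space. \<not> attracted state_space f origin x0} \<subseteq> (\<Union>n. P n)"
    using exceptional_set_cover by blast
  from measure_zero_countable_flat[OF this] show ?thesis
    unfolding almost_globally_asymptotically_stable_def using origin_stable by blast
qed

text \<open>In the basis of \<open>e3\<close>, the horizontal part of \<open>m\<close> and \<open>e3 \<times> m\<close>, the attitude of an equilibrium is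
  \<open>diag (\<sigma>, \<tau>, \<sigma> \<tau>)\<close> with signs \<open>\<sigma>\<close> and \<open>\<tau>\<close>.\<close>

definition eq_attitude :: "real \<Rightarrow> real \<Rightarrow> real^3^3" where
  "eq_attitude \<sigma> \<tau> = (let a = m $ 1; b = m $ 2 in
     vector [vector [\<tau> * (a * a + \<sigma> * (b * b)) / M, \<tau> * (1 - \<sigma>) * a * b / M, 0],
             vector [\<tau> * (1 - \<sigma>) * a * b / M, \<tau> * (b * b + \<sigma> * (a * a)) / M, 0],
             vector [0, 0, \<sigma>]])"

text \<open>The velocity is parallel to \<open>eta = \<sigma> *\<^sub>R e3\<close>, and its
  component is the rest value of the filter \<open>vert\<close>, where damping balances
  \<open>g * (1 - \<sigma>)\<close>.\<close>

definition eq_point :: "real \<Rightarrow> real \<Rightarrow> state" where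
  "eq_point \<sigma> \<tau> = ((- (g / k1v) * (1 - \<sigma>)) *\<^sub>R (\<sigma> *\<^sub>R e3), eq_attitude \<sigma> \<tau>)"

lemma MM: "m $ 1 * m $ 1 + m $ 2 * m $ 2 = M" by (simp add: M_def power2_eq_square)

lemma eq_attitude_rotation:
  assumes "\<sigma> \<in> {1, - 1}" "\<tau> \<in> {1, - 1}" shows "rotation_matrix (eq_attitude \<sigma> \<tau>)"
proof -
  define a b where "a = m $ 1" and "b = m $ 2"
  have M': "M = a * a + b * b" using MM by (simp add: a_def b_def)
  then have nz: "a * a + b * b \<noteq> 0" using M by linarith
  \<comment> \<open>With \<open>\<alpha> + \<gamma> = 1\<close> and
    \<open>\<beta> * \<beta> = \<alpha> * \<gamma>\<close> the rotation conditions become polynomial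
    identities without division by \<open>M\<close>.\<close>
  define \<alpha> \<beta> \<gamma> where "\<alpha> = a * a / M" and "\<beta> = a * b / M" and "\<gamma> = b * b / M"
  have s: "\<alpha> + \<gamma> = 1" using nz by (simp add: \<alpha>_def \<gamma>_def M' flip: add_divide_distrib)
  have p: "\<beta> * \<beta> = \<alpha> * \<gamma>" by (simp add: \<alpha>_def \<beta>_def \<gamma>_def)
  have \<gamma>: "\<gamma> = 1 - \<alpha>" using s by simp
  have Q: "eq_attitude \<sigma> \<tau> = vector [vector [\<tau> * (\<alpha> + \<sigma> * \<gamma>), \<tau> * (1 - \<sigma>) * \<beta>, 0],
             vector [\<tau> * (1 - \<sigma>) * \<beta>, \<tau> * (\<gamma> + \<sigma> * \<alpha>), 0], vector [0, 0, \<sigma>]]"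
    by (simp add: eq_attitude_def Let_def a_def[symmetric] b_def[symmetric] \<alpha>_def \<beta>_def \<gamma>_def add_divide_distrib algebra_simps)
  have "\<beta> * \<beta> = \<alpha> - \<alpha> * \<alpha>" using p \<gamma> by (simp add: algebra_simps)
  then show ?thesis
    using assms unfolding Q \<gamma> rotation_matrix_def orthogonal_matrix
    by (auto simp: det_3 matrix_matrix_mult_def transpose_def mat_def vec_eq_iff forall_3 sum_3 algebra_simps)
qed

lemma eq_point_simps:
  assumes "\<sigma> \<in> {1, - 1}" "\<tau> \<in> {1, - 1}"
  shows "eq_point \<sigma> \<tau> \<in> state_space" "eta (eq_point \<sigma> \<tau>) = \<sigma> *\<^sub>R e3"
    "mag (eq_point \<sigma> \<tau>) = vector [\<tau> * m $ 1, \<tau> * m $ 2, \<sigma> * m $ 3]"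
    "vert (eq_point \<sigma> \<tau>) = - (g / k1v) * (1 - \<sigma>)" "hor (eq_point \<sigma> \<tau>) = 0" "sn (eq_point \<sigma> \<tau>) = 0"
    "cn (eq_point \<sigma> \<tau>) = \<tau> * M"
proof -
  show "eq_point \<sigma> \<tau> \<in> state_space"
    using eq_attitude_rotation[OF assms] by (simp add: eq_point_def state_space_def)
  show eta: "eta (eq_point \<sigma> \<tau>) = \<sigma> *\<^sub>R e3"
    by (simp add: eta_def eq_point_def eq_attitude_def Let_def vec_eq_iff forall_3 matrix_vector_mult_def sum_3)
  have 1: "(\<tau> * (m $ 1 * m $ 1 + \<sigma> * (m $ 2 * m $ 2)) / M) * m $ 1 + \<tau> * (1 - \<sigma>) * m $ 1 * m $ 2 / M * m $ 2 = \<tau> * m $ 1"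
  proof -
    have "(\<tau> * (m $ 1 * m $ 1 + \<sigma> * (m $ 2 * m $ 2)) / M) * m $ 1 + \<tau> * (1 - \<sigma>) * m $ 1 * m $ 2 / M * m $ 2
      = \<tau> * m $ 1 * (m $ 1 * m $ 1 + m $ 2 * m $ 2) / M" by (simp add: add_divide_distrib[symmetric] algebra_simps)
    then show ?thesis unfolding MM using M by simp
  qed
  have 2: "\<tau> * (1 - \<sigma>) * m $ 1 * m $ 2 / M * m $ 1 + (\<tau> * (m $ 2 * m $ 2 + \<sigma> * (m $ 1 * m $ 1)) / M) * m $ 2 = \<tau> * m $ 2"
  proof -
    have "\<tau> * (1 - \<sigma>) * m $ 1 * m $ 2 / M * m $ 1 + (\<tau> * (m $ 2 * m $ 2 + \<sigma> * (m $ 1 * m $ 1)) / M) * m $ 2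
      = \<tau> * m $ 2 * (m $ 1 * m $ 1 + m $ 2 * m $ 2) / M" by (simp add: add_divide_distrib[symmetric] algebra_simps)
    then show ?thesis unfolding MM using M by simp
  qed
  show mag: "mag (eq_point \<sigma> \<tau>) = vector [\<tau> * m $ 1, \<tau> * m $ 2, \<sigma> * m $ 3]"
    using 1 2 by (simp add: mag_def eq_point_def eq_attitude_def Let_def vec_eq_iff forall_3 matrix_vector_mult_def sum_3)
  have ss: "\<sigma> * \<sigma> = 1" using assms by auto
  show vert: "vert (eq_point \<sigma> \<tau>) = - (g / k1v) * (1 - \<sigma>)"
    unfolding vert_def eta using ss by (simp add: eq_point_def mult.assoc)
  show "hor (eq_point \<sigma> \<tau>) = 0" unfolding hor_def vert eta by (simp add: eq_point_def)
  show "sn (eq_point \<sigma> \<tau>) = 0" unfolding sn_def eta mag by (simp add: inner_e3 cross3_eval)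
  have "cn (eq_point \<sigma> \<tau>) = \<tau> * (m $ 1 * m $ 1 + m $ 2 * m $ 2)"
    unfolding cn_def eta mag by (simp add: inner_3 algebra_simps)
  then show "cn (eq_point \<sigma> \<tau>) = \<tau> * M" unfolding MM .
qed

lemma eq_point_equilibrium:
  assumes "\<sigma> \<in> {1, - 1}" "\<tau> \<in> {1, - 1}" shows "eq_point \<sigma> \<tau> \<in> equilibria state_space f"
proof -
  let ?x = "eq_point \<sigma> \<tau>"
  note s = eq_point_simps[OF assms]
  have fst: "fst ?x = vert ?x *\<^sub>R eta ?x" using fst_eq[of ?x] s by simp
  have ss: "\<sigma> * \<sigma> = 1" using assms by auto
  have "fst (f ?x) = g *\<^sub>R (e3 - eta ?x) - k1v *\<^sub>R (vert ?x *\<^sub>R eta ?x)"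
    unfolding fst_f[OF s(1)] fst using eta_eta[OF s(1)] s(5) by (simp add: power2_eq_square)
  also have "\<dots> = (g * (1 - \<sigma>) + g * (1 - \<sigma>) * \<sigma>) *\<^sub>R e3"
  proof -
    have "k1v *\<^sub>R (vert ?x *\<^sub>R eta ?x) = (k1v * vert ?x) *\<^sub>R (\<sigma> *\<^sub>R e3)" by (simp add: s(2))
    also have "k1v * vert ?x = - (g * (1 - \<sigma>))" using s(4) k1v by simp
    finally show ?thesis unfolding s(2) by (simp add: vec_eq_iff algebra_simps)
  qed
  also have "g * (1 - \<sigma>) + g * (1 - \<sigma>) * \<sigma> = 0" using ss by (simp add: algebra_simps)
  finally have 1: "fst (f ?x) = 0" by simp
  have "snd (f ?x) *v u = 0" for u unfolding snd_f using s by simp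
  then have 2: "snd (f ?x) = 0" by (simp add: matrix_eq)
  show ?thesis using s(1) 1 2 by (simp add: equilibria_def prod_eq_iff)
qed

text \<open>The convergence results, applied to the constant trajectory, give
  \<open>hor x = 0\<close> and \<open>eta x $ 3\<close> equal to \<open>1\<close> or
  \<open>- 1\<close>. The vanishing derivatives of \<open>vert\<close> and \<open>cn\<close> give
  the rest value and \<open>sn x = 0\<close>; two linear equations then determine
  \<open>mag x\<close>, and \<open>eta x\<close> with \<open>mag x\<close> determines the
  attitude.\<close>

lemma equilibrium_cases:
  assumes "x \<in> equilibria state_space f"
  shows "\<exists>\<sigma>\<in>{1, - 1}. \<exists>\<tau>\<in>{1, - 1}. x = eq_point \<sigma> \<tau>"
proof -
  have x: "x \<in> state_space" "f x = 0" using assms by (auto simp: equilibria_def)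
  have sol: "solution_on state_space (\<lambda>_. f) UNIV (\<lambda>_. x)" by (simp add: solution_on_def x)
  have sol0: "solution_on state_space (\<lambda>_. f) {0..} (\<lambda>_. x)" by (simp add: solution_on_def x)
  have c0: "c = 0" if "((\<lambda>t. d) has_real_derivative c) (at (0::real))" for c d :: real
    using DERIV_unique[OF that DERIV_const] .
  have hor: "hor x = 0"
    using hor_tendsto_0[OF sol0] by (simp add: tendsto_const_iff)
  have e3: "eta x $ 3 = 1 \<or> eta x $ 3 = - 1"
    using eta_3_tendsto[OF sol0] by (simp add: tendsto_const_iff)
  define \<sigma> where "\<sigma> = eta x $ 3"
  have \<sigma>: "\<sigma> \<in> {1, - 1}" "\<sigma>\<^sup>2 = 1" "\<sigma> * \<sigma> = 1" using e3 by (auto simp: \<sigma>_def)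
  have "(norm (eta x - \<sigma> *\<^sub>R e3))\<^sup>2 = 0" unfolding eta_dist_e3[OF x(1) \<sigma>(2)] using \<sigma> by (simp add: \<sigma>_def)
  then have eta: "eta x = \<sigma> *\<^sub>R e3" by simp
  have "- g * (1 - eta x $ 3) - k1v * vert x = 0"
    using c0[OF vert_deriv[OF sol, of 0, simplified]] by simp
  then have vert: "vert x = - (g / k1v) * (1 - \<sigma>)" using k1v by (simp add: \<sigma>_def field_simps)
  have "k2r * (sn x)\<^sup>2 - k1r * (m \<bullet> eta x) * (hor x \<bullet> mag x) = 0"
    using c0[OF cn_deriv[OF sol, of 0, simplified]] by simp
  then have sn: "sn x = 0" using hor k2r by simp
  have "(cn x)\<^sup>2 = M\<^sup>2"
  proof -
    have "(m \<bullet> eta x)\<^sup>2 = (m $ 3)\<^sup>2" using \<sigma>(2) by (simp add: eta inner_e3 power_mult_distrib)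
    then show ?thesis using sn_cn[OF x(1)] by (simp add: sn M_eq[symmetric] power2_eq_square[of M])
  qed
  then have "cn x = M \<or> cn x = - M" by (simp add: power2_eq_iff)
  then obtain \<tau> where \<tau>: "\<tau> \<in> {1, - 1}" "cn x = \<tau> * M" by (metis insertCI mult_1 mult_minus1)
  define n where "n = mag x"
  have n3: "n $ 3 = \<sigma> * m $ 3"
  proof -
    have "\<sigma> * n $ 3 = m $ 3" using mag_eta[OF x(1)] unfolding eta n_def by (simp add: inner_e3)
    then show ?thesis using \<sigma> by (metis mult.assoc mult_1)
  qed
  have A: "m $ 1 * n $ 2 = m $ 2 * n $ 1"
    using sn \<sigma> unfolding sn_def eta n_def by (auto simp: inner_e3 cross3_eval)
  have Bq: "m $ 1 * n $ 1 + m $ 2 * n $ 2 = \<tau> * M"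
    using \<tau>(2) \<sigma>(3) n3 unfolding cn_def eta n_def[symmetric]
    by (simp add: inner_3 inner_e3 algebra_simps)
  have "M * n $ 1 = m $ 1 * (m $ 1 * n $ 1 + m $ 2 * n $ 2)"
    unfolding MM[symmetric] using A by (simp add: algebra_simps)
  then have n1: "n $ 1 = \<tau> * m $ 1" unfolding Bq using M by simp
  have "M * n $ 2 = m $ 2 * (m $ 1 * n $ 1 + m $ 2 * n $ 2)"
    unfolding MM[symmetric] using A by (simp add: algebra_simps)
  then have n2: "n $ 2 = \<tau> * m $ 2" unfolding Bq using M by simp
  note s = eq_point_simps[OF \<sigma>(1) \<tau>(1)]
  have mag: "mag x = mag (eq_point \<sigma> \<tau>)"
    unfolding s using n1 n2 n3 by (simp add: n_def vec_eq_iff forall_3)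
  obtain C where "norm (snd x - snd (eq_point \<sigma> \<tau>)) \<le> C * (norm (eta x - eta (eq_point \<sigma> \<tau>)) + norm (mag x - mag (eq_point \<sigma> \<tau>)))"
    using norm_snd_diff_le x(1) s(1) by blast
  then have "snd x = snd (eq_point \<sigma> \<tau>)" using mag eta s by simp
  moreover have "fst x = fst (eq_point \<sigma> \<tau>)"
    using fst_eq[of x] fst_eq[of "eq_point \<sigma> \<tau>"] hor vert eta s by simp
  ultimately have "x = eq_point \<sigma> \<tau>" by (simp add: prod_eq_iff)
  then show ?thesis using \<sigma> \<tau> by blast
qed

lemma origin_eq_point: "origin = eq_point 1 1"
proof -
  obtain \<sigma> \<tau> where st: "\<sigma> \<in> {1, - 1}" "\<tau> \<in> {1, - 1}" "origin = eq_point \<sigma> \<tau>"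
    using equilibrium_cases[OF origin_equilibrium] by blast
  have "\<sigma> *\<^sub>R e3 = e3" using eq_point_simps(2)[OF st(1,2)] st(3) by (metis origin_simps(3))
  then have "(\<sigma> *\<^sub>R e3) $ 3 = e3 $ 3" by (rule arg_cong)
  then have "\<sigma> = 1" by simp
  moreover have "cn origin = M" by (simp add: cn_def inner_e3 M_eq power2_eq_square)
  then have "\<tau> * M = 1 * M" using eq_point_simps(7)[OF st(1,2)] st(3) by simp
  then have "\<tau> = 1" using M by simp
  ultimately show ?thesis using st(3) by simp
qed

lemma equilibria_eq: "equilibria state_space f = (\<lambda>(\<sigma>, \<tau>). eq_point \<sigma> \<tau>) ` (Sigma {1, - 1} (\<lambda>_. {1, - 1}))"
proof (rule set_eqI, rule iffI)
  fix x assume "x \<in> equilibria state_space f"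
  then show "x \<in> (\<lambda>(\<sigma>, \<tau>). eq_point \<sigma> \<tau>) ` (Sigma {1, - 1} (\<lambda>_. {1, - 1}))" 
    using equilibrium_cases[of x] by (auto simp: image_iff)
next
  fix x assume "x \<in> (\<lambda>(\<sigma>, \<tau>). eq_point \<sigma> \<tau>) ` (Sigma {1, - 1} (\<lambda>_. {1, - 1}))"
  then show "x \<in> equilibria state_space f" 
    by (auto intro!: eq_point_equilibrium)
qed

lemma card_equilibria: "card (equilibria state_space f) = 4"
proof -
  have "inj_on (\<lambda>(\<sigma>, \<tau>). eq_point \<sigma> \<tau>) (Sigma {1, - 1} (\<lambda>_. {1, - 1}))"
  proof (rule inj_onI, clarify)
    fix \<sigma> \<tau> \<sigma>' \<tau>' :: real
    assume st: "\<sigma> \<in> {1, - 1}" "\<tau> \<in> {1, - 1}" "\<sigma>' \<in> {1, - 1}" "\<tau>' \<in> {1, - 1}" and eq: "eq_point \<sigma> \<tau> = eq_point \<sigma>' \<tau>'"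
    have "\<sigma> *\<^sub>R e3 = \<sigma>' *\<^sub>R e3" 
      by (simp only: eq_point_simps(2)[OF st(1,2), symmetric] eq_point_simps(2)[OF st(3,4), symmetric] eq)
    then have "(\<sigma> *\<^sub>R e3) $ 3 = (\<sigma>' *\<^sub>R e3) $ 3" by (rule arg_cong)
    then have "\<sigma> = \<sigma>'" by simp
    moreover have "\<tau> * M = \<tau>' * M" 
      by (simp only: eq_point_simps(7)[OF st(1,2), symmetric] eq_point_simps(7)[OF st(3,4), symmetric] eq)
    then have "\<tau> = \<tau>'" using M by simp
    ultimately show "\<sigma> = \<sigma>' \<and> \<tau> = \<tau>'" by simp
  qed
  then show ?thesis unfolding equilibria_eq by (simp add: card_image card_cartesian_product)
qed

lemma equilibria_isolated:
  assumes "p \<in> equilibria state_space f" shows "p isolated_in equilibria state_space f"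
proof -
  have "finite (equilibria state_space f)" using card_equilibria by (intro card_ge_0_finite) simp
  then have "\<not> p islimpt equilibria state_space f" by (rule islimpt_finite)
  then show ?thesis using assms by (simp add: isolated_in_islimpt_iff)
qed

end

subsection \<open>Instability\<close>

text \<open>Perturbations for the instability proofs: \<open>rot_1\<close> tilts away from the
  vertical, while \<open>rot_3\<close> changes the heading alone.\<close>

definition rot_1 :: "real \<Rightarrow> real^3^3" where
  "rot_1 s = vector [vector [1, 0, 0], vector [0, cos s, - sin s], vector [0, sin s, cos s]]"

definition rot_3 :: "real \<Rightarrow> real^3^3" where
  "rot_3 s = vector [vector [cos s, - sin s, 0], vector [sin s, cos s, 0], vector [0, 0, 1]]"

lemma sin_cos_mult: "sin (s::real) * sin s + cos s * cos s = 1" "cos s * cos s + sin s * sin s = 1"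
  using sin_cos_squared_add[of s] by (simp_all add: power2_eq_square)

lemma rotation_rot_1: "rotation_matrix (rot_1 s)"
  unfolding rot_1_def rotation_matrix_def orthogonal_matrix
  by (simp add: det_3 matrix_matrix_mult_def transpose_def mat_def vec_eq_iff forall_3 sum_3 sin_cos_mult)

lemma rotation_rot_3: "rotation_matrix (rot_3 s)"
  unfolding rot_3_def rotation_matrix_def orthogonal_matrix
  by (simp add: det_3 matrix_matrix_mult_def transpose_def mat_def vec_eq_iff forall_3 sum_3 sin_cos_mult)

lemma tendsto_matrix_3:
  fixes A :: "'a \<Rightarrow> real^3^3"
  assumes "\<And>i j. ((\<lambda>s. A s $ i $ j) \<longlongrightarrow> L $ i $ j) F" shows "(A \<longlongrightarrow> L) F"
  by (intro vec_tendstoI assms)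

lemma rot_1_tendsto: "(rot_1 \<longlongrightarrow> mat 1) (at 0)"
proof (rule tendsto_matrix_3)
  have "((\<lambda>s::real. cos s) \<longlongrightarrow> cos 0) (at 0)" "((\<lambda>s::real. sin s) \<longlongrightarrow> sin 0) (at 0)" "((\<lambda>s::real. - sin s) \<longlongrightarrow> - sin 0) (at 0)"
    by (intro tendsto_intros)+
  then have "\<forall>i j. ((\<lambda>s. rot_1 s $ i $ j) \<longlongrightarrow> (mat 1 :: real^3^3) $ i $ j) (at 0)"
    by (simp add: rot_1_def forall_3 mat_def)
  then show "((\<lambda>s. rot_1 s $ i $ j) \<longlongrightarrow> (mat 1 :: real^3^3) $ i $ j) (at 0)" for i j by blast
qed

lemma rot_3_tendsto: "(rot_3 \<longlongrightarrow> mat 1) (at 0)"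
proof (rule tendsto_matrix_3)
  have "((\<lambda>s::real. cos s) \<longlongrightarrow> cos 0) (at 0)" "((\<lambda>s::real. sin s) \<longlongrightarrow> sin 0) (at 0)" "((\<lambda>s::real. - sin s) \<longlongrightarrow> - sin 0) (at 0)"
    by (intro tendsto_intros)+
  then have "\<forall>i j. ((\<lambda>s. rot_3 s $ i $ j) \<longlongrightarrow> (mat 1 :: real^3^3) $ i $ j) (at 0)"
    by (simp add: rot_3_def forall_3 mat_def)
  then show "((\<lambda>s. rot_3 s $ i $ j) \<longlongrightarrow> (mat 1 :: real^3^3) $ i $ j) (at 0)" for i j by blast
qed

context observer
begin

text \<open>\<open>y\<close> is a curve of perturbed initial states shrinking to \<open>p\<close>,
  and every one of them is carried a fixed distance away from \<open>p\<close>, whatever its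
  size.\<close>

lemma unstable_if_leaving:
  fixes y :: "real \<Rightarrow> state"
  assumes p: "p \<in> equilibria state_space f" and y: "(y \<longlongrightarrow> p) (at 0)" and e: "\<epsilon> > 0"
    and leave: "\<And>s. 0 < s \<Longrightarrow> s < 1 \<Longrightarrow> y s \<in> state_space \<and>
      (\<exists>t\<ge>0. dist (flow (y s) t) p \<ge> \<epsilon>)"
  shows "unstable_equilibrium state_space f p"
  unfolding unstable_equilibrium_def
proof (intro conjI p notI)
  assume "stable_equilibrium state_space f p"
  then obtain \<delta> where \<delta>: "\<delta> > 0" and st: "\<forall>T>0. \<forall>x. solution_on state_space (\<lambda>_. f) {0..T} x \<and> dist (x 0) p < \<delta> \<longrightarrow>
        (\<forall>t\<in>{0..T}. dist (x t) p < \<epsilon>)"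
    using e unfolding stable_equilibrium_def by blast
  have "\<forall>\<^sub>F s in at 0. dist (y s) p < \<delta>" by (rule tendstoD[OF y \<delta>])
  then obtain d where d: "d > 0" "\<And>s. s \<noteq> 0 \<Longrightarrow> dist s 0 < d \<Longrightarrow> dist (y s) p < \<delta>"
    unfolding eventually_at by blast
  define s where "s = min (d / 2) (1 / 2)"
  have s: "0 < s" "s < 1" "dist s 0 < d" using d(1) by (auto simp: s_def dist_real_def)
  obtain t where t: "t \<ge> 0" "dist (flow (y s) t) p \<ge> \<epsilon>" and ss: "y s \<in> state_space" using leave[OF s(1,2)] by blast
  have sol: "solution_on state_space (\<lambda>_. f) {0..t + 1} (flow (y s))"
    by (rule solution_on_subset[OF flow_solution[OF ss]]) auto
  have "dist (flow (y s) 0) p < \<delta>" using d(2)[of s] s flow_0[OF ss] by simp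
  then have "dist (flow (y s) t) p < \<epsilon>"
    using st[THEN spec, of "t + 1", THEN mp, THEN spec, of "flow (y s)"] sol t by auto
  then show False using t by simp
qed

lemma eta_mag_dist_le:
  "\<exists>C>0. \<forall>x x'. norm (eta x - eta x') \<le> C * dist x x' \<and> norm (mag x - mag x') \<le> C * dist x x'"
proof -
  obtain Q where Q: "Q > 0" "\<And>A (v::real^3). norm ((A::real^3^3) *v v) \<le> norm A * norm v * Q"
    using bounded_bilinear.pos_bounded[OF bounded_bilinear_matrix_vector_mult] by blast
  define C where "C = Q * (1 + norm m)"
  have "norm (snd x *v v - snd x' *v v) \<le> C * dist x x'" if "norm v \<le> 1 + norm m" for v and x x' :: state
  proof -
    have "norm (snd x *v v - snd x' *v v) \<le> norm (snd x - snd x') * norm v * Q"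
      using Q(2)[of "snd x - snd x'" v] by (simp add: matrix_vector_mult_diff_rdistrib)
    also have "\<dots> \<le> dist x x' * (1 + norm m) * Q"
      using Q that norm_snd_le[of "snd x - snd x'" "fst x - fst x'"]
      by (intro mult_right_mono mult_mono) (auto simp: dist_norm minus_prod_def)
    finally show ?thesis by (simp add: C_def mult_ac)
  qed
  then have "norm (eta x - eta x') \<le> C * dist x x' \<and> norm (mag x - mag x') \<le> C * dist x x'" for x x' :: state
    by (simp add: eta_def mag_def)
  moreover have "C > 0" unfolding C_def using Q by (intro mult_pos_pos add_pos_nonneg) auto
  ultimately show ?thesis by blast
qed

lemma eq_point_eta_snd: "snd (eq_point \<sigma> \<tau>) *v e3 = \<sigma> *\<^sub>R e3" if "\<sigma> \<in> {1, - 1}" "\<tau> \<in> {1, - 1}"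
  using eq_point_simps(2)[OF that] by (simp add: eta_def)

text \<open>A tilted state without horizontal velocity has energy below \<open>2 * g\<close>, the
  value at the lower pole. As energy never increases, convergence to that pole is excluded, so the
  trajectory tends to the upper one and leaves.\<close>

lemma down_unstable:
  assumes \<tau>: "\<tau> \<in> {1, - 1}" shows "unstable_equilibrium state_space f (eq_point (- 1) \<tau>)"
proof -
  let ?p = "eq_point (- 1) \<tau>"
  have \<sigma>: "- 1 \<in> {1, - 1 :: real}" by simp
  note p = eq_point_simps[OF \<sigma> \<tau>]
  obtain C where C: "C > 0" "\<And>x x'. norm (eta x - eta x') \<le> C * dist x x'" using eta_mag_dist_le by blast
  \<comment> \<open>The velocity is rotated along with \<open>eta\<close>, which keeps it parallel
    to \<open>eta\<close> and so the kinetic part of the energy at zero.\<close>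
  define y where "y s = (vert ?p *\<^sub>R (rot_1 s *v (- e3)), rot_1 s ** snd ?p)" for s
  have fst_p: "fst ?p = vert ?p *\<^sub>R (- e3)" using fst_eq[of ?p] p by simp
  show ?thesis
  proof (rule unstable_if_leaving[OF eq_point_equilibrium[OF \<sigma> \<tau>], of y "1 / C"])
    have "((\<lambda>s. (vert ?p *\<^sub>R (rot_1 s *v (- e3)), rot_1 s ** snd ?p)) \<longlongrightarrow> (vert ?p *\<^sub>R (mat 1 *v (- e3)), mat 1 ** snd ?p)) (at 0)"
      by (intro tendsto_Pair tendsto_scaleR tendsto_const rot_1_tendsto
         bounded_bilinear.tendsto[OF bounded_bilinear_matrix_vector_mult] bounded_bilinear.tendsto[OF bounded_bilinear_matrix_matrix_mult])
    moreover have "(vert ?p *\<^sub>R (mat 1 *v (- e3)), mat 1 ** snd ?p) = ?p" using fst_p by (simp add: prod_eq_iff)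
    ultimately show "(y \<longlongrightarrow> ?p) (at 0)" unfolding y_def[abs_def] by metis
    show "1 / C > 0" using C by simp
    fix s :: real assume s: "0 < s" "s < 1"
    have ss: "y s \<in> state_space"
      using rotation_matrix_mult[OF rotation_rot_1 state_rotation[OF p(1)]] by (simp add: y_def state_space_def)
    have eta: "eta (y s) = rot_1 s *v (- e3)"
      using eq_point_eta_snd[OF \<sigma> \<tau>] by (simp add: eta_def y_def matrix_vector_mul_assoc[symmetric])
    have eta3: "eta (y s) $ 3 = - cos s"
      unfolding eta by (simp add: rot_1_def matrix_vector_mult_def sum_3)
    have "fst (y s) = vert ?p *\<^sub>R eta (y s)" unfolding eta by (simp add: y_def)
    then have hor: "hor (y s) = 0" using eta_eta[OF ss] by (simp add: hor_def vert_def)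
    have "cos s < 1" using cos_monotone_0_pi[of 0 s] s pi_gt3 by simp
    then have en: "energy (y s) < 2 * g" using g by (simp add: energy_def hor eta3)
    define x where "x = flow (y s)"
    have sol: "solution_on state_space (\<lambda>_. f) {0..} x" and x0: "x 0 = y s"
      unfolding x_def using flow_solution[OF ss] flow_0[OF ss] by auto
    have "\<not> ((\<lambda>t. eta (x t) $ 3) \<longlongrightarrow> - 1) at_top"
    proof
      assume down: "((\<lambda>t. eta (x t) $ 3) \<longlongrightarrow> - 1) at_top"
      have "((\<lambda>t. energy (x t)) \<longlongrightarrow> k1r / 2 * ((0::real^3) \<bullet> 0) + g * (1 - (- 1))) at_top"
        unfolding energy_def
        by (intro tendsto_add tendsto_mult tendsto_diff tendsto_const tendsto_inner hor_tendsto_0[OF sol] down)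
      then have lim: "((\<lambda>t. energy (x t)) \<longlongrightarrow> 2 * g) at_top" by (simp add: mult.commute)
      have "\<forall>\<^sub>F t in at_top. energy (y s) < energy (x t) \<and> t \<ge> 0"
        using order_tendstoD(1)[OF lim en] eventually_ge_at_top[of 0] by eventually_elim simp
      from eventually_happens'[OF trivial_limit_at_top_linorder this]
      obtain t where "energy (y s) < energy (x t)" "t \<ge> 0" by blast
      then show False using energy_le_initial[OF sol, of t] x0 by simp
    qed
    then have "((\<lambda>t. eta (x t) $ 3) \<longlongrightarrow> 1) at_top" using eta_3_tendsto[OF sol] by blast
    then have "\<forall>\<^sub>F t in at_top. 0 < eta (x t) $ 3" by (rule order_tendstoD(1)) simp
    then have "\<forall>\<^sub>F t in at_top. 0 < eta (x t) $ 3 \<and> t \<ge> 0"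
      using eventually_ge_at_top[of 0] by eventually_elim simp
    from eventually_happens'[OF trivial_limit_at_top_linorder this]
    obtain t where t: "0 < eta (x t) $ 3" "t \<ge> 0" by blast
    have "1 \<le> \<bar>(eta (x t) - eta ?p) $ 3\<bar>" using t by (simp add: p)
    also have "\<dots> \<le> C * dist (x t) ?p" using component_le_norm_cart C(2) order_trans by blast
    finally have "1 / C \<le> dist (x t) ?p" using C(1) by (simp add: field_simps)
    then show "y s \<in> state_space \<and> (\<exists>t\<ge>0. dist (flow (y s) t) ?p \<ge> 1 / C)"
      using ss t by (auto simp: x_def)
  qed
qed

text \<open>Turned about the vertical, the state has zero energy and keeps it, so \<open>eta\<close>
  remains at \<open>e3\<close> and \<open>hor\<close> at zero. Then \<open>cn\<close> is
  nondecreasing from a value above \<open>- M\<close>, cannot return to \<open>- M\<close>, and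
  tends to \<open>M\<close>.\<close>

lemma up_unstable: "unstable_equilibrium state_space f (eq_point 1 (- 1))"
proof -
  let ?p = "eq_point 1 (- 1)"
  have st: "(1::real) \<in> {1, - 1}" "- 1 \<in> {1, - 1 :: real}" by simp_all
  note p = eq_point_simps[OF st]
  obtain C where C: "C > 0" "\<And>x x'. norm (eta x - eta x') \<le> C * dist x x' \<and> norm (mag x - mag x') \<le> C * dist x x'"
    using eta_mag_dist_le by blast
  define C' where "C' = (norm m + norm m * norm m) * C + 1"
  have C': "C' > 0" unfolding C'_def using C by (intro add_nonneg_pos mult_nonneg_nonneg add_nonneg_nonneg) auto
  have cnC: "\<bar>cn x - cn x'\<bar> \<le> C' * dist x x'" for x x'
  proof -
    have "cn x - cn x' = m \<bullet> (mag x - mag x') - m $ 3 * (m \<bullet> (eta x - eta x'))"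
      unfolding cn_def inner_diff_right right_diff_distrib by linarith
    moreover have "\<bar>m \<bullet> (mag x - mag x')\<bar> \<le> norm m * (C * dist x x')"
      using C(2) by (intro order_trans[OF Cauchy_Schwarz_ineq2] mult_left_mono) auto
    moreover have "\<bar>m \<bullet> (eta x - eta x')\<bar> \<le> norm m * (C * dist x x')"
      using C(2) by (intro order_trans[OF Cauchy_Schwarz_ineq2] mult_left_mono) auto
    then have "\<bar>m $ 3 * (m \<bullet> (eta x - eta x'))\<bar> \<le> norm m * (norm m * (C * dist x x'))"
      unfolding abs_mult by (intro mult_mono component_le_norm_cart) auto
    moreover have "C' * dist x x' = norm m * (C * dist x x') + norm m * (norm m * (C * dist x x')) + dist x x'"
      by (simp add: C'_def algebra_simps)
    moreover have "0 \<le> dist x x'" by simp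
    ultimately show ?thesis by linarith
  qed
  define y where "y s = (0 :: real^3, rot_3 s ** snd ?p)" for s
  show ?thesis
  proof (rule unstable_if_leaving[OF eq_point_equilibrium[OF st], of y "M / C'"])
    have "((\<lambda>s. (0 :: real^3, rot_3 s ** snd ?p)) \<longlongrightarrow> (0, mat 1 ** snd ?p)) (at 0)"
      by (intro tendsto_Pair tendsto_const rot_3_tendsto bounded_bilinear.tendsto[OF bounded_bilinear_matrix_matrix_mult])
    moreover have "(0, mat 1 ** snd ?p) = ?p" by (simp add: prod_eq_iff eq_point_def)
    ultimately show "(y \<longlongrightarrow> ?p) (at 0)" unfolding y_def[abs_def] by metis
    show "M / C' > 0" using M C' by simp
    fix s :: real assume s: "0 < s" "s < 1"
    have ss: "y s \<in> state_space"
      using rotation_matrix_mult[OF rotation_rot_3 state_rotation[OF p(1)]] by (simp add: y_def state_space_def)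
    have "eta (y s) = rot_3 s *v (snd ?p *v e3)" by (simp only: eta_def y_def snd_conv matrix_vector_mul_assoc)
    also have "\<dots> = rot_3 s *v e3" by (simp add: eq_point_eta_snd[OF st])
    also have "\<dots> = e3" by (simp add: rot_3_def matrix_vector_mult_def sum_3 vec_eq_iff forall_3)
    finally have eta: "eta (y s) = e3" .
    have mag: "mag (y s) = rot_3 s *v vector [- m $ 1, - m $ 2, m $ 3]"
      using p(3) by (simp add: mag_def y_def matrix_vector_mul_assoc[symmetric])
    have "cn (y s) = - cos s * (m $ 1 * m $ 1 + m $ 2 * m $ 2)"
      unfolding cn_def eta mag
      by (simp add: inner_3 rot_3_def matrix_vector_mult_def sum_3 algebra_simps)
    then have cn0: "cn (y s) = - cos s * M" unfolding MM .
    have "cos s < 1" using cos_monotone_0_pi[of 0 s] s pi_gt3 by simp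
    then have cn1: "- M < cn (y s)" unfolding cn0 using M by simp
    have "hor (y s) = 0" by (simp add: hor_def vert_def y_def)
    then have en: "energy (y s) = 0" by (simp add: energy_def eta)
    define x where "x = flow (y s)"
    have sol: "solution_on state_space (\<lambda>_. f) {0..} x" and x0: "x 0 = y s"
      unfolding x_def using flow_solution[OF ss] flow_0[OF ss] by auto
    have en0: "energy (x t) = 0" if "t \<ge> 0" for t
      using energy_le_initial[OF sol that] energy_nonneg[OF in_space[OF sol that]] x0 en by simp
    have hor: "hor (x t) = 0" if "t \<ge> 0" for t
    proof -
      have "hor (x t) \<bullet> hor (x t) = 0"
        using hor_le_energy[OF in_space[OF sol that]] en0[OF that] inner_ge_zero[of "hor (x t)"] by simp
      then show ?thesis by simp
    qed
    have "eta (x t) $ 3 = 1" if "t \<ge> 0" for t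
      using en0[OF that] hor[OF that] g by (simp add: energy_def)
    then have "\<forall>\<^sub>F t in at_top. eta (x t) $ 3 = 1" 
      unfolding eventually_at_top_linorder by blast
    then have up: "((\<lambda>t. eta (x t) $ 3) \<longlongrightarrow> 1) at_top" by (rule tendsto_eventually)
    have mono: "cn (y s) \<le> cn (x t)" if t: "t \<ge> 0" for t
    proof -
      have "cn (x 0) \<le> cn (x t)"
      proof (rule nonneg_derivative_imp_le[OF t, where J = "{0..}"])
        fix u assume u: "u \<in> {0..t}"
        show "((\<lambda>t. cn (x t)) has_real_derivative k2r * (sn (x u))\<^sup>2 - k1r * (m \<bullet> eta (x u)) * (hor (x u) \<bullet> mag (x u))) (at u within {0..})"
          using u by (intro cn_deriv[OF sol]) auto
        show "0 \<le> k2r * (sn (x u))\<^sup>2 - k1r * (m \<bullet> eta (x u)) * (hor (x u) \<bullet> mag (x u))"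
          using u k2r hor[of u] by simp
      qed auto
      then show ?thesis by (simp add: x0)
    qed
    have "\<not> ((\<lambda>t. cn (x t)) \<longlongrightarrow> - M) at_top"
    proof
      assume "((\<lambda>t. cn (x t)) \<longlongrightarrow> - M) at_top"
      from order_tendstoD(2)[OF this cn1] have "\<forall>\<^sub>F t in at_top. cn (x t) < cn (y s) \<and> t \<ge> 0"
        using eventually_ge_at_top[of 0] by eventually_elim simp
      from eventually_happens'[OF trivial_limit_at_top_linorder this]
      obtain t where "cn (x t) < cn (y s)" "t \<ge> 0" by blast
      then show False using mono[of t] by simp
    qed
    then have "((\<lambda>t. cn (x t)) \<longlongrightarrow> M) at_top" using cn_tendsto[OF sol up] by blast
    from order_tendstoD(1)[OF this M] have "\<forall>\<^sub>F t in at_top. 0 < cn (x t) \<and> t \<ge> 0"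
      using eventually_ge_at_top[of 0] by eventually_elim simp
    from eventually_happens'[OF trivial_limit_at_top_linorder this]
    obtain t where t: "0 < cn (x t)" "t \<ge> 0" by blast
    have "M \<le> \<bar>cn (x t) - cn ?p\<bar>" using t M by (simp add: p)
    also have "\<dots> \<le> C' * dist (x t) ?p" by (rule cnC)
    finally have "M / C' \<le> dist (x t) ?p" using C' by (simp add: field_simps)
    then show "y s \<in> state_space \<and> (\<exists>t\<ge>0. dist (flow (y s) t) ?p \<ge> M / C')"
      using ss t by (auto simp: x_def)
  qed
qed

lemma other_equilibria_unstable:
  assumes "p \<in> equilibria state_space f - {origin}" shows "unstable_equilibrium state_space f p"
proof -
  obtain \<sigma> \<tau> where st: "\<sigma> \<in> {1, - 1}" "\<tau> \<in> {1, - 1}" "p = eq_point \<sigma> \<tau>"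
    using equilibrium_cases[of p] assms by blast
  then consider "\<sigma> = - 1" | "\<sigma> = 1" "\<tau> = - 1" using assms origin_eq_point by auto
  then show ?thesis using down_unstable[OF st(2)] up_unstable st(3) by cases auto
qed

end

subsection \<open>The observer\<close>

text \<open>The correction terms are built from inner and cross products and hence commute with
  rotations. This is what lets the body-frame observer terms reappear unchanged in the inertial
  frame.\<close>

lemma rotation_sigma_v:
  assumes "rotation_matrix R"
  shows "R *v sigma_v k1v k2v k1r w \<gamma> = sigma_v k1v k2v k1r (R *v w) (R *v \<gamma>)"
  by (simp add: sigma_v_def cross_rotation_matrix[OF assms] matrix_vector_mult_diff_distrib matrix_vector_mult_scaleR)

lemma rotation_sigma_R:
  assumes "rotation_matrix R"
  shows "R *v sigma_R k1r k2r w \<gamma> u u' = sigma_R k1r k2r (R *v w) (R *v \<gamma>) (R *v u) (R *v u')"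
  by (simp add: sigma_R_def cross_rotation_matrix[OF assms] rotation_matrix_inner[OF assms]
      matrix_vector_right_distrib matrix_vector_mult_scaleR)

lemma transpose_minus: "transpose (- (A :: real^3^3)) = - transpose A"
  by (rule linear_neg[OF bounded_linear.linear[OF bounded_linear_transpose]])

lemma matrix_mult_minus:
  fixes A B :: "real^3^3"
  shows "(- A) ** B = - (A ** B)" "A ** (- B) = - (A ** B)" "(- A) *v u = - (A *v u)"
  by (simp_all add: bounded_bilinear.minus_left[OF bounded_bilinear_matrix_matrix_mult]
     bounded_bilinear.minus_right[OF bounded_bilinear_matrix_matrix_mult]
     bounded_bilinear.minus_left[OF bounded_bilinear_matrix_vector_mult])

lemma solution_on_PairD:
  assumes "solution_on state_space F J (\<lambda>t. (v t, R t))" "t \<in> J"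
  shows "rotation_matrix (R t)" "(v has_vector_derivative fst (F t (v t, R t))) (at t within J)"
    "(R has_vector_derivative snd (F t (v t, R t))) (at t within J)"
  using assms bounded_linear.has_vector_derivative[OF bounded_linear_fst, of "\<lambda>t. (v t, R t)"]
    bounded_linear.has_vector_derivative[OF bounded_linear_snd, of "\<lambda>t. (v t, R t)"]
  by (fastforce simp: solution_on_def state_space_def)+

lemma solution_on_PairI:
  assumes "\<And>t. t \<in> J \<Longrightarrow> rotation_matrix (R t)"
    "\<And>t. t \<in> J \<Longrightarrow> (v has_vector_derivative fst (F t (v t, R t))) (at t within J)"
    "\<And>t. t \<in> J \<Longrightarrow> (R has_vector_derivative snd (F t (v t, R t))) (at t within J)"
  shows "solution_on state_space F J (\<lambda>t. (v t, R t))"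
  unfolding solution_on_def
proof (intro ballI conjI)
  fix t assume t: "t \<in> J"
  show "(v t, R t) \<in> state_space" using assms(1)[OF t] by (simp add: state_space_def)
  show "((\<lambda>t. (v t, R t)) has_vector_derivative F t (v t, R t)) (at t within J)"
    using has_vector_derivative_Pair[OF assms(2,3)[OF t]] by simp
qed

text \<open>The measured \<open>mB\<close> enters the observer only through the component of \<open>sigma_R\<close> along
  \<open>\<gamma>\<close>, which does not rotate \<open>\<gamma>\<close>.\<close>

lemma observer_tilt_dynamics:
  assumes sol: "solution_on state_space (observer_field g k1v k2v k1r k2r mI v \<omega> a mB) J (\<lambda>t. (vh t, Rh t))"
    and t: "t \<in> J"
  shows "((\<lambda>s. transpose (Rh s) *v e3) has_vector_derivative
     (transpose (Rh t) *v e3) \<times> (\<omega> t + k1r *\<^sub>R ((v t - vh t) \<times> (transpose (Rh t) *v e3)))) (at t within J)"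
proof -
  let ?\<gamma> = "transpose (Rh t) *v e3"
  let ?u = "\<omega> t + sigma_R k1r k2r (v t - vh t) ?\<gamma> (mB t) (transpose (Rh t) *v mI)"
  have "(Rh has_vector_derivative Rh t ** skew ?u) (at t within J)"
    using solution_on_PairD(3)[OF sol t] by (simp add: observer_field_def Let_def)
  then have "((\<lambda>s. transpose (Rh s) *v e3) has_vector_derivative transpose (Rh t ** skew ?u) *v e3) (at t within J)"
    by (intro bounded_linear.has_vector_derivative[OF bounded_bilinear.bounded_linear_left[OF bounded_bilinear_matrix_vector_mult]]
      bounded_linear.has_vector_derivative[OF bounded_linear_transpose])
  moreover have "transpose (Rh t ** skew ?u) *v e3 = ?\<gamma> \<times> ?u"
    by (simp only: matrix_transpose_mul transpose_skew matrix_mult_minus matrix_vector_mul_assoc[symmetric] skew_mult_vector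
        cross_skew[of ?\<gamma> ?u])
  moreover have "?\<gamma> \<times> ?u = ?\<gamma> \<times> (\<omega> t + k1r *\<^sub>R ((v t - vh t) \<times> ?\<gamma>))"
    by (simp add: sigma_R_def cross_add_right cross_mult_right)
  ultimately show ?thesis by simp
qed

section \<open>Correspondence of observer and error trajectories\<close>

context observer
begin

context
  fixes v R \<omega> a
  assumes sys: "solution_on state_space (system_field g \<omega> a) {0..} (\<lambda>t. (v t, R t))"
begin

abbreviation obs :: "real \<Rightarrow> state \<Rightarrow> state" where
  "obs \<equiv> observer_field g k1v k2v k1r k2r m v \<omega> a (\<lambda>t. transpose (R t) *v m)"

lemma sys_facts:
  assumes "t \<ge> 0"
  shows "rotation_matrix (R t)" "(v has_vector_derivative v t \<times> \<omega> t + a t + g *\<^sub>R (transpose (R t) *v e3)) (at t within {0..})"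
    "(R has_vector_derivative R t ** skew (\<omega> t)) (at t within {0..})"
  using solution_on_PairD[OF sys, of t] assms by (simp_all add: system_field_def)

text \<open>The input \<open>a\<close> cancels in the difference of the velocities and
  \<open>\<omega>\<close> cancels against the rotation of the frame; equivariance together with
  \<open>R *v (transpose R *v m) = m\<close> turns what remains into functions of the errors
  alone.\<close>

lemma error_solution:
  assumes obs: "solution_on state_space obs {0..} (\<lambda>t. (vh t, Rh t))"
  shows "solution_on state_space (\<lambda>_. f) {0..} (\<lambda>t. error_state (v t, R t) (vh t, Rh t))"
  unfolding error_state_def split_conv
proof (rule solution_on_PairI)
  fix t :: real assume "t \<in> {0..}"
  then have t: "t \<ge> 0" by simp
  note s = sys_facts[OF t]
  define \<gamma> where "\<gamma> = transpose (Rh t) *v e3"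
  define \<sigma> where "\<sigma> = sigma_R k1r k2r (v t - vh t) \<gamma> (transpose (R t) *v m) (transpose (Rh t) *v m)"
  have Rh: "rotation_matrix (Rh t)"
    and vh': "(vh has_vector_derivative vh t \<times> \<omega> t + a t + g *\<^sub>R \<gamma> + sigma_v k1v k2v k1r (v t - vh t) \<gamma>) (at t within {0..})"
    and Rh': "(Rh has_vector_derivative Rh t ** skew (\<omega> t + \<sigma>)) (at t within {0..})"
    using solution_on_PairD[OF obs, of t] t by (simp_all add: observer_field_def Let_def \<gamma>_def \<sigma>_def)
  define w where "w = R t *v (v t - vh t)"
  define Q where "Q = R t ** transpose (Rh t)"
  show "rotation_matrix (R t ** transpose (Rh t))" using s(1) Rh by blast
  have R\<gamma>: "R t *v \<gamma> = Q *v e3" by (simp only: \<gamma>_def Q_def matrix_vector_mul_assoc)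
  have R\<sigma>: "R t *v \<sigma> = sigma_R k1r k2r w (Q *v e3) m (Q *v m)"
    unfolding \<sigma>_def rotation_sigma_R[OF s(1)] R\<gamma> rotation_matrix_inverses(4)[OF s(1)]
    by (simp only: w_def Q_def matrix_vector_mul_assoc)
  have "((\<lambda>t. R t *v (v t - vh t)) has_vector_derivative
     R t *v ((v t \<times> \<omega> t + a t + g *\<^sub>R (transpose (R t) *v e3)) - (vh t \<times> \<omega> t + a t + g *\<^sub>R \<gamma> + sigma_v k1v k2v k1r (v t - vh t) \<gamma>))
      + (R t ** skew (\<omega> t)) *v (v t - vh t)) (at t within {0..})"
    by (intro bounded_bilinear.has_vector_derivative[OF bounded_bilinear_matrix_vector_mult] has_vector_derivative_diff s vh')
  moreover have "R t *v ((v t \<times> \<omega> t + a t + g *\<^sub>R (transpose (R t) *v e3)) - (vh t \<times> \<omega> t + a t + g *\<^sub>R \<gamma> + sigma_v k1v k2v k1r (v t - vh t) \<gamma>))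
      + (R t ** skew (\<omega> t)) *v (v t - vh t) = fst (f (w, Q))"
  proof -
    have "(v t \<times> \<omega> t + a t + g *\<^sub>R (transpose (R t) *v e3)) - (vh t \<times> \<omega> t + a t + g *\<^sub>R \<gamma> + sigma_v k1v k2v k1r (v t - vh t) \<gamma>)
      + skew (\<omega> t) *v (v t - vh t) = g *\<^sub>R (transpose (R t) *v e3 - \<gamma>) - sigma_v k1v k2v k1r (v t - vh t) \<gamma>"
      by (simp add: skew_mult_vector cross_skew[of "\<omega> t"] Cross3.left_diff_distrib scaleR_diff_right)
    then have "R t *v ((v t \<times> \<omega> t + a t + g *\<^sub>R (transpose (R t) *v e3)) - (vh t \<times> \<omega> t + a t + g *\<^sub>R \<gamma> + sigma_v k1v k2v k1r (v t - vh t) \<gamma>))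
      + (R t ** skew (\<omega> t)) *v (v t - vh t) = R t *v (g *\<^sub>R (transpose (R t) *v e3 - \<gamma>) - sigma_v k1v k2v k1r (v t - vh t) \<gamma>)"
      by (simp only: matrix_vector_mul_assoc[symmetric] matrix_vector_right_distrib[symmetric])
    also have "\<dots> = g *\<^sub>R (e3 - Q *v e3) - sigma_v k1v k2v k1r w (Q *v e3)"
      by (simp only: matrix_vector_mult_diff_distrib matrix_vector_mult_scaleR rotation_sigma_v[OF s(1)] R\<gamma>
          rotation_matrix_inverses(4)[OF s(1)] w_def)
    finally show ?thesis by (simp add: error_field_def matrix_vector_mult_diff_rdistrib)
  qed
  ultimately show "((\<lambda>t. R t *v (v t - vh t)) has_vector_derivative fst (f (R t *v (v t - vh t), R t ** transpose (Rh t)))) (at t within {0..})"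
    by (simp only: w_def Q_def)
  have "((\<lambda>t. R t ** transpose (Rh t)) has_vector_derivative
      R t ** transpose (Rh t ** skew (\<omega> t + \<sigma>)) + (R t ** skew (\<omega> t)) ** transpose (Rh t)) (at t within {0..})"
    by (intro bounded_bilinear.has_vector_derivative[OF bounded_bilinear_matrix_matrix_mult] s(3)
       bounded_linear.has_vector_derivative[OF bounded_linear_transpose] Rh')
  moreover have "R t ** transpose (Rh t ** skew (\<omega> t + \<sigma>)) + (R t ** skew (\<omega> t)) ** transpose (Rh t) = snd (f (w, Q))"
  proof -
    have "transpose (Rh t ** skew (\<omega> t + \<sigma>)) = - ((skew (\<omega> t) + skew \<sigma>) ** transpose (Rh t))"
      by (simp only: matrix_transpose_mul linear_add[OF linear_skew, symmetric] transpose_skew matrix_mult_minus)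
    then have "R t ** transpose (Rh t ** skew (\<omega> t + \<sigma>)) + (R t ** skew (\<omega> t)) ** transpose (Rh t)
       = - ((R t ** skew \<sigma>) ** transpose (Rh t))"
      by (simp add: matrix_mult_minus matrix_mul_assoc matrix_add_ldistrib
          bounded_bilinear.add_left[OF bounded_bilinear_matrix_matrix_mult]
          bounded_bilinear.diff_right[OF bounded_bilinear_matrix_matrix_mult])
    also have "\<dots> = - (skew (R t *v \<sigma>) ** Q)"
      by (simp only: rotation_skew[OF s(1)] Q_def matrix_mul_assoc)
    finally show ?thesis by (simp add: R\<sigma> error_field_def)
  qed
  ultimately show "((\<lambda>t. R t ** transpose (Rh t)) has_vector_derivative snd (f (R t *v (v t - vh t), R t ** transpose (Rh t)))) (at t within {0..})"
    by (simp only: w_def Q_def)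
qed

text \<open>The change to error variables inverts along a given vehicle trajectory, so global
  solutions of the error system supply global solutions of the observer.\<close>

lemma observer_solution:
  assumes err: "solution_on state_space (\<lambda>_. f) {0..} (\<lambda>t. (w t, Q t))"
  shows "solution_on state_space obs {0..} (\<lambda>t. (v t - transpose (R t) *v w t, transpose (Q t) ** R t))"
proof (rule solution_on_PairI)
  fix t :: real assume "t \<in> {0..}"
  then have t: "t \<ge> 0" by simp
  note s = sys_facts[OF t]
  have Q: "rotation_matrix (Q t)" and w': "(w has_vector_derivative fst (f (w t, Q t))) (at t within {0..})"
    and Q': "(Q has_vector_derivative snd (f (w t, Q t))) (at t within {0..})"
    using solution_on_PairD[OF err, of t] t by simp_all
  define vh where "vh = v t - transpose (R t) *v w t"
  define Rh where "Rh = transpose (Q t) ** R t"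
  define \<gamma> where "\<gamma> = transpose Rh *v e3"
  define \<sigma> where "\<sigma> = sigma_R k1r k2r (w t) (Q t *v e3) m (Q t *v m)"
  note Rt = rotation_matrix_transpose[OF s(1)]
  show "rotation_matrix (transpose (Q t) ** R t)" using s(1) Q by blast
  have \<gamma>: "\<gamma> = transpose (R t) *v (Q t *v e3)" and mh: "transpose Rh *v m = transpose (R t) *v (Q t *v m)"
    by (simp_all only: \<gamma>_def Rh_def matrix_transpose_mul transpose_transpose matrix_vector_mul_assoc)
  have d: "v t - vh = transpose (R t) *v w t" by (simp add: vh_def)
  have fst_f': "fst (f (w t, Q t)) = g *\<^sub>R (e3 - Q t *v e3) - sigma_v k1v k2v k1r (w t) (Q t *v e3)"
    by (simp add: error_field_def matrix_vector_mult_diff_rdistrib)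
  have snd_f': "snd (f (w t, Q t)) = - (skew \<sigma> ** Q t)" by (simp add: error_field_def \<sigma>_def)
  have obs: "obs t (vh, Rh) = (vh \<times> \<omega> t + a t + g *\<^sub>R \<gamma> + sigma_v k1v k2v k1r (transpose (R t) *v w t) \<gamma>,
      Rh ** skew (\<omega> t + transpose (R t) *v \<sigma>))"
    unfolding \<sigma>_def rotation_sigma_R[OF Rt] 
    by (simp only: observer_field_def Let_def split_conv \<gamma>_def[symmetric] d mh \<gamma>)
  have "((\<lambda>t. v t - transpose (R t) *v w t) has_vector_derivative (v t \<times> \<omega> t + a t + g *\<^sub>R (transpose (R t) *v e3))
      - (transpose (R t) *v fst (f (w t, Q t)) + transpose (R t ** skew (\<omega> t)) *v w t)) (at t within {0..})"
    by (intro has_vector_derivative_diff bounded_bilinear.has_vector_derivative[OF bounded_bilinear_matrix_vector_mult]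
       bounded_linear.has_vector_derivative[OF bounded_linear_transpose] s w')
  moreover have "(v t \<times> \<omega> t + a t + g *\<^sub>R (transpose (R t) *v e3))
      - (transpose (R t) *v fst (f (w t, Q t)) + transpose (R t ** skew (\<omega> t)) *v w t) = fst (obs t (vh, Rh))"
  proof -
    have "transpose (R t ** skew (\<omega> t)) *v w t = (transpose (R t) *v w t) \<times> \<omega> t"
      by (simp only: matrix_transpose_mul transpose_skew matrix_mult_minus matrix_vector_mul_assoc[symmetric] skew_mult_vector
        cross_skew[of "transpose (R t) *v w t"])
    moreover have "transpose (R t) *v fst (f (w t, Q t)) = g *\<^sub>R (transpose (R t) *v e3 - \<gamma>) - sigma_v k1v k2v k1r (transpose (R t) *v w t) \<gamma>"
      unfolding fst_f' \<gamma> by (simp only: matrix_vector_mult_diff_distrib matrix_vector_mult_scaleR rotation_sigma_v[OF Rt])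
    moreover have "fst (obs t (vh, Rh)) = vh \<times> \<omega> t + a t + g *\<^sub>R \<gamma> + sigma_v k1v k2v k1r (transpose (R t) *v w t) \<gamma>"
      by (simp only: obs fst_conv)
    ultimately show ?thesis
      by (simp only: vh_def Cross3.left_diff_distrib scaleR_diff_right) (simp add: algebra_simps)
  qed
  ultimately show "((\<lambda>t. v t - transpose (R t) *v w t) has_vector_derivative
      fst (obs t (v t - transpose (R t) *v w t, transpose (Q t) ** R t))) (at t within {0..})"
    by (simp only: vh_def Rh_def)
  have "((\<lambda>t. transpose (Q t) ** R t) has_vector_derivative
      transpose (Q t) ** (R t ** skew (\<omega> t)) + transpose (snd (f (w t, Q t))) ** R t) (at t within {0..})"
    by (intro bounded_bilinear.has_vector_derivative[OF bounded_bilinear_matrix_matrix_mult] s(3)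
       bounded_linear.has_vector_derivative[OF bounded_linear_transpose] Q')
  moreover have "transpose (Q t) ** (R t ** skew (\<omega> t)) + transpose (snd (f (w t, Q t))) ** R t = snd (obs t (vh, Rh))"
  proof -
    have "skew \<sigma> ** R t = R t ** skew (transpose (R t) *v \<sigma>)"
      by (simp only: rotation_skew[OF s(1)] rotation_matrix_inverses(4)[OF s(1)])
    moreover have "transpose (snd (f (w t, Q t))) = transpose (Q t) ** skew \<sigma>"
      by (simp only: snd_f' transpose_minus matrix_transpose_mul transpose_skew matrix_mult_minus minus_minus)
    ultimately have "transpose (snd (f (w t, Q t))) ** R t = Rh ** skew (transpose (R t) *v \<sigma>)"
      by (simp only: Rh_def matrix_mul_assoc[symmetric])
    moreover have "snd (obs t (vh, Rh)) = Rh ** skew (\<omega> t) + Rh ** skew (transpose (R t) *v \<sigma>)"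
      by (simp only: obs snd_conv linear_add[OF linear_skew] matrix_add_ldistrib)
    moreover have "transpose (Q t) ** (R t ** skew (\<omega> t)) = Rh ** skew (\<omega> t)"
      by (simp only: Rh_def matrix_mul_assoc)
    ultimately show ?thesis by simp
  qed
  ultimately show "((\<lambda>t. transpose (Q t) ** R t) has_vector_derivative
      snd (obs t (v t - transpose (R t) *v w t, transpose (Q t) ** R t))) (at t within {0..})"
    by (simp only: vh_def Rh_def)
qed

text \<open>For a fixed vehicle state the error is an affine function of the estimate, and the
  rotation \<open>R 0\<close> can be undone at bounded cost. This is the Lipschitz inverse that
  \<open>flat_vimage\<close> asks for.\<close>

lemma error_state_expanding:
  "\<exists>C\<ge>0. \<forall>x y. dist x y \<le> C * dist (error_state (v 0, R 0) x) (error_state (v 0, R 0) y)"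
proof -
  have R: "rotation_matrix (R 0)" by (rule sys_facts) simp
  obtain K1 where K1: "K1 > 0" "\<And>A B. norm ((A::real^3^3) ** (B::real^3^3)) \<le> norm A * norm B * K1"
    using bounded_bilinear.pos_bounded[OF bounded_bilinear_matrix_matrix_mult] by blast
  obtain K2 where K2: "K2 > 0" "\<And>A :: real^3^3. norm (transpose A) \<le> norm A * K2"
    using bounded_linear.pos_bounded[OF bounded_linear_transpose] by blast
  define C where "C = 1 + norm (transpose (R 0)) * K1 * K2"
  have C: "C \<ge> 0" using K1 K2 by (simp add: C_def)
  have "dist x y \<le> C * dist (error_state (v 0, R 0) x) (error_state (v 0, R 0) y)" for x y
  proof -
    define D where "D = error_state (v 0, R 0) x - error_state (v 0, R 0) y"
    have 1: "norm (fst x - fst y) = norm (fst D)"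
    proof -
      have "fst D = - (R 0 *v (fst x - fst y))"
        by (simp add: D_def error_state_def split_beta matrix_vector_mult_diff_distrib)
      then show ?thesis by (simp add: rotation_matrix_norm[OF R])
    qed
    have "snd x - snd y = transpose (transpose (R 0) ** snd D)"
    proof -
      have "snd D = R 0 ** (transpose (snd x) - transpose (snd y))"
        by (simp add: D_def error_state_def split_beta bounded_bilinear.diff_right[OF bounded_bilinear_matrix_matrix_mult])
      then have "transpose (R 0) ** snd D = transpose (snd x) - transpose (snd y)"
        by (simp add: matrix_mul_assoc rotation_matrix_inverses[OF R])
      then show ?thesis by (simp add: transpose_def vec_eq_iff)
    qed
    then have "norm (snd x - snd y) \<le> norm (transpose (R 0) ** snd D) * K2" using K2(2) by simp
    also have "\<dots> \<le> norm (transpose (R 0)) * norm (snd D) * K1 * K2"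
      using K1 K2 by (intro mult_right_mono) auto
    also have "\<dots> \<le> norm (transpose (R 0)) * norm D * K1 * K2"
      using K1 K2 norm_snd_le[of "snd D" "fst D"] by (intro mult_right_mono mult_left_mono) auto
    finally have 2: "norm (snd x - snd y) \<le> norm (transpose (R 0)) * norm D * K1 * K2" .
    have "dist x y \<le> norm (fst x - fst y) + norm (snd x - snd y)"
      using norm_Pair_le[of "fst x - fst y" "snd x - snd y"] by (simp add: dist_norm minus_prod_def)
    also have "\<dots> \<le> norm D + norm (transpose (R 0)) * norm D * K1 * K2"
      using 1 2 norm_fst_le[of "fst D" "snd D"] by (intro add_mono) auto
    finally show ?thesis by (simp add: C_def D_def dist_norm algebra_simps)
  qed
  then show ?thesis using C by blast
qed

definition converging :: "state \<Rightarrow> bool" where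
  "converging x0 \<longleftrightarrow> (\<exists>x. solution_on state_space obs {0..} x \<and> x 0 = x0) \<and>
     (\<forall>x. solution_on state_space obs {0..} x \<and> x 0 = x0 \<longrightarrow>
        ((\<lambda>t. error_state (v t, R t) (x t)) \<longlongrightarrow> origin) at_top)"

lemma converging_if_attracted:
  assumes "attracted state_space f origin (error_state (v 0, R 0) x0)"
  shows "converging x0"
  unfolding converging_def
proof (intro conjI allI impI)
  have R: "rotation_matrix (R 0)" by (rule sys_facts) simp
  obtain e where e: "solution_on state_space (\<lambda>_. f) {0..} e" "e 0 = error_state (v 0, R 0) x0"
    using assms unfolding attracted_def by blast
  have "solution_on state_space obs {0..} (\<lambda>t. (v t - transpose (R t) *v fst (e t), transpose (snd (e t)) ** R t))"
    by (rule observer_solution) (use e(1) in simp)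
  moreover have "(v 0 - transpose (R 0) *v fst (e 0), transpose (snd (e 0)) ** R 0) = x0"
    unfolding e(2) by (simp only: error_state_def split_beta fst_conv snd_conv rotation_matrix_inverses[OF R]
        matrix_transpose_mul transpose_transpose matrix_mul_assoc[symmetric] matrix_mul_rid) simp
  ultimately show "\<exists>x. solution_on state_space obs {0..} x \<and> x 0 = x0"
    by (intro exI[of _ "\<lambda>t. (v t - transpose (R t) *v fst (e t), transpose (snd (e t)) ** R t)"]) simp
  fix x assume x: "solution_on state_space obs {0..} x \<and> x 0 = x0"
  then have "solution_on state_space (\<lambda>_. f) {0..} (\<lambda>t. error_state (v t, R t) (fst (x t), snd (x t)))"
    by (intro error_solution) simp
  then have "solution_on state_space (\<lambda>_. f) {0..} (\<lambda>t. error_state (v t, R t) (x t))" by simp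
  moreover have "error_state (v 0, R 0) (x 0) = error_state (v 0, R 0) x0" using x by simp
  ultimately show "((\<lambda>t. error_state (v t, R t) (x t)) \<longlongrightarrow> origin) at_top"
    using assms[unfolded attracted_def, THEN conjunct2, THEN spec, of "\<lambda>t. error_state (v t, R t) (x t)"] by simp
qed

text \<open>The cover by flat sets is pulled back instead of the null set itself: flatness passes to
  preimages under maps with Lipschitz inverse and implies measure zero again.\<close>

lemma converging_almost_everywhere: "measure_zero {x0 \<in> state_space. \<not> converging x0}"
proof -
  have R: "rotation_matrix (R 0)" by (rule sys_facts) simp
  obtain P :: "nat \<Rightarrow> state set" where P: "\<And>n. flat (P n)"
    "{x0 \<in> state_space. \<not> attracted state_space f origin x0} \<subseteq> (\<Union>n. P n)"
    using exceptional_set_cover by blast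
  obtain C where C: "C \<ge> 0" "\<And>x y. dist x y \<le> C * dist (error_state (v 0, R 0) x) (error_state (v 0, R 0) y)"
    using error_state_expanding by blast
  show ?thesis
  proof (rule measure_zero_countable_flat)
    show "flat {x \<in> UNIV. error_state (v 0, R 0) x \<in> P n}" for n
      by (rule flat_vimage[OF P(1) C])
    show "{x0 \<in> state_space. \<not> converging x0} \<subseteq> (\<Union>n. {x \<in> UNIV. error_state (v 0, R 0) x \<in> P n})"
    proof
      fix x0 assume x0: "x0 \<in> {x0 \<in> state_space. \<not> converging x0}"
      then have "rotation_matrix (snd x0)" by (simp add: state_rotation)
      then have "error_state (v 0, R 0) x0 \<in> state_space"
        using rotation_matrix_mult[OF R rotation_matrix_transpose] by (simp add: error_state_def state_space_def split_beta)
      moreover have "\<not> attracted state_space f origin (error_state (v 0, R 0) x0)"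
        using x0 converging_if_attracted by blast
      ultimately show "x0 \<in> (\<Union>n. {x \<in> UNIV. error_state (v 0, R 0) x \<in> P n})" using P(2) by blast
    qed
  qed
qed

end

end

theorem theorem2:
  fixes g k1v k2v k1r k2r :: real and mI :: "real^3"
  assumes "g > 0" and "cross3 mI e3 \<noteq> 0"
    and "k1v > 0" and "k2v > 0" and "k1r > 0" and "k2r > 0"
  shows
    "(\<forall>v R \<omega> a vh Rh.
        solution_on state_space (system_field g \<omega> a) {0..} (\<lambda>t. (v t, R t)) \<and>
        solution_on state_space
          (observer_field g k1v k2v k1r k2r mI v \<omega> a (\<lambda>t. transpose (R t) *v mI)) {0..}
          (\<lambda>t. (vh t, Rh t)) \<longrightarrow>
        solution_on state_space (\<lambda>_. error_field g k1v k2v k1r k2r mI) {0..}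
          (\<lambda>t. error_state (v t, R t) (vh t, Rh t)))
     \<and>
     (card (equilibria state_space (error_field g k1v k2v k1r k2r mI)) = 4 \<and>
      (\<forall>p \<in> equilibria state_space (error_field g k1v k2v k1r k2r mI).
         p isolated_in equilibria state_space (error_field g k1v k2v k1r k2r mI)) \<and>
      (0, mat 1) \<in> equilibria state_space (error_field g k1v k2v k1r k2r mI))
     \<and>
     (locally_exponentially_stable state_space (error_field g k1v k2v k1r k2r mI) (0, mat 1) \<and>
      almost_globally_asymptotically_stable (error_field g k1v k2v k1r k2r mI) (0, mat 1) \<and>
      (\<forall>p \<in> equilibria state_space (error_field g k1v k2v k1r k2r mI) - {(0, mat 1)}.
         unstable_equilibrium state_space (error_field g k1v k2v k1r k2r mI) p) \<and>
      (\<forall>v R \<omega> a.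
         solution_on state_space (system_field g \<omega> a) {0..} (\<lambda>t. (v t, R t)) \<longrightarrow>
         measure_zero {x0 \<in> state_space.
           \<not> ((\<exists>x. solution_on state_space
                    (observer_field g k1v k2v k1r k2r mI v \<omega> a (\<lambda>t. transpose (R t) *v mI)) {0..} x
                  \<and> x 0 = x0) \<and>
              (\<forall>x. solution_on state_space
                    (observer_field g k1v k2v k1r k2r mI v \<omega> a (\<lambda>t. transpose (R t) *v mI)) {0..} x
                  \<and> x 0 = x0 \<longrightarrow>
                  ((\<lambda>t. error_state (v t, R t) (x t)) \<longlongrightarrow> (0, mat 1)) at_top))}))
     \<and>
     (\<exists>F G :: real^3 \<Rightarrow> real^3 \<Rightarrow> real^3 \<Rightarrow> real^3 \<Rightarrow> real^3 \<Rightarrow> real^3.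
        \<forall>v \<omega> a mB vh Rh.
          solution_on state_space (observer_field g k1v k2v k1r k2r mI v \<omega> a mB) {0..}
            (\<lambda>t. (vh t, Rh t)) \<longrightarrow>
          (\<forall>t\<ge>0.
            (vh has_vector_derivative
               F (vh t) (transpose (Rh t) *v e3) (v t) (\<omega> t) (a t)) (at t within {0..}) \<and>
            ((\<lambda>s. transpose (Rh s) *v e3) has_vector_derivative
               G (vh t) (transpose (Rh t) *v e3) (v t) (\<omega> t) (a t)) (at t within {0..})))"
proof -
  interpret observer g k1v k2v k1r k2r mI
    using assms by unfold_locales
  show ?thesis
  proof (intro conjI)
    show "\<forall>v R \<omega> a vh Rh.
        solution_on state_space (system_field g \<omega> a) {0..} (\<lambda>t. (v t, R t)) \<and>
        solution_on state_space
          (observer_field g k1v k2v k1r k2r mI v \<omega> a (\<lambda>t. transpose (R t) *v mI)) {0..}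
          (\<lambda>t. (vh t, Rh t)) \<longrightarrow>
        solution_on state_space (\<lambda>_. f) {0..} (\<lambda>t. error_state (v t, R t) (vh t, Rh t))"
      by (intro allI impI, elim conjE) (rule error_solution)
    show "card (equilibria state_space f) = 4" by (rule card_equilibria)
    show "\<forall>p \<in> equilibria state_space f. p isolated_in equilibria state_space f"
      by (intro ballI equilibria_isolated)
    show "(0, mat 1) \<in> equilibria state_space f"
      using origin_equilibrium by (simp add: origin_def)
    show "locally_exponentially_stable state_space f (0, mat 1)"
      using origin_exponentially_stable by (simp add: origin_def)
    show "almost_globally_asymptotically_stable f (0, mat 1)"
      using origin_almost_globally_stable by (simp add: origin_def)
    show "\<forall>p \<in> equilibria state_space f - {(0, mat 1)}. unstable_equilibrium state_space f p"
      using other_equilibria_unstable by (simp add: origin_def)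
    show "\<forall>v R \<omega> a.
         solution_on state_space (system_field g \<omega> a) {0..} (\<lambda>t. (v t, R t)) \<longrightarrow>
         measure_zero {x0 \<in> state_space.
           \<not> ((\<exists>x. solution_on state_space
                    (observer_field g k1v k2v k1r k2r mI v \<omega> a (\<lambda>t. transpose (R t) *v mI)) {0..} x
                  \<and> x 0 = x0) \<and>
              (\<forall>x. solution_on state_space
                    (observer_field g k1v k2v k1r k2r mI v \<omega> a (\<lambda>t. transpose (R t) *v mI)) {0..} x
                  \<and> x 0 = x0 \<longrightarrow>
                  ((\<lambda>t. error_state (v t, R t) (x t)) \<longlongrightarrow> (0, mat 1)) at_top))}"
    proof (intro allI impI)
      fix v R \<omega> a
      assume sys: "solution_on state_space (system_field g \<omega> a) {0..} (\<lambda>t. (v t, R t))"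
      from converging_almost_everywhere[OF sys]
      show "measure_zero {x0 \<in> state_space.
           \<not> ((\<exists>x. solution_on state_space
                    (observer_field g k1v k2v k1r k2r mI v \<omega> a (\<lambda>t. transpose (R t) *v mI)) {0..} x
                  \<and> x 0 = x0) \<and>
              (\<forall>x. solution_on state_space
                    (observer_field g k1v k2v k1r k2r mI v \<omega> a (\<lambda>t. transpose (R t) *v mI)) {0..} x
                  \<and> x 0 = x0 \<longrightarrow>
                  ((\<lambda>t. error_state (v t, R t) (x t)) \<longlongrightarrow> (0, mat 1)) at_top))}"
        unfolding converging_def[OF sys] origin_def .
    qed
    show "\<exists>F G :: real^3 \<Rightarrow> real^3 \<Rightarrow> real^3 \<Rightarrow> real^3 \<Rightarrow> real^3 \<Rightarrow> real^3.
        \<forall>v \<omega> a mB vh Rh.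
          solution_on state_space (observer_field g k1v k2v k1r k2r mI v \<omega> a mB) {0..}
            (\<lambda>t. (vh t, Rh t)) \<longrightarrow>
          (\<forall>t\<ge>0.
            (vh has_vector_derivative
               F (vh t) (transpose (Rh t) *v e3) (v t) (\<omega> t) (a t)) (at t within {0..}) \<and>
            ((\<lambda>s. transpose (Rh s) *v e3) has_vector_derivative
               G (vh t) (transpose (Rh t) *v e3) (v t) (\<omega> t) (a t)) (at t within {0..}))"
    proof (rule exI[of _ "\<lambda>u \<gamma> v w a. u \<times> w + a + g *\<^sub>R \<gamma> + sigma_v k1v k2v k1r (v - u) \<gamma>"],
        rule exI[of _ "\<lambda>u \<gamma> v w a. \<gamma> \<times> (w + k1r *\<^sub>R ((v - u) \<times> \<gamma>))"], intro allI impI conjI)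
      fix v \<omega> a mB vh Rh and t :: real
      assume sol: "solution_on state_space (observer_field g k1v k2v k1r k2r mI v \<omega> a mB) {0..} (\<lambda>t. (vh t, Rh t))"
        and "0 \<le> t"
      then have t: "t \<in> {0..}" by simp
      show "(vh has_vector_derivative vh t \<times> \<omega> t + a t + g *\<^sub>R (transpose (Rh t) *v e3)
          + sigma_v k1v k2v k1r (v t - vh t) (transpose (Rh t) *v e3)) (at t within {0..})"
        using solution_on_PairD(2)[OF sol t] by (simp add: observer_field_def Let_def)
      show "((\<lambda>s. transpose (Rh s) *v e3) has_vector_derivative
         (transpose (Rh t) *v e3) \<times> (\<omega> t + k1r *\<^sub>R ((v t - vh t) \<times> (transpose (Rh t) *v e3)))) (at t within {0..})"
        by (rule observer_tilt_dynamics[OF sol t])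
    qed
  qed
qed

end
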